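(* Let $\Omega$ be a bounded domain in $\mathbb{C}^n$, let $\mathcal{E}$ be a Hilbert space, let $\mathcal{H}_g$ be a good reproducing kernel Hilbert module on $\Omega$ (with scalar good kernel $g$), and let $\mathcal{H}_K\subseteq\mathcal{O}(\Omega,\mathcal{E})$ be a reproducing kernel Hilbert module over $\mathbb{C}[\boldsymbol{z}]$ with $\mathcal{B}(\mathcal{E})$-valued kernel $K$. Then the following conditions are equivalent: (1) There exists a Hilbert space $\mathcal{E}_*$ such that the following two (mutually equivalent, for given $\mathcal{E}_*$) conditions hold: (a) $\mathcal{H}_K$ dilates to $\mathcal{H}_g\otimes\mathcal{E}_*$; (b) there exists a holomorphic function $\Phi:\Omega\to\mathcal{B}(\mathcal{E}_*,\mathcal{E})$ such that $K(\boldsymbol{z},\boldsymbol{w})=g(\boldsymbol{z},\boldsymbol{w})\Phi(\boldsymbol{z})\Phi(\boldsymbol{w})^*$ for all $\boldsymbol{z},\boldsymbol{w}\in\Omega$. (2) There exists a $\mathcal{B}(\mathcal{E})$-valued kernel $L$ on $\Omega$, holomorphic in the first and anti-holomorphic in the second variable, such that $K=gL$.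
   Context: All Hilbert spaces are complex. A $\mathcal{B}(\mathcal{E})$-valued kernel on $\Omega$ is a function $K:\Omega\times\Omega\to\mathcal{B}(\mathcal{E})$ with $\sum_{p,q=1}^m\langle K(x_p,x_q)\eta_q,\eta_p\rangle\ge 0$ for all $m\in\mathbb{N}$, $x_j\in\Omega$, $\eta_j\in\mathcal{E}$; $\mathcal{H}_K$ is the associated reproducing kernel Hilbert space of $\mathcal{E}$-valued functions, in which the functions $K(\cdot,\boldsymbol{w})\eta$ are total and $\langle f(\boldsymbol{w}),\eta\rangle_{\mathcal{E}}=\langle f,K(\cdot,\boldsymbol{w})\eta\rangle_{\mathcal{H}_K}$. Scalar kernels are the case $\mathcal{E}=\mathbb{C}$. Standing assumptions: the kernels $K(\boldsymbol{z},\boldsymbol{w})$ and $g(\boldsymbol{z},\boldsymbol{w})$ are holomorphic in $\boldsymbol{z}=(z_1,\dots,z_n)$ and anti-holomorphic in $\boldsymbol{w}$, so that $\mathcal{H}_K\subseteq\mathcal{O}(\Omega,\mathcal{E})$ (holomorphic $\mathcal{E}$-valued functions), and $K(\cdot,\boldsymbol{w})\ne0$ for all $\boldsymbol{w}\in\Omega$. $\mathcal{H}_K$ is a reproducing kernel Hilbert module (over $\mathbb{C}[\boldsymbol{z}]$) if $z_j\mathcal{H}_K\subseteq\mathcal{H}_K$ for $j=1,\dots,n$; then $M_{z_j}$ denotes the bounded operator $(M_{z_j}f)(\boldsymbol{w})=w_jf(\boldsymbol{w})$ on $\mathcal{H}_K$. A scalar-valued kernel $g$ on $\Omega$ is a good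 kernel (and $\mathcal{H}_g$ is a good reproducing kernel Hilbert module) if $\mathcal{H}_g$ is a reproducing kernel Hilbert module, $\bigcap_{j=1}^n\ker(M_{z_j}^*-\bar w_jI_{\mathcal{H}_g})=\mathbb{C}\,g(\cdot,\boldsymbol{w})$ for all $\boldsymbol{w}\in\Omega$, and there exists $\boldsymbol{w}_0\in\Omega$ with $g(\cdot,\boldsymbol{w}_0)\equiv 1$. $\mathcal{H}_K$ dilates to $\mathcal{H}_g\otimes\mathcal{E}_*$ if there exists an isometry $\Pi:\mathcal{H}_K\to\mathcal{H}_g\otimes\mathcal{E}_*$ such that $(M_{z_i}^*\otimes I_{\mathcal{E}_*})\Pi=\Pi M_{z_i}^*$ for $i=1,\dots,n$. *)

theory Defs
  imports "HOL-Analysis.Analysis" "HOL-Library.Function_Algebras"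
begin

section \<open>Complex vector spaces\<close>

class complex_vector = ab_group_add +
  fixes scaleC :: "complex \<Rightarrow> 'a \<Rightarrow> 'a" (infixr \<open>*\<^sub>C\<close> 75)
  assumes scaleC_add_right: "a *\<^sub>C (x + y) = a *\<^sub>C x + a *\<^sub>C y"
    and scaleC_add_left: "(a + b) *\<^sub>C x = a *\<^sub>C x + b *\<^sub>C x"
    and scaleC_scaleC: "a *\<^sub>C b *\<^sub>C x = (a * b) *\<^sub>C x"
    and scaleC_one: "1 *\<^sub>C x = x"

instantiation complex :: complex_vector
begin
definition scaleC_complex :: "complex \<Rightarrow> complex \<Rightarrow> complex"
  where "a *\<^sub>C x = a * (x::complex)"
instance
  by standard (simp_all add: scaleC_complex_def algebra_simps)
end

instantiation "fun" :: (type, complex_vector) complex_vector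
begin
definition scaleC_fun :: "complex \<Rightarrow> ('a \<Rightarrow> 'b) \<Rightarrow> 'a \<Rightarrow> 'b"
  where "a *\<^sub>C f = (\<lambda>x. a *\<^sub>C f x)"
instance
  by standard
    (simp_all add: scaleC_fun_def plus_fun_def scaleC_add_right scaleC_add_left scaleC_scaleC scaleC_one)
end

global_interpretation complex_vector: vector_space "scaleC :: complex \<Rightarrow> 'a \<Rightarrow> 'a::complex_vector"
  defines csubspace = complex_vector.subspace
    and cspan = complex_vector.span
  by unfold_locales (rule scaleC_add_right scaleC_add_left scaleC_scaleC scaleC_one)+


section \<open>Complex Hilbert spaces\<close>

text \<open>
  A Hilbert space is a linear subspace of an ambient complex vector space together with an inner
  product (linear in the first argument); the values of the inner product off the subspace are
  irrelevant. Carriers, rather than one type per space, are needed because reproducing kernel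
  spaces depend on the kernel and because the theorem quantifies existentially over Hilbert spaces.
\<close>

record 'a hspace =
  hset :: "'a set"
  hip :: "'a \<Rightarrow> 'a \<Rightarrow> complex"

definition hnorm :: "'a hspace \<Rightarrow> 'a \<Rightarrow> real"
  where "hnorm H x = sqrt (Re (hip H x x))"

definition inner_product_space :: "'a::complex_vector hspace \<Rightarrow> bool" where
  "inner_product_space H \<longleftrightarrow>
     csubspace (hset H) \<and>
     (\<forall>x\<in>hset H. \<forall>y\<in>hset H. \<forall>z\<in>hset H. hip H (x + y) z = hip H x z + hip H y z) \<and>
     (\<forall>a. \<forall>x\<in>hset H. \<forall>y\<in>hset H. hip H (a *\<^sub>C x) y = a * hip H x y) \<and>
     (\<forall>x\<in>hset H. \<forall>y\<in>hset H. hip H y x = cnj (hip H x y)) \<and>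
     (\<forall>x\<in>hset H. 0 \<le> Re (hip H x x)) \<and>
     (\<forall>x\<in>hset H. hip H x x = 0 \<longrightarrow> x = 0)"

definition hilbert_space :: "'a::complex_vector hspace \<Rightarrow> bool" where
  "hilbert_space H \<longleftrightarrow>
     inner_product_space H \<and>
     (\<forall>X. (\<forall>n. X n \<in> hset H) \<and> (\<forall>e>0. \<exists>N. \<forall>m\<ge>N. \<forall>n\<ge>N. hnorm H (X m - X n) < e) \<longrightarrow>
          (\<exists>x\<in>hset H. (\<lambda>n. hnorm H (X n - x)) \<longlonglongrightarrow> 0))"

definition complex_hspace :: "complex hspace"
  where "complex_hspace = \<lparr>hset = UNIV, hip = (\<lambda>x y. x * cnj y)\<rparr>"

definition total_in :: "'a::complex_vector hspace \<Rightarrow> 'a set \<Rightarrow> bool" where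
  "total_in H S \<longleftrightarrow>
     S \<subseteq> hset H \<and> (\<forall>x\<in>hset H. \<forall>e>0. \<exists>y\<in>cspan S. hnorm H (x - y) < e)"


section \<open>Bounded operators\<close>

text \<open>
  Functions defined on a set are represented by total functions that vanish off that set, so that
  equality of operators on a Hilbert space (and of functions on \<open>\<Omega>\<close>) is equality in the logic.
\<close>

definition zero_ext :: "'a set \<Rightarrow> ('a \<Rightarrow> 'b) \<Rightarrow> 'a \<Rightarrow> 'b::zero"
  where "zero_ext A f = (\<lambda>x. if x \<in> A then f x else 0)"

definition linear_ops :: "'a::complex_vector hspace \<Rightarrow> 'b::complex_vector hspace \<Rightarrow> ('a \<Rightarrow> 'b) set" where
  "linear_ops E F = {T.
     (\<forall>x\<in>hset E. T x \<in> hset F) \<and> (\<forall>x. x \<notin> hset E \<longrightarrow> T x = 0) \<and>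
     (\<forall>x\<in>hset E. \<forall>y\<in>hset E. T (x + y) = T x + T y) \<and>
     (\<forall>a. \<forall>x\<in>hset E. T (a *\<^sub>C x) = a *\<^sub>C T x)}"

definition bounded_ops :: "'a::complex_vector hspace \<Rightarrow> 'b::complex_vector hspace \<Rightarrow> ('a \<Rightarrow> 'b) set" where
  "bounded_ops E F = {T \<in> linear_ops E F. \<exists>C. \<forall>x\<in>hset E. hnorm F (T x) \<le> C * hnorm E x}"

definition opnorm :: "'a::complex_vector hspace \<Rightarrow> 'b::complex_vector hspace \<Rightarrow> ('a \<Rightarrow> 'b) \<Rightarrow> real" where
  "opnorm E F T = (SUP x \<in> {x \<in> hset E. hnorm E x \<le> 1}. hnorm F (T x))"

definition isometries :: "'a::complex_vector hspace \<Rightarrow> 'b::complex_vector hspace \<Rightarrow> ('a \<Rightarrow> 'b) set" where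
  "isometries E F = {T \<in> linear_ops E F. \<forall>x\<in>hset E. hnorm F (T x) = hnorm E x}"

definition adj :: "'a::complex_vector hspace \<Rightarrow> 'b::complex_vector hspace \<Rightarrow> ('a \<Rightarrow> 'b) \<Rightarrow> 'b \<Rightarrow> 'a" where
  "adj E F T = zero_ext (hset F)
     (\<lambda>y. THE x. x \<in> hset E \<and> (\<forall>u\<in>hset E. hip F (T u) y = hip E u x))"

definition id_op :: "'a::complex_vector hspace \<Rightarrow> 'a \<Rightarrow> 'a"
  where "id_op E = zero_ext (hset E) (\<lambda>x. x)"


section \<open>Hilbert space tensor products\<close>

text \<open>\<open>T\<close> with the bilinear map \<open>\<tau>\<close> is (a model of) the completed tensor product \<open>H \<otimes> E\<close>,
  \<open>\<tau> h e\<close> being the elementary tensor; this determines \<open>(T, \<tau>)\<close> up to a unique unitary map.\<close>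

definition is_tensor_product ::
  "'a::complex_vector hspace \<Rightarrow> 'b::complex_vector hspace \<Rightarrow>
   't::complex_vector hspace \<Rightarrow> ('a \<Rightarrow> 'b \<Rightarrow> 't) \<Rightarrow> bool" where
  "is_tensor_product H E T \<tau> \<longleftrightarrow>
     hilbert_space T \<and>
     (\<forall>h\<in>hset H. \<forall>k\<in>hset H. \<forall>e\<in>hset E. \<tau> (h + k) e = \<tau> h e + \<tau> k e) \<and>
     (\<forall>h\<in>hset H. \<forall>d\<in>hset E. \<forall>e\<in>hset E. \<tau> h (d + e) = \<tau> h d + \<tau> h e) \<and>
     (\<forall>a. \<forall>h\<in>hset H. \<forall>e\<in>hset E. \<tau> (a *\<^sub>C h) e = a *\<^sub>C \<tau> h e \<and> \<tau> h (a *\<^sub>C e) = a *\<^sub>C \<tau> h e) \<and>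
     (\<forall>h\<in>hset H. \<forall>k\<in>hset H. \<forall>d\<in>hset E. \<forall>e\<in>hset E.
        hip T (\<tau> h d) (\<tau> k e) = hip H h k * hip E d e) \<and>
     total_in T {\<tau> h e | h e. h \<in> hset H \<and> e \<in> hset E}"

text \<open>The operator \<open>A \<otimes> B\<close> on \<open>H \<otimes> E\<close>, for bounded operators \<open>A\<close> on \<open>H\<close> and \<open>B\<close> on \<open>E\<close>.\<close>

definition tensor_op ::
  "'a::complex_vector hspace \<Rightarrow> 'b::complex_vector hspace \<Rightarrow>
   't::complex_vector hspace \<Rightarrow> ('a \<Rightarrow> 'b \<Rightarrow> 't) \<Rightarrow> ('a \<Rightarrow> 'a) \<Rightarrow> ('b \<Rightarrow> 'b) \<Rightarrow> 't \<Rightarrow> 't" where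
  "tensor_op H E T \<tau> A B =
     (THE R. R \<in> bounded_ops T T \<and> (\<forall>h\<in>hset H. \<forall>e\<in>hset E. R (\<tau> h e) = \<tau> (A h) (B e)))"


section \<open>Holomorphic functions of several variables with values in a normed space\<close>

text \<open>
  Complex Frechet differentiability on the open set \<open>\<Omega>\<close> of a function with values in the complex
  normed space \<open>(V, \<nu>)\<close>. The parameter \<open>\<sigma>\<close> is the identity for holomorphic functions (complex linear
  derivative) and complex conjugation for anti-holomorphic ones (conjugate-linear derivative).
\<close>

definition differentiable_into ::
  "(complex \<Rightarrow> complex) \<Rightarrow> 'v::complex_vector set \<Rightarrow> ('v \<Rightarrow> real) \<Rightarrow>
   (complex ^ 'n) set \<Rightarrow> (complex ^ 'n \<Rightarrow> 'v) \<Rightarrow> bool" where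
  "differentiable_into \<sigma> V \<nu> \<Omega> f \<longleftrightarrow>
     (\<forall>z\<in>\<Omega>. f z \<in> V) \<and>
     (\<forall>z\<in>\<Omega>. \<exists>D.
        (\<forall>h. D h \<in> V) \<and>
        (\<forall>h k. D (h + k) = D h + D k) \<and>
        (\<forall>a h. D (a *s h) = \<sigma> a *\<^sub>C D h) \<and>
        ((\<lambda>h. \<nu> (f (z + h) - f z - D h) / norm h) \<longlongrightarrow> 0) (at 0))"

abbreviation "holomorphic_into \<equiv> differentiable_into (\<lambda>a. a)"
abbreviation "antiholomorphic_into \<equiv> differentiable_into cnj"

text \<open>Holomorphic in the first and anti-holomorphic in the second variable, with values in
  \<open>\<B>(\<E>)\<close> under the operator norm.\<close>

definition sesqui_holomorphic ::
  "'e::complex_vector hspace \<Rightarrow> (complex ^ 'n) set \<Rightarrow>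
   (complex ^ 'n \<Rightarrow> complex ^ 'n \<Rightarrow> 'e \<Rightarrow> 'e) \<Rightarrow> bool" where
  "sesqui_holomorphic E \<Omega> K \<longleftrightarrow>
     (\<forall>w\<in>\<Omega>. holomorphic_into (bounded_ops E E) (opnorm E E) \<Omega> (\<lambda>z. K z w)) \<and>
     (\<forall>z\<in>\<Omega>. antiholomorphic_into (bounded_ops E E) (opnorm E E) \<Omega> (\<lambda>w. K z w))"

definition bounded_domain :: "(complex ^ 'n) set \<Rightarrow> bool" where
  "bounded_domain \<Omega> \<longleftrightarrow> bounded \<Omega> \<and> open \<Omega> \<and> connected \<Omega> \<and> \<Omega> \<noteq> {}"


section \<open>Kernels and reproducing kernel Hilbert modules\<close>

definition is_kernel ::
  "'e::complex_vector hspace \<Rightarrow> 'x set \<Rightarrow> ('x \<Rightarrow> 'x \<Rightarrow> 'e \<Rightarrow> 'e) \<Rightarrow> bool" where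
  "is_kernel E \<Omega> K \<longleftrightarrow>
     (\<forall>z\<in>\<Omega>. \<forall>w\<in>\<Omega>. K z w \<in> bounded_ops E E) \<and>
     (\<forall>(m::nat) x \<eta>. (\<forall>j<m. x j \<in> \<Omega> \<and> \<eta> j \<in> hset E) \<longrightarrow>
        (\<Sum>p<m. \<Sum>q<m. hip E (K (x p) (x q) (\<eta> q)) (\<eta> p)) \<in> \<real>\<^sub>\<ge>\<^sub>0)"

text \<open>A scalar function of two variables as a \<open>\<B>(\<complex>)\<close>-valued one.\<close>

definition scalar_kernel :: "('x \<Rightarrow> 'x \<Rightarrow> complex) \<Rightarrow> 'x \<Rightarrow> 'x \<Rightarrow> complex \<Rightarrow> complex"
  where "scalar_kernel g z w = (\<lambda>\<eta>. g z w * \<eta>)"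

definition kernel_fun ::
  "'x set \<Rightarrow> ('x \<Rightarrow> 'x \<Rightarrow> 'e \<Rightarrow> 'e::complex_vector) \<Rightarrow> 'x \<Rightarrow> 'e \<Rightarrow> 'x \<Rightarrow> 'e"
  where "kernel_fun \<Omega> K w \<eta> = zero_ext \<Omega> (\<lambda>z. K z w \<eta>)"

text \<open>\<open>H\<close> is the reproducing kernel Hilbert space \<open>\<H>\<^sub>K\<close>, with pointwise operations; the properties
  below determine both its elements and its inner product.\<close>

definition is_rkhs ::
  "'e::complex_vector hspace \<Rightarrow> 'x set \<Rightarrow> ('x \<Rightarrow> 'x \<Rightarrow> 'e \<Rightarrow> 'e) \<Rightarrow> ('x \<Rightarrow> 'e) hspace \<Rightarrow> bool" where
  "is_rkhs E \<Omega> K H \<longleftrightarrow>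
     hilbert_space H \<and>
     (\<forall>f\<in>hset H. (\<forall>w\<in>\<Omega>. f w \<in> hset E) \<and> (\<forall>w. w \<notin> \<Omega> \<longrightarrow> f w = 0)) \<and>
     total_in H {kernel_fun \<Omega> K w \<eta> | w \<eta>. w \<in> \<Omega> \<and> \<eta> \<in> hset E} \<and>
     (\<forall>f\<in>hset H. \<forall>w\<in>\<Omega>. \<forall>\<eta>\<in>hset E. hip E (f w) \<eta> = hip H f (kernel_fun \<Omega> K w \<eta>))"

definition coord_mult :: "'n \<Rightarrow> (complex ^ 'n \<Rightarrow> 'e) \<Rightarrow> complex ^ 'n \<Rightarrow> 'e::complex_vector"
  where "coord_mult j f = (\<lambda>w. (w $ j) *\<^sub>C f w)"

definition is_module :: "(complex ^ 'n \<Rightarrow> 'e::complex_vector) hspace \<Rightarrow> bool"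
  where "is_module H \<longleftrightarrow> (\<forall>j. \<forall>f\<in>hset H. coord_mult j f \<in> hset H)"

definition M_op ::
  "(complex ^ 'n \<Rightarrow> 'e) hspace \<Rightarrow> 'n \<Rightarrow> (complex ^ 'n \<Rightarrow> 'e) \<Rightarrow> complex ^ 'n \<Rightarrow> 'e::complex_vector"
  where "M_op H j = zero_ext (hset H) (coord_mult j)"

definition good_kernel ::
  "(complex ^ 'n) set \<Rightarrow> (complex ^ 'n \<Rightarrow> complex ^ 'n \<Rightarrow> complex) \<Rightarrow>
   (complex ^ 'n \<Rightarrow> complex) hspace \<Rightarrow> bool" where
  "good_kernel \<Omega> g H \<longleftrightarrow>
     is_kernel complex_hspace \<Omega> (scalar_kernel g) \<and>
     is_rkhs complex_hspace \<Omega> (scalar_kernel g) H \<and>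
     is_module H \<and>
     (\<forall>w\<in>\<Omega>. (\<Inter>j. {f \<in> hset H. adj H H (M_op H j) f - cnj (w $ j) *\<^sub>C f = 0})
              = range (\<lambda>c. c *\<^sub>C zero_ext \<Omega> (\<lambda>z. g z w))) \<and>
     (\<exists>w0\<in>\<Omega>. \<forall>z\<in>\<Omega>. g z w0 = 1)"


section \<open>Dilations and factorizations\<close>

text \<open>
  The model \<open>(T, \<tau>)\<close> of \<open>\<H>\<^sub>g \<otimes> \<E>\<^sub>*\<close> is sought among spaces of functions on \<open>\<H>\<^sub>g \<times> \<E>\<^sub>*\<close>. Every tensor
  product has a copy there, via \<open>t \<mapsto> ((h, e) \<mapsto> \<langle>t, h \<otimes> e\<rangle>)\<close>, and since tensor products are unique
  up to unitary equivalence the choice of the model does not matter.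
\<close>

definition dilates ::
  "(complex ^ 'n \<Rightarrow> 'e::complex_vector) hspace \<Rightarrow> (complex ^ 'n \<Rightarrow> complex) hspace \<Rightarrow>
   'f::complex_vector hspace \<Rightarrow> bool" where
  "dilates HK Hg F \<longleftrightarrow>
     (\<exists>(T :: ((complex ^ 'n \<Rightarrow> complex) \<times> 'f \<Rightarrow> complex) hspace) \<tau>.
        is_tensor_product Hg F T \<tau> \<and>
        (\<exists>V \<in> isometries HK T. \<forall>i.
           tensor_op Hg F T \<tau> (adj Hg Hg (M_op Hg i)) (id_op F) \<circ> V = V \<circ> adj HK HK (M_op HK i)))"

definition factors ::
  "'e::complex_vector hspace \<Rightarrow> (complex ^ 'n) set \<Rightarrow>
   (complex ^ 'n \<Rightarrow> complex ^ 'n \<Rightarrow> 'e \<Rightarrow> 'e) \<Rightarrow>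
   (complex ^ 'n \<Rightarrow> complex ^ 'n \<Rightarrow> complex) \<Rightarrow> 'f::complex_vector hspace \<Rightarrow> bool" where
  "factors E \<Omega> K g F \<longleftrightarrow>
     (\<exists>\<Phi>. holomorphic_into (bounded_ops F E) (opnorm F E) \<Omega> \<Phi> \<and>
          (\<forall>z\<in>\<Omega>. \<forall>w\<in>\<Omega>. K z w = g z w *\<^sub>C (\<Phi> z \<circ> adj F E (\<Phi> w))))"

end

theory Submission
  imports Defs "HOL-Complex_Analysis.Cauchy_Integral_Formula"
begin

text \<open>
  If \<open>V\<close> dilates \<open>\<H>\<^sub>K\<close> to \<open>\<H>\<^sub>g \<otimes> F\<close>, then \<open>V K(\<cdot>, w)\<eta>\<close> is a joint eigenvector of the operators
  \<open>M\<^sub>i\<^sup>* \<otimes> I\<close> for the eigenvalues \<open>cnj w\<^sub>i\<close>. Since \<open>g\<close> is good, these eigenvectors are exactly the tensors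
  \<open>g(\<cdot>, w) \<otimes> f\<close>, so \<open>V K(\<cdot>, w)\<eta> = g(\<cdot>, w) \<otimes> \<Phi>(w)\<^sup>*\<eta>\<close>; comparing inner products gives
  \<open>K(z, w) = g(z, w) \<Phi>(z) \<Phi>(w)\<^sup>*\<close>. With \<open>J f = g(\<cdot>, w\<^sub>0) \<otimes> f\<close> for the point \<open>w\<^sub>0\<close> where
  \<open>g(\<cdot>, w\<^sub>0) = 1\<close>, one has \<open>\<Phi>(w) f = (V\<^sup>* J f)(w)\<close>, which is holomorphic in \<open>w\<close>; local boundedness of
  point evaluations (uniform boundedness) and Cauchy estimates upgrade this to the operator norm.
  Conversely the same formula defines an isometry \<open>V\<close> on kernel functions. A kernel \<open>L\<close> with
  \<open>K = g L\<close> yields \<open>\<Phi>\<close> as point evaluation on \<open>\<H>\<^sub>L\<close>.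
\<close>

section \<open>Inner product spaces with a carrier\<close>

text \<open>Two analytic facts do not come with the hypotheses. A module is only required to be
  invariant under the coordinate functions, and its elements are holomorphic one at a time; the
  boundedness of \<open>M_op\<close> and a common bound for the point evaluations near a point must
  be derived, and both come from one uniform boundedness principle. Cauchy estimates then work
  because the remainder of second order is bounded linearly in the supremum of the function: for
  \<Phi>(w) f it is at most a constant times ||f|| ||h||^2, hence uniform over the unit ball of f. A
  second obstacle is that completions must again consist of functions. The reproducing property lets
  pointwise limits stand for Cauchy sequences without loss, and one existence theorem then provides
  both the space of L and, from the kernel <h', h> <e', e> on pairs, the tensor product. Positivity
  of Schur products is used for this kernel and for the boundedness of A tensor I. A linear map
  prescribed on generators is not known to be well defined, so it is first treated as a relation;
  single-valuedness follows from the norm bound.\<close>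

lemma inner_product_spaceD:
  assumes "inner_product_space H"
  shows hset_zero: "0 \<in> hset H"
    and hset_add: "x \<in> hset H \<Longrightarrow> y \<in> hset H \<Longrightarrow> x + y \<in> hset H"
    and hset_scale: "x \<in> hset H \<Longrightarrow> a *\<^sub>C x \<in> hset H"
    and hset_diff: "x \<in> hset H \<Longrightarrow> y \<in> hset H \<Longrightarrow> x - y \<in> hset H"
    and hset_minus: "x \<in> hset H \<Longrightarrow> - x \<in> hset H"
    and hset_sum: "(\<And>i. i \<in> I \<Longrightarrow> f i \<in> hset H) \<Longrightarrow> (\<Sum>i\<in>I. f i) \<in> hset H"
  using assms unfolding inner_product_space_def
  by (auto intro: complex_vector.subspace_0 complex_vector.subspace_add complex_vector.subspace_scale
      complex_vector.subspace_diff complex_vector.subspace_neg complex_vector.subspace_sum)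

lemma inner_product_spaceD_hip:
  assumes "inner_product_space H"
  shows hip_add_left: "x \<in> hset H \<Longrightarrow> y \<in> hset H \<Longrightarrow> z \<in> hset H \<Longrightarrow>
      hip H (x + y) z = hip H x z + hip H y z"
    and hip_scale_left: "x \<in> hset H \<Longrightarrow> y \<in> hset H \<Longrightarrow> hip H (a *\<^sub>C x) y = a * hip H x y"
    and hip_commute: "x \<in> hset H \<Longrightarrow> y \<in> hset H \<Longrightarrow> hip H y x = cnj (hip H x y)"
    and hip_self_nonneg: "x \<in> hset H \<Longrightarrow> 0 \<le> Re (hip H x x)"
    and hip_self_zero: "x \<in> hset H \<Longrightarrow> hip H x x = 0 \<Longrightarrow> x = 0"
  proof -
  have *: "\<forall>x\<in>hset H. \<forall>y\<in>hset H. \<forall>z\<in>hset H. hip H (x + y) z = hip H x z + hip H y z"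
    "\<forall>a. \<forall>x\<in>hset H. \<forall>y\<in>hset H. hip H (a *\<^sub>C x) y = a * hip H x y"
    "\<forall>x\<in>hset H. \<forall>y\<in>hset H. hip H y x = cnj (hip H x y)"
    "\<forall>x\<in>hset H. 0 \<le> Re (hip H x x)"
    "\<forall>x\<in>hset H. hip H x x = 0 \<longrightarrow> x = 0"
    using assms unfolding inner_product_space_def by - (elim conjE, assumption)+
  show "x \<in> hset H \<Longrightarrow> y \<in> hset H \<Longrightarrow> z \<in> hset H \<Longrightarrow> hip H (x + y) z = hip H x z + hip H y z"
    "x \<in> hset H \<Longrightarrow> y \<in> hset H \<Longrightarrow> hip H (a *\<^sub>C x) y = a * hip H x y"
    "x \<in> hset H \<Longrightarrow> y \<in> hset H \<Longrightarrow> hip H y x = cnj (hip H x y)"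
    "x \<in> hset H \<Longrightarrow> 0 \<le> Re (hip H x x)"
    "x \<in> hset H \<Longrightarrow> hip H x x = 0 \<Longrightarrow> x = 0"
    by (rule *[rule_format]; assumption)+
qed

lemma hilbert_space_ips [simp, intro]: "hilbert_space H \<Longrightarrow> inner_product_space H"
  by (simp add: hilbert_space_def)

context
  fixes H :: "'a::complex_vector hspace"
  assumes ips: "inner_product_space H"
begin

lemma hip_add_right:
  assumes "x \<in> hset H" "y \<in> hset H" "z \<in> hset H"
  shows "hip H x (y + z) = hip H x y + hip H x z"
  using assms hip_commute[OF ips] hip_add_left[OF ips] hset_add[OF ips]
  by (metis complex_cnj_add)

lemma hip_scale_right:
  assumes "x \<in> hset H" "y \<in> hset H"
  shows "hip H x (a *\<^sub>C y) = cnj a * hip H x y"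
  using assms hip_commute[OF ips] hip_scale_left[OF ips] hset_scale[OF ips]
  by (metis complex_cnj_mult)

lemma hip_minus_left:
  assumes "x \<in> hset H" "y \<in> hset H"
  shows "hip H (- x) y = - hip H x y"
  using hip_scale_left[OF ips assms, of "-1"] by simp

lemma hip_minus_right:
  assumes "x \<in> hset H" "y \<in> hset H"
  shows "hip H x (- y) = - hip H x y"
  using hip_scale_right[OF assms, of "-1"] by simp

lemma hip_diff_left:
  assumes "x \<in> hset H" "y \<in> hset H" "z \<in> hset H"
  shows "hip H (x - y) z = hip H x z - hip H y z"
  using hip_add_left[OF ips, of x "- y" z] hip_minus_left[of y z] hset_minus[OF ips] assms by simp

lemma hip_diff_right:
  assumes "x \<in> hset H" "y \<in> hset H" "z \<in> hset H"
  shows "hip H x (y - z) = hip H x y - hip H x z"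
  using hip_add_right[of x y "- z"] hip_minus_right[of x z] hset_minus[OF ips] assms by simp

lemma hip_zero_left: "x \<in> hset H \<Longrightarrow> hip H 0 x = 0"
  using hip_scale_left[OF ips, of x x 0] by simp

lemma hip_zero_right: "x \<in> hset H \<Longrightarrow> hip H x 0 = 0"
  using hip_scale_right[of x x 0] by simp

lemma hip_sum_left:
  assumes "\<And>i. i \<in> I \<Longrightarrow> f i \<in> hset H" "y \<in> hset H"
  shows "hip H (\<Sum>i\<in>I. f i) y = (\<Sum>i\<in>I. hip H (f i) y)"
  using assms
  by (induction I rule: infinite_finite_induct)
    (auto simp: hip_zero_left hip_add_left[OF ips] hset_sum[OF ips])

lemma hip_sum_right:
  assumes "\<And>i. i \<in> I \<Longrightarrow> f i \<in> hset H" "y \<in> hset H"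
  shows "hip H y (\<Sum>i\<in>I. f i) = (\<Sum>i\<in>I. hip H y (f i))"
  using assms
  by (induction I rule: infinite_finite_induct)
    (auto simp: hip_zero_right hip_add_right hset_sum[OF ips])

lemma hip_self: "x \<in> hset H \<Longrightarrow> hip H x x = of_real ((hnorm H x)\<^sup>2)"
  using hip_commute[OF ips, of x x] hip_self_nonneg[OF ips, of x]
  by (simp add: hnorm_def complex_eq_iff)

lemma hnorm_sq: "x \<in> hset H \<Longrightarrow> (hnorm H x)\<^sup>2 = Re (hip H x x)"
  by (simp add: hip_self)

lemma hnorm_nonneg: "x \<in> hset H \<Longrightarrow> 0 \<le> hnorm H x"
  by (simp add: hnorm_def hip_self_nonneg[OF ips])

lemma hnorm_zero: "hnorm H 0 = 0"
  by (simp add: hnorm_def hip_zero_left hset_zero[OF ips])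

lemma hnorm_eq_zero: "x \<in> hset H \<Longrightarrow> hnorm H x = 0 \<longleftrightarrow> x = 0"
  using hip_self[of x] hip_self_zero[OF ips, of x] hnorm_zero by auto

lemma hnorm_scale:
  assumes "x \<in> hset H"
  shows "hnorm H (a *\<^sub>C x) = cmod a * hnorm H x"
proof -
  have "hip H (a *\<^sub>C x) (a *\<^sub>C x) = (a * cnj a) * hip H x x"
    using assms by (simp add: hip_scale_left[OF ips] hip_scale_right hset_scale[OF ips])
  also have "\<dots> = of_real ((cmod a * hnorm H x)\<^sup>2)"
    using assms by (simp add: hip_self complex_norm_square[symmetric] power_mult_distrib)
  finally have "Re (hip H (a *\<^sub>C x) (a *\<^sub>C x)) = (cmod a * hnorm H x)\<^sup>2"
    by simp
  then show ?thesis
    using hnorm_nonneg[OF assms] by (simp add: hnorm_def)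
qed

lemma hnorm_minus: "x \<in> hset H \<Longrightarrow> hnorm H (- x) = hnorm H x"
  using hnorm_scale[of x "-1"] by simp

lemma hnorm_diff_commute: "x \<in> hset H \<Longrightarrow> y \<in> hset H \<Longrightarrow> hnorm H (x - y) = hnorm H (y - x)"
  using hnorm_minus[of "x - y"] hset_diff[OF ips] by simp

lemma hnorm_diff_sq:
  assumes "x \<in> hset H" "y \<in> hset H"
  shows "(hnorm H (x - y))\<^sup>2 = (hnorm H x)\<^sup>2 - 2 * Re (hip H x y) + (hnorm H y)\<^sup>2"
  using assms hip_commute[OF ips, of x y]
  by (simp add: hnorm_sq hset_diff[OF ips] hip_diff_left hip_diff_right algebra_simps)

lemma hnorm_add_sq:
  assumes "x \<in> hset H" "y \<in> hset H"
  shows "(hnorm H (x + y))\<^sup>2 = (hnorm H x)\<^sup>2 + 2 * Re (hip H x y) + (hnorm H y)\<^sup>2"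
  using assms hip_commute[OF ips, of x y]
  by (simp add: hnorm_sq hset_add[OF ips] hip_add_left[OF ips] hip_add_right algebra_simps)

lemma parallelogram:
  assumes "x \<in> hset H" "y \<in> hset H"
  shows "(hnorm H (x + y))\<^sup>2 + (hnorm H (x - y))\<^sup>2 = 2 * (hnorm H x)\<^sup>2 + 2 * (hnorm H y)\<^sup>2"
  using hnorm_add_sq[OF assms] hnorm_diff_sq[OF assms] by simp

lemma Cauchy_Schwarz:
  assumes x: "x \<in> hset H" and y: "y \<in> hset H"
  shows "cmod (hip H x y) \<le> hnorm H x * hnorm H y"
proof (cases "y = 0")
  case True
  then show ?thesis
    using x hnorm_zero by (simp add: hip_zero_right)
next
  case False
  define n where "n = (hnorm H y)\<^sup>2"
  define c where "c = hip H x y"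
  \<comment> \<open>The coefficient of the orthogonal projection of \<open>x\<close> onto
    \<open>y\<close>; it minimises the norm of \<open>x - a *\<^sub>C y\<close>, so nonnegativity of
    that norm is already the inequality.\<close>
  define a where "a = c / of_real n"
  have n: "n > 0"
    using False hnorm_eq_zero[OF y] by (simp add: n_def)
  have "0 \<le> (hnorm H (x - a *\<^sub>C y))\<^sup>2"
    by simp
  also have "\<dots> = (hnorm H x)\<^sup>2 - 2 * Re (cnj a * c) + (cmod a)\<^sup>2 * n"
    using x y by (simp add: hnorm_diff_sq hset_scale[OF ips] hip_scale_right hnorm_scale
        power_mult_distrib n_def c_def)
  also have "cnj a * c = of_real ((cmod c)\<^sup>2 / n)"
    by (simp add: a_def complex_norm_square[unfolded of_real_power] mult.commute)
  also have "(cmod a)\<^sup>2 * n = (cmod c)\<^sup>2 / n"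
    using n by (simp add: a_def norm_divide power_divide power2_eq_square)
  finally have "(cmod c)\<^sup>2 / n \<le> (hnorm H x)\<^sup>2"
    by simp
  then have "(cmod c)\<^sup>2 \<le> (hnorm H x * hnorm H y)\<^sup>2"
    using n by (simp add: divide_le_eq power_mult_distrib n_def)
  then show ?thesis
    unfolding c_def by (rule power2_le_imp_le) (simp add: x y hnorm_nonneg)
qed

lemma hnorm_triangle:
  assumes "x \<in> hset H" "y \<in> hset H"
  shows "hnorm H (x + y) \<le> hnorm H x + hnorm H y"
proof (rule power2_le_imp_le)
  have "Re (hip H x y) \<le> hnorm H x * hnorm H y"
    using Cauchy_Schwarz[OF assms] complex_Re_le_cmod order_trans by blast
  then show "(hnorm H (x + y))\<^sup>2 \<le> (hnorm H x + hnorm H y)\<^sup>2"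
    using hnorm_add_sq[OF assms] by (simp add: power2_sum)
qed (simp add: assms hnorm_nonneg)

lemma hnorm_triangle_diff:
  assumes "x \<in> hset H" "y \<in> hset H" "z \<in> hset H"
  shows "hnorm H (x - z) \<le> hnorm H (x - y) + hnorm H (y - z)"
  using hnorm_triangle[of "x - y" "y - z"] assms hset_diff[OF ips] by simp

lemma hnorm_diff_triangle:
  assumes "x \<in> hset H" "y \<in> hset H"
  shows "hnorm H (x - y) \<le> hnorm H x + hnorm H y"
  using hnorm_triangle[of x "- y"] assms hset_minus[OF ips] hnorm_minus by simp

lemma hnorm_reverse_triangle:
  assumes "x \<in> hset H" "y \<in> hset H"
  shows "\<bar>hnorm H x - hnorm H y\<bar> \<le> hnorm H (x - y)"
  using hnorm_triangle[of "x - y" y] hnorm_triangle[of "y - x" x] assms hset_diff[OF ips]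
    hnorm_diff_commute[OF assms] by simp

text \<open>Duality in its cheapest form: the vector is paired with itself and one factor of its
  norm is cancelled. Bounds for adjoints, point evaluations and Taylor remainders are all obtained
  this way. If the norm is 0, nothing can be cancelled and \<open>0 \<le> C\<close> decides.\<close>

lemma hnorm_le_of_hip:
  assumes "x \<in> hset H" "0 \<le> C" "cmod (hip H x x) \<le> C * hnorm H x"
  shows "hnorm H x \<le> C"
proof (cases "hnorm H x = 0")
  case False
  then have "hnorm H x > 0"
    using hnorm_nonneg[OF assms(1)] by simp
  moreover have "hnorm H x * hnorm H x \<le> C * hnorm H x"
    using assms(3) by (simp add: hip_self[OF assms(1)] power2_eq_square norm_mult)
  ultimately show ?thesis
    by (rule_tac mult_right_le_imp_le)
qed (use assms in simp)

lemma hip_ext: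
  assumes "x \<in> hset H" "y \<in> hset H" "\<And>z. z \<in> hset H \<Longrightarrow> hip H x z = hip H y z"
  shows "x = y"
proof -
  have "hip H (x - y) (x - y) = 0"
    using assms hset_diff[OF ips] by (simp add: hip_diff_left)
  then show ?thesis
    using hip_self_zero[OF ips, of "x - y"] assms hset_diff[OF ips] by simp
qed

lemma hip_ext_right:
  assumes "x \<in> hset H" "y \<in> hset H" "\<And>z. z \<in> hset H \<Longrightarrow> hip H z x = hip H z y"
  shows "x = y"
  using assms hip_commute[OF ips] by (metis hip_ext)

lemma tendsto_hip:
  assumes "\<And>n. X n \<in> hset H" "\<And>n. Y n \<in> hset H" "x \<in> hset H" "y \<in> hset H"
    and "(\<lambda>n. hnorm H (X n - x)) \<longlonglongrightarrow> 0" "(\<lambda>n. hnorm H (Y n - y)) \<longlonglongrightarrow> 0"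
  shows "(\<lambda>n. hip H (X n) (Y n)) \<longlonglongrightarrow> hip H x y"
proof (rule Lim_transform2[OF tendsto_const])
  let ?B = "\<lambda>n. hnorm H (X n - x) * hnorm H (Y n - y) + hnorm H (X n - x) * hnorm H y
    + hnorm H x * hnorm H (Y n - y)"
  have "cmod (hip H x y - hip H (X n) (Y n)) \<le> ?B n" for n
  proof -
    \<comment> \<open>Expanding around the limits leaves three terms, each with a factor that tends
      to 0 and otherwise only constants or another null factor.\<close>
    have eq: "hip H (X n) (Y n) - hip H x y
        = hip H (X n - x) (Y n - y) + hip H (X n - x) y + hip H x (Y n - y)"
      using assms by (simp add: hip_diff_left hip_diff_right hset_diff[OF ips])
    have "cmod (hip H x y - hip H (X n) (Y n)) \<le> cmod (hip H (X n - x) (Y n - y))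
        + cmod (hip H (X n - x) y) + cmod (hip H x (Y n - y))"
      unfolding norm_minus_commute[of "hip H x y"] eq
      by (meson norm_triangle_ineq order_trans add_right_mono)
    also have "\<dots> \<le> ?B n"
      using assms by (intro add_mono Cauchy_Schwarz) (auto simp: hset_diff[OF ips])
    finally show ?thesis .
  qed
  moreover have "?B \<longlonglongrightarrow> 0 * 0 + 0 * hnorm H y + hnorm H x * 0"
    using assms by (intro tendsto_intros)
  ultimately show "(\<lambda>n. hip H x y - hip H (X n) (Y n)) \<longlonglongrightarrow> 0"
    by (rule_tac Lim_null_comparison[of _ ?B]) auto
qed

lemma tendsto_hnorm:
  assumes "\<And>n. X n \<in> hset H" "x \<in> hset H" "(\<lambda>n. hnorm H (X n - x)) \<longlonglongrightarrow> 0"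
  shows "(\<lambda>n. hnorm H (X n)) \<longlonglongrightarrow> hnorm H x"
proof (rule Lim_transform2[OF tendsto_const])
  show "(\<lambda>n. hnorm H x - hnorm H (X n)) \<longlonglongrightarrow> 0"
    by (rule Lim_null_comparison[OF _ assms(3)])
      (use hnorm_reverse_triangle[of "X _" x] assms in \<open>auto simp: abs_minus_commute\<close>)
qed

lemma hnorm_limit_unique:
  assumes "\<And>n. X n \<in> hset H" "x \<in> hset H" "y \<in> hset H"
    and "(\<lambda>n. hnorm H (X n - x)) \<longlonglongrightarrow> 0" "(\<lambda>n. hnorm H (X n - y)) \<longlonglongrightarrow> 0"
  shows "x = y"
proof -
  have "hnorm H (x - y) \<le> hnorm H (X n - x) + hnorm H (X n - y)" for n
    using hnorm_triangle_diff[of x "X n" y] hnorm_diff_commute[of x "X n"] assms by simp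
  moreover have "(\<lambda>n. hnorm H (X n - x) + hnorm H (X n - y)) \<longlonglongrightarrow> 0 + 0"
    using assms by (intro tendsto_intros)
  ultimately have "hnorm H (x - y) \<le> 0"
    by (intro LIMSEQ_le_const[of _ "0 :: real"]) auto
  then show ?thesis
    using hnorm_eq_zero[of "x - y"] hnorm_nonneg[of "x - y"] assms hset_diff[OF ips] by auto
qed

text \<open>Orthogonality passes to the span, and <y, y> = <y - s, y> for every s in the span. Hence
  ||y|| is at most the distance from y to the span, which is arbitrarily small.\<close>

lemma total_orthogonal_zero:
  assumes S: "total_in H S" and y: "y \<in> hset H" and orth: "\<And>x. x \<in> S \<Longrightarrow> hip H x y = 0"
  shows "y = 0"
proof -
  have S_sub: "S \<subseteq> hset H"
    using S by (simp add: total_in_def)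
  have span: "s \<in> hset H \<and> hip H s y = 0" if "s \<in> cspan S" for s
    using that
  proof (induction rule: complex_vector.span_induct_alt)
    case base
    then show ?case by (simp add: hset_zero[OF ips] hip_zero_left y)
  next
    case (step c x z)
    then show ?case
      using S_sub y orth
      by (auto simp: hset_add[OF ips] hset_scale[OF ips] hip_add_left[OF ips] hip_scale_left[OF ips])
  qed
  have "hnorm H y \<le> e" if "e > 0" for e
  proof (rule hnorm_le_of_hip[OF y])
    obtain s where s: "s \<in> cspan S" "hnorm H (y - s) < e"
      using S y \<open>e > 0\<close> unfolding total_in_def by blast
    have "hip H y y = hip H (y - s) y"
      using span[OF s(1)] y by (simp add: hip_diff_left)
    also have "cmod \<dots> \<le> hnorm H (y - s) * hnorm H y"
      using span[OF s(1)] y by (intro Cauchy_Schwarz) (auto simp: hset_diff[OF ips])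
    also have "\<dots> \<le> e * hnorm H y"
      using s(2) y by (intro mult_right_mono) (auto simp: hnorm_nonneg)
    finally show "cmod (hip H y y) \<le> e * hnorm H y" .
  qed (use that in simp)
  then have "hnorm H y \<le> 0"
    using field_le_epsilon[of "hnorm H y" 0] by simp
  then show ?thesis
    using hnorm_nonneg[OF y] hnorm_eq_zero[OF y] by simp
qed

lemma total_hip_ext:
  assumes "total_in H S" "x \<in> hset H" "y \<in> hset H" "\<And>s. s \<in> S \<Longrightarrow> hip H s x = hip H s y"
  shows "x = y"
proof -
  have "S \<subseteq> hset H"
    using assms(1) by (simp add: total_in_def)
  then have "x - y = 0"
    using assms hset_diff[OF ips]
    by (intro total_orthogonal_zero[OF assms(1)]) (auto simp: hip_diff_right subset_iff)
  then show ?thesis by simp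
qed

lemma cspan_subset_hset: "S \<subseteq> hset H \<Longrightarrow> cspan S \<subseteq> hset H"
  using ips by (simp add: complex_vector.span_minimal inner_product_space_def)

lemma total_approx_seq:
  assumes "total_in H S" "x \<in> hset H"
  obtains X where "\<And>n. X n \<in> cspan S" "\<And>n. X n \<in> hset H" "(\<lambda>n. hnorm H (X n - x)) \<longlonglongrightarrow> 0"
proof -
  have "\<exists>y\<in>cspan S. hnorm H (x - y) < inverse (Suc n)" for n
    using assms by (simp add: total_in_def)
  then obtain X where X: "\<And>n. X n \<in> cspan S" "\<And>n. hnorm H (x - X n) < inverse (Suc n)"
    by metis
  have X_in: "X n \<in> hset H" for n
    using X(1) cspan_subset_hset assms(1) by (auto simp: total_in_def)
  have "(\<lambda>n. hnorm H (X n - x)) \<longlonglongrightarrow> 0"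
  proof (rule Lim_null_comparison[OF _ LIMSEQ_inverse_real_of_nat])
    show "\<forall>\<^sub>F n in sequentially. norm (hnorm H (X n - x)) \<le> inverse (real (Suc n))"
      using X(2) X_in assms(2) hnorm_diff_commute[of x] hnorm_nonneg hset_diff[OF ips]
      by (simp add: less_imp_le)
  qed
  then show ?thesis using that X(1) X_in by blast
qed

end

section \<open>Completeness and the Riesz representation theorem\<close>

definition Cauchy_in :: "'a::complex_vector hspace \<Rightarrow> (nat \<Rightarrow> 'a) \<Rightarrow> bool" where
  "Cauchy_in H X \<longleftrightarrow> (\<forall>n. X n \<in> hset H) \<and> (\<forall>e>0. \<exists>N. \<forall>m\<ge>N. \<forall>n\<ge>N. hnorm H (X m - X n) < e)"

lemma hilbert_space_iff:
  "hilbert_space H \<longleftrightarrow> inner_product_space H \<and>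
     (\<forall>X. Cauchy_in H X \<longrightarrow> (\<exists>x\<in>hset H. (\<lambda>n. hnorm H (X n - x)) \<longlonglongrightarrow> 0))"
  by (simp add: hilbert_space_def Cauchy_in_def)

lemma hilbert_complete:
  assumes "hilbert_space H" "Cauchy_in H X"
  obtains x where "x \<in> hset H" "(\<lambda>n. hnorm H (X n - x)) \<longlonglongrightarrow> 0"
  using assms by (auto simp: hilbert_space_iff)

lemma Cauchy_inI:
  assumes H: "inner_product_space H" and X: "\<And>n. X n \<in> hset H"
    and x: "x \<in> hset H" "(\<lambda>n. hnorm H (X n - x)) \<longlonglongrightarrow> 0"
  shows "Cauchy_in H X"
  unfolding Cauchy_in_def
proof (intro conjI allI impI X)
  fix e :: real assume "e > 0"
  then have "\<forall>\<^sub>F n in sequentially. hnorm H (X n - x) < e/2"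
    using order_tendstoD(2)[OF x(2), of "e/2"] by simp
  then obtain N where N: "\<And>n. n \<ge> N \<Longrightarrow> hnorm H (X n - x) < e/2"
    by (auto simp: eventually_sequentially)
  have "hnorm H (X m - X n) < e" if "m \<ge> N" "n \<ge> N" for m n
    using hnorm_triangle_diff[OF H, of "X m" x "X n"] hnorm_diff_commute[OF H, of x "X n"] X x
      N[OF that(1)] N[OF that(2)] by simp
  then show "\<exists>N. \<forall>m\<ge>N. \<forall>n\<ge>N. hnorm H (X m - X n) < e" by blast
qed

text \<open>Dirichlet principle: the representing vector is the minimiser of J(x) = ||x||^2 - 2 Re
  \<phi>(x). The lower bound -C^2 comes from (||x|| - C)^2 being nonnegative, existence of the
  minimiser from the parallelogram law, and the representation from the vanishing first
  variation.\<close>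

lemma Riesz_representation:
  assumes H: "hilbert_space H"
    and add: "\<And>x y. x \<in> hset H \<Longrightarrow> y \<in> hset H \<Longrightarrow> \<phi> (x + y) = \<phi> x + \<phi> y"
    and scale: "\<And>a x. x \<in> hset H \<Longrightarrow> \<phi> (a *\<^sub>C x) = a * \<phi> x"
    and bound: "\<And>x. x \<in> hset H \<Longrightarrow> cmod (\<phi> x) \<le> C * hnorm H x"
  obtains y where "y \<in> hset H" "\<And>x. x \<in> hset H \<Longrightarrow> \<phi> x = hip H x y"
proof -
  note ips = hilbert_space_ips[OF H]
  note mem = hset_zero[OF ips] hset_add[OF ips] hset_scale[OF ips] hset_diff[OF ips]
  define J where "J x = (hnorm H x)\<^sup>2 - 2 * Re (\<phi> x)" for x
  have J_lower: "J x \<ge> - C\<^sup>2" if "x \<in> hset H" for x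
  proof -
    have "Re (\<phi> x) \<le> C * hnorm H x"
      using bound[OF that] complex_Re_le_cmod order_trans by blast
    moreover have "0 \<le> (hnorm H x - C)\<^sup>2" by simp
    ultimately show ?thesis
      by (simp add: J_def power2_eq_square algebra_simps)
  qed
  define m where "m = Inf (J ` hset H)"
  have bdd: "bdd_below (J ` hset H)"
    using J_lower by (intro bdd_belowI2)
  have m_le: "m \<le> J x" if "x \<in> hset H" for x
    unfolding m_def using bdd that by (intro cInf_lower) auto
  have ex: "\<exists>x\<in>hset H. J x < m + inverse (Suc n)" for n
    using cInf_lessD[of "J ` hset H" "m + inverse (Suc n)"] mem(1)
    by (auto simp: m_def)
  then obtain X where X: "\<And>n. X n \<in> hset H" "\<And>n. J (X n) < m + inverse (Suc n)"
    by metis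
  \<comment> \<open>The midpoint of two near-minimisers cannot lie below the infimum; with the
    parallelogram law this forces the two points together.\<close>
  have par: "(hnorm H (x - y))\<^sup>2 \<le> 2 * (J x - m) + 2 * (J y - m)"
    if "x \<in> hset H" "y \<in> hset H" for x y
  proof -
    let ?z = "(1/2) *\<^sub>C (x + y)"
    have z: "?z \<in> hset H" using that mem by blast
    have "(hnorm H ?z)\<^sup>2 = (hnorm H (x + y))\<^sup>2 / 4"
      using that mem by (simp add: hnorm_scale[OF ips] power_mult_distrib power2_eq_square norm_divide)
    moreover have "Re (\<phi> ?z) = (Re (\<phi> x) + Re (\<phi> y)) / 2"
      using that mem by (simp add: scale add)
    ultimately have "4 * J ?z = (hnorm H (x + y))\<^sup>2 - 4 * (Re (\<phi> x) + Re (\<phi> y))"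
      by (simp add: J_def)
    then show ?thesis
      using parallelogram[OF ips that] m_le[OF z] by (simp add: J_def)
  qed
  have "Cauchy_in H X"
    unfolding Cauchy_in_def
  proof (intro conjI allI impI X(1))
    fix e :: real assume e: "e > 0"
    \<comment> \<open>With both values below m + e^2/4 the inequality \<open>par\<close> gives a
      squared distance below 2 e^2/4 + 2 e^2/4 = e^2.\<close>
    obtain N where N: "inverse (real (Suc N)) < e\<^sup>2/4"
      using reals_Archimedean[of "e\<^sup>2/4"] e by auto
    have J_lt: "J (X j) < m + e\<^sup>2/4" if "j \<ge> N" for j
    proof -
      have "J (X j) < m + inverse (real (Suc j))"
        by (rule X(2))
      also have "\<dots> \<le> m + inverse (real (Suc N))"
        using that by (intro add_left_mono le_imp_inverse_le) auto
      also have "\<dots> < m + e\<^sup>2/4"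
        using N by simp
      finally show ?thesis .
    qed
    have "hnorm H (X k - X n) < e" if "k \<ge> N" "n \<ge> N" for k n
    proof (rule power2_less_imp_less)
      show "(hnorm H (X k - X n))\<^sup>2 < e\<^sup>2"
        using par[OF X(1) X(1), of k n] J_lt[OF that(1)] J_lt[OF that(2)] by simp
    qed (use e in simp)
    then show "\<exists>N. \<forall>k\<ge>N. \<forall>n\<ge>N. hnorm H (X k - X n) < e" by blast
  qed
  then obtain y where y: "y \<in> hset H" "(\<lambda>n. hnorm H (X n - y)) \<longlonglongrightarrow> 0"
    by (rule hilbert_complete[OF H])
  have phi_diff: "\<phi> (x - z) = \<phi> x - \<phi> z" if "x \<in> hset H" "z \<in> hset H" for x z
    using add[of "x - z" z] that mem by simp
  have Jy: "J y \<le> m"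
  proof (rule tendsto_le[OF sequentially_bot])
    have "(\<lambda>n. \<phi> (X n) - \<phi> y) \<longlonglongrightarrow> 0"
      by (rule Lim_null_comparison[of _ "\<lambda>n. C * hnorm H (X n - y)"])
        (use y X(1) mem bound[of "X _ - y"] in \<open>auto intro!: tendsto_mult_right_zero simp: phi_diff[symmetric]\<close>)
    then have "(\<lambda>n. \<phi> (X n)) \<longlonglongrightarrow> \<phi> y"
      using LIM_zero_iff by blast
    then show "(\<lambda>n. J (X n)) \<longlonglongrightarrow> J y"
      unfolding J_def by (intro tendsto_intros tendsto_hnorm[OF ips X(1) y])
    show "(\<lambda>n. m + inverse (real (Suc n))) \<longlonglongrightarrow> m"
      using tendsto_add[OF tendsto_const LIMSEQ_inverse_real_of_nat, of m] by simp
    show "\<forall>\<^sub>F n in sequentially. J (X n) \<le> m + inverse (real (Suc n))"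
      using X(2) by (simp add: less_imp_le)
  qed
  \<comment> \<open>First variation at the minimiser: J(y + t x) - J(y) = t^2 ||x||^2 + 2 t r is
    nonnegative for all real t, which forces r = 0.\<close>
  have Re0: "Re (hip H x y) = Re (\<phi> x)" if x: "x \<in> hset H" for x
  proof -
    define r where "r = Re (hip H x y) - Re (\<phi> x)"
    have ineq: "0 \<le> t\<^sup>2 * (hnorm H x)\<^sup>2 + 2 * t * r" for t :: real
    proof -
      have "J (y + of_real t *\<^sub>C x) = J y + t\<^sup>2 * (hnorm H x)\<^sup>2 + 2 * t * r"
        using x y mem hip_commute[OF ips x y(1)]
        by (simp add: J_def hnorm_add_sq[OF ips] hnorm_scale[OF ips] power_mult_distrib
            hip_scale_right[OF ips] add scale r_def algebra_simps)
      then show ?thesis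
        using m_le[of "y + of_real t *\<^sub>C x"] Jy x y mem by simp
    qed
    show ?thesis
    proof (rule ccontr)
      assume "\<not> ?thesis"
      then have r: "r \<noteq> 0" by (simp add: r_def)
      \<comment> \<open>The summand 1 keeps \<open>s\<close> positive even if x = 0, so t = -r/s is
        always a legitimate test value.\<close>
      define s where "s = (hnorm H x)\<^sup>2 + 1"
      have s: "s > 0" by (simp add: s_def add_nonneg_pos)
      have "(- r/s)\<^sup>2 * (hnorm H x)\<^sup>2 \<le> (- r/s)\<^sup>2 * s"
        by (intro mult_left_mono) (auto simp: s_def)
      then have "0 \<le> (- r/s)\<^sup>2 * s + 2 * (- r/s) * r"
        using ineq[of "- r/s"] by linarith
      also have "\<dots> = - (r\<^sup>2/s)"
        using s by (simp add: power2_eq_square)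
      finally show False using s r
        by (simp add: divide_le_0_iff)
    qed
  qed
  have "\<phi> x = hip H x y" if x: "x \<in> hset H" for x
  proof (rule complex_eqI)
    show "Re (\<phi> x) = Re (hip H x y)" using Re0[OF x] by simp
    \<comment> \<open>Real parts agree for all vectors; applying this to the i-fold of x recovers
      the imaginary parts.\<close>
    have "Re (\<i> * \<phi> x) = Re (\<i> * hip H x y)"
      using Re0[of "\<i> *\<^sub>C x"] x y mem by (simp add: scale hip_scale_left[OF ips])
    then show "Im (\<phi> x) = Im (hip H x y)" by simp
  qed
  then show ?thesis using that y(1) by blast
qed

section \<open>Bounded operators and adjoints\<close>

lemma linear_opsD:
  assumes "T \<in> linear_ops E F"
  shows op_mem: "x \<in> hset E \<Longrightarrow> T x \<in> hset F"
    and op_off: "x \<notin> hset E \<Longrightarrow> T x = 0"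
    and op_add: "x \<in> hset E \<Longrightarrow> y \<in> hset E \<Longrightarrow> T (x + y) = T x + T y"
    and op_scale: "x \<in> hset E \<Longrightarrow> T (a *\<^sub>C x) = a *\<^sub>C T x"
  using assms by (auto simp: linear_ops_def)

lemma bounded_ops_linear: "T \<in> bounded_ops E F \<Longrightarrow> T \<in> linear_ops E F"
  by (simp add: bounded_ops_def)

lemma linear_opsI:
  assumes "\<And>x. x \<in> hset E \<Longrightarrow> T x \<in> hset F"
    and "\<And>x. x \<notin> hset E \<Longrightarrow> T x = 0"
    and "\<And>x y. x \<in> hset E \<Longrightarrow> y \<in> hset E \<Longrightarrow> T (x + y) = T x + T y"
    and "\<And>a x. x \<in> hset E \<Longrightarrow> T (a *\<^sub>C x) = a *\<^sub>C T x"
  shows "T \<in> linear_ops E F"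
  using assms by (simp add: linear_ops_def)

lemma op_zero:
  assumes "T \<in> linear_ops E F" "inner_product_space E"
  shows "T 0 = 0"
  using op_scale[OF assms(1), of 0 0] hset_zero[OF assms(2)] by simp

lemma op_diff:
  assumes "T \<in> linear_ops E F" "inner_product_space E" "x \<in> hset E" "y \<in> hset E"
  shows "T (x - y) = T x - T y"
  using op_add[OF assms(1), of "x - y" y] assms hset_diff by fastforce

lemma bounded_opsI:
  assumes "T \<in> linear_ops E F" "\<And>x. x \<in> hset E \<Longrightarrow> hnorm F (T x) \<le> C * hnorm E x"
  shows "T \<in> bounded_ops E F"
  using assms by (auto simp: bounded_ops_def)

text \<open>The constant in \<open>bounded_ops\<close> can be negative if the domain is trivial.
  Enlarging it to \<open>\<bar>C\<bar> + 1\<close> allows monotonicity arguments and division by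
  it.\<close>

lemma bounded_ops_bound:
  assumes "T \<in> bounded_ops E F" "inner_product_space E"
  obtains C where "C > 0" "\<And>x. x \<in> hset E \<Longrightarrow> hnorm F (T x) \<le> C * hnorm E x"
proof -
  obtain C where C: "\<And>x. x \<in> hset E \<Longrightarrow> hnorm F (T x) \<le> C * hnorm E x"
    using assms by (auto simp: bounded_ops_def)
  have "hnorm F (T x) \<le> (\<bar>C\<bar> + 1) * hnorm E x" if "x \<in> hset E" for x
    using C[OF that] mult_right_mono[OF _ hnorm_nonneg[OF assms(2) that], of C "\<bar>C\<bar> + 1"] by linarith
  then show ?thesis using that[of "\<bar>C\<bar> + 1"] by simp
qed

lemma opnorm_bdd:
  assumes "T \<in> bounded_ops E F" "inner_product_space E"
  shows "bdd_above ((\<lambda>x. hnorm F (T x)) ` {x \<in> hset E. hnorm E x \<le> 1})"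
proof -
  obtain C where C: "C > 0" "\<And>x. x \<in> hset E \<Longrightarrow> hnorm F (T x) \<le> C * hnorm E x"
    using bounded_ops_bound[OF assms] by blast
  have "hnorm F (T x) \<le> C" if "x \<in> hset E" "hnorm E x \<le> 1" for x
    using C(2)[OF that(1)] mult_left_mono[OF that(2), of C] C(1) by linarith
  then show ?thesis by (intro bdd_aboveI2) auto
qed

lemma opnorm_bound:
  assumes T: "T \<in> bounded_ops E F" and E: "inner_product_space E" and F: "inner_product_space F"
    and x: "x \<in> hset E"
  shows "hnorm F (T x) \<le> opnorm E F T * hnorm E x"
proof (cases "x = 0")
  case True
  then show ?thesis
    using op_zero[OF bounded_ops_linear[OF T] E] hnorm_zero[OF E] hnorm_zero[OF F] by simp
next
  case False
  then have n: "hnorm E x > 0"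
    using hnorm_nonneg[OF E x] hnorm_eq_zero[OF E x] by simp
  define u where "u = of_real (inverse (hnorm E x)) *\<^sub>C x"
  have u: "u \<in> hset E" "hnorm E u = 1"
    using x n by (simp_all add: u_def hset_scale[OF E] hnorm_scale[OF E] norm_inverse)
  have "hnorm F (T u) \<le> opnorm E F T"
    unfolding opnorm_def using u by (intro cSUP_upper opnorm_bdd[OF T E]) auto
  moreover have "hnorm F (T u) = hnorm F (T x) / hnorm E x"
    using x n op_mem[OF bounded_ops_linear[OF T] x]
    by (simp add: u_def op_scale[OF bounded_ops_linear[OF T]] hnorm_scale[OF F] norm_inverse divide_inverse)
  ultimately show ?thesis
    using n by (simp add: divide_le_eq)
qed

lemma opnorm_le:
  assumes "inner_product_space E" "0 \<le> C"
    and C: "\<And>x. x \<in> hset E \<Longrightarrow> hnorm F (T x) \<le> C * hnorm E x"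
  shows "opnorm E F T \<le> C"
  unfolding opnorm_def
proof (rule cSUP_least)
  show "{x \<in> hset E. hnorm E x \<le> 1} \<noteq> {}"
    using hset_zero[OF assms(1)] hnorm_zero[OF assms(1)] by force
  show "hnorm F (T x) \<le> C" if "x \<in> {x \<in> hset E. hnorm E x \<le> 1}" for x
    using C[of x] that mult_left_mono[of "hnorm E x" 1 C] assms(2) by auto
qed

lemma opnorm_nonneg:
  assumes T: "T \<in> bounded_ops E F" and E: "inner_product_space E" and F: "inner_product_space F"
  shows "0 \<le> opnorm E F T"
proof -
  have "hnorm F (T 0) \<le> opnorm E F T"
    unfolding opnorm_def
    using hset_zero[OF E] hnorm_zero[OF E] by (intro cSUP_upper opnorm_bdd[OF T E]) auto
  then show ?thesis
    using op_zero[OF bounded_ops_linear[OF T] E] hnorm_zero[OF F] by simp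
qed

lemma hip_complex [simp]: "hip complex_hspace x y = x * cnj y"
  and hset_complex [simp]: "hset complex_hspace = UNIV"
  by (simp_all add: complex_hspace_def)

lemma hnorm_complex [simp]: "hnorm complex_hspace x = cmod x"
  by (simp add: hnorm_def cmod_def power2_eq_square)

lemma hilbert_complex [simp]: "hilbert_space complex_hspace"
proof -
  have "inner_product_space complex_hspace"
    by (auto simp: inner_product_space_def scaleC_complex_def algebra_simps complex_is_Real_iff)
  moreover have "\<exists>x. (\<lambda>n. cmod (X n - x)) \<longlonglongrightarrow> 0"
    if "\<forall>e>0. \<exists>N. \<forall>m\<ge>N. \<forall>n\<ge>N. cmod (X m - X n) < e" for X :: "nat \<Rightarrow> complex"
  proof -
    have "Cauchy X" using that by (simp add: Cauchy_def dist_norm)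
    then obtain x where "X \<longlonglongrightarrow> x"
      using Cauchy_convergent convergent_def by blast
    then show ?thesis using tendsto_norm_zero LIM_zero by blast
  qed
  ultimately show ?thesis by (simp add: hilbert_space_def)
qed

lemma adj_eqI:
  assumes "inner_product_space E" "y \<in> hset F" "x \<in> hset E"
    and "\<And>u. u \<in> hset E \<Longrightarrow> hip F (T u) y = hip E u x"
  shows "adj E F T y = x"
proof -
  have "(THE x. x \<in> hset E \<and> (\<forall>u\<in>hset E. hip F (T u) y = hip E u x)) = x"
    using assms by (intro the_equality) (auto intro: hip_ext_right)
  then show ?thesis
    using assms(2) by (simp add: adj_def zero_ext_def)
qed

lemma adj_off: "y \<notin> hset F \<Longrightarrow> adj E F T y = 0"
  by (simp add: adj_def zero_ext_def)

lemma adj_exists: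
  assumes E: "hilbert_space E" and F: "inner_product_space F" and T: "T \<in> bounded_ops E F"
    and y: "y \<in> hset F"
  shows "adj E F T y \<in> hset E \<and> (\<forall>u\<in>hset E. hip F (T u) y = hip E u (adj E F T y))"
proof -
  note TL = bounded_ops_linear[OF T]
  obtain C where C: "C > 0" "\<And>x. x \<in> hset E \<Longrightarrow> hnorm F (T x) \<le> C * hnorm E x"
    using bounded_ops_bound[OF T] E by blast
  obtain x where x: "x \<in> hset E" "\<And>u. u \<in> hset E \<Longrightarrow> hip F (T u) y = hip E u x"
  proof (rule Riesz_representation[OF E, of "\<lambda>u. hip F (T u) y" "C * hnorm F y"])
    fix u assume u: "u \<in> hset E"
    have "cmod (hip F (T u) y) \<le> hnorm F (T u) * hnorm F y"
      by (intro Cauchy_Schwarz[OF F] op_mem[OF TL] u y)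
    also have "\<dots> \<le> C * hnorm E u * hnorm F y"
      by (intro mult_right_mono C u hnorm_nonneg[OF F] y)
    finally show "cmod (hip F (T u) y) \<le> C * hnorm F y * hnorm E u"
      by (simp add: algebra_simps)
  qed (use y in \<open>simp_all add: op_add[OF TL] op_scale[OF TL] op_mem[OF TL]
      hip_add_left[OF F] hip_scale_left[OF F]\<close>)
  then have "adj E F T y = x"
    using E y by (intro adj_eqI) auto
  then show ?thesis using x by simp
qed

lemmas adj_mem = adj_exists[THEN conjunct1]
lemmas hip_adj = adj_exists[THEN conjunct2, rule_format]

lemma hip_adj_left:
  assumes "hilbert_space E" "inner_product_space F" "T \<in> bounded_ops E F"
    and "y \<in> hset F" "u \<in> hset E"
  shows "hip E (adj E F T y) u = hip F y (T u)"
  using hip_adj[OF assms] hip_commute[of E] hip_commute[of F] adj_mem[OF assms(1-4)]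
    op_mem[OF bounded_ops_linear[OF assms(3)] assms(5)] assms hilbert_space_ips
  by metis

text \<open>With x the image of y under the adjoint, ||x||^2 = <T x, y> \<le> C ||x|| ||y||, and
  ||x|| cancels.\<close>

lemma adj_bound:
  assumes E: "hilbert_space E" and F: "inner_product_space F" and T: "T \<in> bounded_ops E F"
    and y: "y \<in> hset F" and "0 \<le> C" and C: "\<And>x. x \<in> hset E \<Longrightarrow> hnorm F (T x) \<le> C * hnorm E x"
  shows "hnorm E (adj E F T y) \<le> C * hnorm F y"
proof (rule hnorm_le_of_hip[OF hilbert_space_ips[OF E]])
  let ?x = "adj E F T y"
  show x: "?x \<in> hset E" by (rule adj_mem[OF E F T y])
  show "0 \<le> C * hnorm F y" using assms by (simp add: hnorm_nonneg)
  have "cmod (hip E ?x ?x) = cmod (hip F (T ?x) y)"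
    using hip_adj[OF E F T y x] by simp
  also have "\<dots> \<le> hnorm F (T ?x) * hnorm F y"
    by (intro Cauchy_Schwarz[OF F] op_mem[OF bounded_ops_linear[OF T]] x y)
  also have "\<dots> \<le> C * hnorm E ?x * hnorm F y"
    by (intro mult_right_mono C x hnorm_nonneg[OF F] y)
  finally show "cmod (hip E ?x ?x) \<le> C * hnorm F y * hnorm E ?x"
    by (simp add: algebra_simps)
qed

lemma adj_bounded:
  assumes E: "hilbert_space E" and F: "inner_product_space F" and T: "T \<in> bounded_ops E F"
  shows "adj E F T \<in> bounded_ops F E"
proof -
  note ipsE = hilbert_space_ips[OF E]
  note h = hip_adj[OF E F T] adj_mem[OF E F T] op_mem[OF bounded_ops_linear[OF T]]
  obtain C where C: "C > 0" "\<And>x. x \<in> hset E \<Longrightarrow> hnorm F (T x) \<le> C * hnorm E x"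
    using bounded_ops_bound[OF T] E by blast
  show ?thesis
  proof (rule bounded_opsI[OF linear_opsI])
    fix x y a assume x: "x \<in> hset F" and y: "y \<in> hset F"
    show "adj E F T (x + y) = adj E F T x + adj E F T y"
      by (rule adj_eqI) (use x y in \<open>auto simp: ipsE hset_add[OF ipsE] hset_add[OF F] h
        hip_add_right[OF F] hip_add_right[OF ipsE]\<close>)
  next
    fix x a assume x: "x \<in> hset F"
    show "adj E F T (a *\<^sub>C x) = a *\<^sub>C adj E F T x"
      by (rule adj_eqI) (use x in \<open>auto simp: ipsE hset_scale[OF ipsE] hset_scale[OF F] h
        hip_scale_right[OF F] hip_scale_right[OF ipsE]\<close>)
  next
    fix x assume x: "x \<in> hset F"
    show "hnorm E (adj E F T x) \<le> C * hnorm F x"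
      by (rule adj_bound[OF E F T x]) (use C in auto)
  qed (auto simp: adj_mem[OF E F T] adj_off)
qed

lemma bounded_ops_add:
  assumes "S \<in> bounded_ops E F" "T \<in> bounded_ops E F" "inner_product_space E" "inner_product_space F"
  shows "(\<lambda>x. S x + T x) \<in> bounded_ops E F"
proof -
  note lin = bounded_ops_linear[OF assms(1)] bounded_ops_linear[OF assms(2)]
  obtain C D where C: "\<And>x. x \<in> hset E \<Longrightarrow> hnorm F (S x) \<le> C * hnorm E x"
    and D: "\<And>x. x \<in> hset E \<Longrightarrow> hnorm F (T x) \<le> D * hnorm E x"
    using bounded_ops_bound assms by metis
  show ?thesis
  proof (rule bounded_opsI[OF linear_opsI, where C = "C + D"])
    fix x assume x: "x \<in> hset E"
    show "hnorm F (S x + T x) \<le> (C + D) * hnorm E x"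
      using hnorm_triangle[OF assms(4) op_mem[OF lin(1) x] op_mem[OF lin(2) x]] C[OF x] D[OF x]
      by (simp add: distrib_right)
  qed (auto simp: op_mem[OF lin(1)] op_mem[OF lin(2)] op_off[OF lin(1)] op_off[OF lin(2)]
      op_add[OF lin(1)] op_add[OF lin(2)] op_scale[OF lin(1)] op_scale[OF lin(2)]
      hset_add[OF assms(4)] scaleC_add_right)
qed

lemma bounded_ops_scale:
  assumes "T \<in> bounded_ops E F" "inner_product_space E" "inner_product_space F"
  shows "(\<lambda>x. a *\<^sub>C T x) \<in> bounded_ops E F"
proof -
  note lin = bounded_ops_linear[OF assms(1)]
  obtain C where C: "\<And>x. x \<in> hset E \<Longrightarrow> hnorm F (T x) \<le> C * hnorm E x"
    using bounded_ops_bound assms by metis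
  show ?thesis
  proof (rule bounded_opsI[OF linear_opsI, where C = "cmod a * C"])
    fix x assume x: "x \<in> hset E"
    show "hnorm F (a *\<^sub>C T x) \<le> cmod a * C * hnorm E x"
      using mult_left_mono[OF C[OF x], of "cmod a"] op_mem[OF lin x]
      by (simp add: hnorm_scale[OF assms(3)] mult.assoc)
  qed (auto simp: op_mem[OF lin] op_off[OF lin] op_add[OF lin] op_scale[OF lin]
      hset_scale[OF assms(3)] scaleC_add_right scaleC_scaleC mult.commute)
qed

lemma bounded_ops_diff:
  assumes "S \<in> bounded_ops E F" "T \<in> bounded_ops E F" "inner_product_space E" "inner_product_space F"
  shows "(\<lambda>x. S x - T x) \<in> bounded_ops E F"
  using bounded_ops_add[OF assms(1) bounded_ops_scale[OF assms(2-4), of "-1"] assms(3-4)] by simp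

lemma bounded_ops_comp:
  assumes "S \<in> bounded_ops F G" "T \<in> bounded_ops E F"
    "inner_product_space E" "inner_product_space F" "inner_product_space G"
  shows "S \<circ> T \<in> bounded_ops E G"
proof -
  note lin = bounded_ops_linear[OF assms(1)] bounded_ops_linear[OF assms(2)]
  obtain C D where C: "C > 0" "\<And>x. x \<in> hset F \<Longrightarrow> hnorm G (S x) \<le> C * hnorm F x"
    and D: "\<And>x. x \<in> hset E \<Longrightarrow> hnorm F (T x) \<le> D * hnorm E x"
    using bounded_ops_bound assms by metis
  show ?thesis
  proof (rule bounded_opsI[OF linear_opsI, where C = "C * D"])
    fix x assume x: "x \<in> hset E"
    show "hnorm G ((S \<circ> T) x) \<le> C * D * hnorm E x"
      using order_trans[OF C(2)[OF op_mem[OF lin(2) x]] mult_left_mono[OF D[OF x]]] C(1)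
      by (simp add: mult.assoc)
  qed (auto simp: op_mem[OF lin(1)] op_mem[OF lin(2)] op_off[OF lin(2)] op_zero[OF lin(1) assms(4)]
      op_add[OF lin(1)] op_add[OF lin(2)] op_scale[OF lin(1)] op_scale[OF lin(2)])
qed

text \<open>The adjoints are compared instead of the operators: pairing with the total set shows
  that they agree everywhere, and agreement of the adjoints returns agreement of the operators
  without any limit argument.\<close>

lemma bounded_ops_eq_on_total:
  assumes E: "hilbert_space E" and F: "inner_product_space F"
    and S: "S \<in> bounded_ops E F" and T: "T \<in> bounded_ops E F"
    and X: "total_in E X" and eq: "\<And>x. x \<in> X \<Longrightarrow> S x = T x"
  shows "S = T"
proof
  fix x
  show "S x = T x"
  proof (cases "x \<in> hset E")
    case True
    have sub: "X \<subseteq> hset E" using X by (simp add: total_in_def)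
    have adj_eq: "adj E F S y = adj E F T y" if y: "y \<in> hset F" for y
    proof (rule total_hip_ext[OF hilbert_space_ips[OF E] X])
      show "hip E s (adj E F S y) = hip E s (adj E F T y)" if "s \<in> X" for s
        using eq[OF that] that sub hip_adj[OF E F S y, of s] hip_adj[OF E F T y, of s] by auto
    qed (rule adj_mem[OF E F S y] adj_mem[OF E F T y])+
    show ?thesis
    proof (rule hip_ext[OF F])
      show "S x \<in> hset F" "T x \<in> hset F"
        using True op_mem[OF bounded_ops_linear] S T by blast+
      show "hip F (S x) z = hip F (T x) z" if "z \<in> hset F" for z
        using hip_adj[OF E F S that True] hip_adj[OF E F T that True] adj_eq[OF that] by simp
    qed
  qed (use op_off[OF bounded_ops_linear] S T in metis)
qed

section \<open>Extension of linear relations and of maps given on generators\<close>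

lemma extend_linear_relation:
  assumes H1: "inner_product_space H1" and H2: "hilbert_space H2" and "0 \<le> C"
    and mem: "\<And>a b. R a b \<Longrightarrow> a \<in> hset H1 \<and> b \<in> hset H2"
    and add: "\<And>a b a' b'. R a b \<Longrightarrow> R a' b' \<Longrightarrow> R (a + a') (b + b')"
    and scale: "\<And>c a b. R a b \<Longrightarrow> R (c *\<^sub>C a) (c *\<^sub>C b)"
    and bound: "\<And>a b. R a b \<Longrightarrow> hnorm H2 b \<le> C * hnorm H1 a"
    and dense: "\<And>x e. x \<in> hset H1 \<Longrightarrow> e > 0 \<Longrightarrow> \<exists>a b. R a b \<and> hnorm H1 (x - a) < e"
  obtains V where "V \<in> bounded_ops H1 H2" "\<And>x. x \<in> hset H1 \<Longrightarrow> hnorm H2 (V x) \<le> C * hnorm H1 x"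
    "\<And>a b. R a b \<Longrightarrow> V a = b"
proof -
  note ips2 = hilbert_space_ips[OF H2]
  \<comment> \<open>\<open>P\<close> is the closure of the graph \<open>R\<close>. Density makes it
    total, and the norm bound, which survives the closure, makes it single-valued.\<close>
  define P where "P x y \<longleftrightarrow> (\<exists>A B. (\<forall>n. R (A n) (B n)) \<and> x \<in> hset H1 \<and> y \<in> hset H2 \<and>
    (\<lambda>n. hnorm H1 (A n - x)) \<longlonglongrightarrow> 0 \<and> (\<lambda>n. hnorm H2 (B n - y)) \<longlonglongrightarrow> 0)" for x y
  have Rdiff: "R (a - a') (b - b')" if "R a b" "R a' b'" for a b a' b'
    using add[OF that(1) scale[OF that(2), of "-1"]] by simp
  have P_mem: "y \<in> hset H2" if "P x y" for x y
    using that by (auto simp: P_def)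
  have P_ex: "\<exists>y. P x y" if x: "x \<in> hset H1" for x
  proof -
    have "\<exists>a b. R a b \<and> hnorm H1 (x - a) < inverse (Suc n)" for n
      using dense[OF x, of "inverse (Suc n)"] by simp
    then obtain A B where AB: "\<And>n. R (A n) (B n)" "\<And>n. hnorm H1 (x - A n) < inverse (Suc n)"
      by metis
    have A_in: "A n \<in> hset H1" and B_in: "B n \<in> hset H2" for n
      using mem[OF AB(1)] by auto
    have lim: "(\<lambda>n. hnorm H1 (A n - x)) \<longlonglongrightarrow> 0"
    proof (rule Lim_null_comparison[OF _ LIMSEQ_inverse_real_of_nat])
      show "\<forall>\<^sub>F n in sequentially. norm (hnorm H1 (A n - x)) \<le> inverse (real (Suc n))"
        using AB(2) A_in x hnorm_diff_commute[OF H1 x] hnorm_nonneg[OF H1] hset_diff[OF H1]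
        by (simp add: less_imp_le)
    qed
    have "Cauchy_in H2 B"
      unfolding Cauchy_in_def
    proof (intro conjI allI impI B_in)
      fix e :: real assume e: "e > 0"
      have "Cauchy_in H1 A"
        by (rule Cauchy_inI[OF H1 A_in x lim])
      \<comment> \<open>\<open>C\<close> may be 0, so \<open>C + 1\<close> serves as
        divisor.\<close>
      moreover have "e / (C + 1) > 0"
        using e \<open>0 \<le> C\<close> by simp
      ultimately obtain N where N: "\<And>m n. m \<ge> N \<Longrightarrow> n \<ge> N \<Longrightarrow> hnorm H1 (A m - A n) < e / (C + 1)"
        unfolding Cauchy_in_def by meson
      have "hnorm H2 (B m - B n) < e" if "m \<ge> N" "n \<ge> N" for m n
      proof -
        have "hnorm H2 (B m - B n) \<le> C * hnorm H1 (A m - A n)"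
          by (intro bound Rdiff AB)
        also have "\<dots> \<le> (C + 1) * hnorm H1 (A m - A n)"
          by (intro mult_right_mono hnorm_nonneg[OF H1] hset_diff[OF H1] A_in) auto
        also have "\<dots> < e"
          using N[OF that] \<open>0 \<le> C\<close> by (simp add: pos_less_divide_eq mult.commute)
        finally show ?thesis .
      qed
      then show "\<exists>N. \<forall>m\<ge>N. \<forall>n\<ge>N. hnorm H2 (B m - B n) < e" by blast
    qed
    then obtain y where "y \<in> hset H2" "(\<lambda>n. hnorm H2 (B n - y)) \<longlonglongrightarrow> 0"
      by (rule hilbert_complete[OF H2])
    then show ?thesis
      using AB(1) x lim unfolding P_def by blast
  qed
  have P_bound: "hnorm H2 y \<le> C * hnorm H1 x" if P: "P x y" for x y
  proof -
    obtain A B where AB: "\<And>n. R (A n) (B n)" "x \<in> hset H1" "y \<in> hset H2"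
      "(\<lambda>n. hnorm H1 (A n - x)) \<longlonglongrightarrow> 0" "(\<lambda>n. hnorm H2 (B n - y)) \<longlonglongrightarrow> 0"
      using P unfolding P_def by blast
    show ?thesis
    proof (rule tendsto_le[OF sequentially_bot])
      show "(\<lambda>n. hnorm H2 (B n)) \<longlonglongrightarrow> hnorm H2 y"
        using mem AB by (intro tendsto_hnorm[OF ips2]) auto
      show "(\<lambda>n. C * hnorm H1 (A n)) \<longlonglongrightarrow> C * hnorm H1 x"
        using mem AB by (intro tendsto_mult_left tendsto_hnorm[OF H1]) auto
      show "\<forall>\<^sub>F n in sequentially. hnorm H2 (B n) \<le> C * hnorm H1 (A n)"
        using bound AB(1) by simp
    qed
  qed
  have P_add: "P (x + x') (y + y')" if P: "P x y" and P': "P x' y'" for x x' y y'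
  proof -
    obtain A B where AB: "\<And>n. R (A n) (B n)" "x \<in> hset H1" "y \<in> hset H2"
      "(\<lambda>n. hnorm H1 (A n - x)) \<longlonglongrightarrow> 0" "(\<lambda>n. hnorm H2 (B n - y)) \<longlonglongrightarrow> 0"
      using P unfolding P_def by blast
    obtain A' B' where AB': "\<And>n. R (A' n) (B' n)" "x' \<in> hset H1" "y' \<in> hset H2"
      "(\<lambda>n. hnorm H1 (A' n - x')) \<longlonglongrightarrow> 0" "(\<lambda>n. hnorm H2 (B' n - y')) \<longlonglongrightarrow> 0"
      using P' unfolding P_def by blast
    have lim: "(\<lambda>n. hnorm H (F n + F' n - (u + u'))) \<longlonglongrightarrow> 0"
      if "inner_product_space H" "\<And>n. F n \<in> hset H" "\<And>n. F' n \<in> hset H" "u \<in> hset H" "u' \<in> hset H"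
        "(\<lambda>n. hnorm H (F n - u)) \<longlonglongrightarrow> 0" "(\<lambda>n. hnorm H (F' n - u')) \<longlonglongrightarrow> 0"
      for H :: "'x::complex_vector hspace" and F F' u u'
    proof (rule Lim_null_comparison)
      show "\<forall>\<^sub>F n in sequentially. norm (hnorm H (F n + F' n - (u + u')))
          \<le> hnorm H (F n - u) + hnorm H (F' n - u')"
        using hnorm_triangle[OF that(1), of "F _ - u" "F' _ - u'"] that(2-5)
        by (auto simp: hset_diff[OF that(1)] hset_add[OF that(1)] hnorm_nonneg[OF that(1)] algebra_simps)
      show "(\<lambda>n. hnorm H (F n - u) + hnorm H (F' n - u')) \<longlonglongrightarrow> 0"
        using tendsto_add[OF that(6,7)] by simp
    qed
    have "(\<lambda>n. hnorm H1 (A n + A' n - (x + x'))) \<longlonglongrightarrow> 0"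
      using mem AB AB' by (intro lim H1) auto
    moreover have "(\<lambda>n. hnorm H2 (B n + B' n - (y + y'))) \<longlonglongrightarrow> 0"
      using mem AB AB' by (intro lim ips2) auto
    ultimately show ?thesis
      using add[OF AB(1) AB'(1)] AB(2,3) AB'(2,3) hset_add[OF H1] hset_add[OF ips2]
      unfolding P_def by (intro exI[of _ "\<lambda>n. A n + A' n"] exI[of _ "\<lambda>n. B n + B' n"]) simp
  qed
  have P_scale: "P (c *\<^sub>C x) (c *\<^sub>C y)" if P: "P x y" for c x y
  proof -
    obtain A B where AB: "\<And>n. R (A n) (B n)" "x \<in> hset H1" "y \<in> hset H2"
      "(\<lambda>n. hnorm H1 (A n - x)) \<longlonglongrightarrow> 0" "(\<lambda>n. hnorm H2 (B n - y)) \<longlonglongrightarrow> 0"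
      using P unfolding P_def by blast
    have "(\<lambda>n. hnorm H1 (c *\<^sub>C A n - c *\<^sub>C x)) \<longlonglongrightarrow> 0"
      using tendsto_mult_right_zero[OF AB(4), of "cmod c"] AB mem[OF AB(1)]
      by (simp add: complex_vector.scale_right_diff_distrib[symmetric] hnorm_scale[OF H1] hset_diff[OF H1])
    moreover have "(\<lambda>n. hnorm H2 (c *\<^sub>C B n - c *\<^sub>C y)) \<longlonglongrightarrow> 0"
      using tendsto_mult_right_zero[OF AB(5), of "cmod c"] AB mem[OF AB(1)]
      by (simp add: complex_vector.scale_right_diff_distrib[symmetric] hnorm_scale[OF ips2] hset_diff[OF ips2])
    ultimately show ?thesis
      using scale[OF AB(1)] AB(2,3) hset_scale[OF H1] hset_scale[OF ips2]
      unfolding P_def by (intro exI[of _ "\<lambda>n. c *\<^sub>C A n"] exI[of _ "\<lambda>n. c *\<^sub>C B n"]) simp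
  qed
  \<comment> \<open>Two values over the same x differ by a value over 0, and the bound forces that
    one to be 0. Linear dependences among generators are thereby harmless.\<close>
  have P_unique: "y = y'" if "P x y" "P x y'" for x y y'
  proof -
    have "P (x + (-1) *\<^sub>C x) (y + (-1) *\<^sub>C y')"
      using that P_add P_scale by blast
    then have "hnorm H2 (y - y') \<le> 0"
      using P_bound[of 0 "y - y'"] hnorm_zero[OF H1] by simp
    then show ?thesis
      using P_mem that hset_diff[OF ips2] hnorm_nonneg[OF ips2] hnorm_eq_zero[OF ips2]
      by (metis eq_iff_diff_eq_0 order_antisym)
  qed
  define V where "V = zero_ext (hset H1) (\<lambda>x. THE y. P x y)"
  have V: "P x (V x)" if "x \<in> hset H1" for x
    using P_ex[OF that] P_unique that by (auto simp: V_def zero_ext_def intro: theI)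
  have V_eq: "V x = y" if "x \<in> hset H1" "P x y" for x y
    using V[OF that(1)] that(2) P_unique by blast
  have "V \<in> bounded_ops H1 H2"
  proof (rule bounded_opsI[OF linear_opsI])
    show "V x \<in> hset H2" if "x \<in> hset H1" for x
      using V[OF that] P_mem by blast
    show "V x = 0" if "x \<notin> hset H1" for x
      using that by (simp add: V_def zero_ext_def)
    show "V (x + y) = V x + V y" if "x \<in> hset H1" "y \<in> hset H1" for x y
      by (intro V_eq hset_add[OF H1] P_add V that)
    show "V (a *\<^sub>C x) = a *\<^sub>C V x" if "x \<in> hset H1" for a x
      by (intro V_eq hset_scale[OF H1] P_scale V that)
    show "hnorm H2 (V x) \<le> C * hnorm H1 x" if "x \<in> hset H1" for x
      by (intro P_bound V that)
  qed
  moreover have "V a = b" if "R a b" for a b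
  proof (rule V_eq)
    show "a \<in> hset H1" using mem[OF that] by simp
    show "P a b"
      unfolding P_def using that mem[OF that] hnorm_zero[OF H1] hnorm_zero[OF ips2]
      by (intro exI[of _ "\<lambda>_. a"] exI[of _ "\<lambda>_. b"]) auto
  qed
  ultimately show ?thesis
    using that V P_bound by blast
qed

text \<open>The linear span of the pairs (x i, y i), with no claim that it is a graph. The shape of
  \<open>step\<close> follows \<open>span_induct_alt\<close>, so that the first components run
  exactly through the span of the x i.\<close>

inductive generated_relation :: "('i \<Rightarrow> 'a::complex_vector) \<Rightarrow> ('i \<Rightarrow> 'b::complex_vector) \<Rightarrow> 'i set \<Rightarrow> 'a \<Rightarrow> 'b \<Rightarrow> bool"
  for x y I where
  zero: "generated_relation x y I 0 0"
| step: "i \<in> I \<Longrightarrow> generated_relation x y I a b \<Longrightarrow> generated_relation x y I (c *\<^sub>C x i + a) (c *\<^sub>C y i + b)"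

lemma generated_relation_add:
  assumes "generated_relation x y I a b" "generated_relation x y I a' b'"
  shows "generated_relation x y I (a + a') (b + b')"
  using assms by induction (auto simp: add.assoc intro: generated_relation.intros)

lemma generated_relation_scale:
  assumes "generated_relation x y I a b"
  shows "generated_relation x y I (k *\<^sub>C a) (k *\<^sub>C b)"
  using assms
  by induction (auto simp: scaleC_add_right scaleC_scaleC intro: generated_relation.intros)

lemma generated_relation_mem:
  assumes "generated_relation x y I a b" "inner_product_space H1" "inner_product_space H2"
    and "\<And>i. i \<in> I \<Longrightarrow> x i \<in> hset H1" "\<And>i. i \<in> I \<Longrightarrow> y i \<in> hset H2"
  shows "a \<in> hset H1 \<and> b \<in> hset H2"
  using assms(1)
  by induction (auto simp: hset_zero hset_add hset_scale assms)

lemma generated_relation_total: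
  assumes "a \<in> cspan (x ` I)"
  shows "\<exists>b. generated_relation x y I a b"
  using assms
  by (induction rule: complex_vector.span_induct_alt) (auto intro: generated_relation.intros)

text \<open>Positivity of matrices is stated for sums over initial segments of the naturals; this
  brings derivations into that form. The same generator may occur under several indices.\<close>

lemma generated_relation_sum:
  assumes "generated_relation x y I a b"
  shows "\<exists>(m::nat) c i. (\<forall>j<m. i j \<in> I) \<and> a = (\<Sum>j<m. c j *\<^sub>C x (i j)) \<and> b = (\<Sum>j<m. c j *\<^sub>C y (i j))"
  using assms
proof induction
  case zero
  show ?case by (intro exI[of _ 0]) auto
next
  case (step k a b d)
  from step.IH obtain m :: nat and c i where *: "\<forall>j<m. i j \<in> I" "a = (\<Sum>j<m. c j *\<^sub>C x (i j))" "b = (\<Sum>j<m. c j *\<^sub>C y (i j))"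
    by (elim exE conjE) (rule that; assumption)
  show ?case
    \<comment> \<open>The new term is appended at position m, leaving the earlier coefficients and
      indices untouched.\<close>
    by (rule exI[of _ "Suc m"], rule exI[of _ "c(m := d)"], rule exI[of _ "i(m := k)"])
      (use * step(1) in \<open>auto simp: less_Suc_eq add.commute\<close>)
qed

lemma extend_generators:
  assumes H1: "inner_product_space H1" and H2: "hilbert_space H2" and "0 \<le> C"
    and total: "total_in H1 (x ` I)" and y: "\<And>i. i \<in> I \<Longrightarrow> y i \<in> hset H2"
    and bound: "\<And>a b. generated_relation x y I a b \<Longrightarrow> hnorm H2 b \<le> C * hnorm H1 a"
  obtains V where "V \<in> bounded_ops H1 H2" "\<And>i. i \<in> I \<Longrightarrow> V (x i) = y i"
    "\<And>z. z \<in> hset H1 \<Longrightarrow> hnorm H2 (V z) \<le> C * hnorm H1 z"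
proof -
  have x: "x i \<in> hset H1" if "i \<in> I" for i
    using total that by (auto simp: total_in_def)
  have dense: "\<exists>a b. generated_relation x y I a b \<and> hnorm H1 (z - a) < e" if z: "z \<in> hset H1" "e > 0" for z e
  proof -
    obtain a where "a \<in> cspan (x ` I)" "hnorm H1 (z - a) < e"
      using total z unfolding total_in_def by blast
    then show ?thesis using generated_relation_total by blast
  qed
  have mem: "a \<in> hset H1 \<and> b \<in> hset H2" if "generated_relation x y I a b" for a b
    by (rule generated_relation_mem[OF that H1 hilbert_space_ips[OF H2] x y])
  obtain V where V: "V \<in> bounded_ops H1 H2" "\<And>x. x \<in> hset H1 \<Longrightarrow> hnorm H2 (V x) \<le> C * hnorm H1 x"
    "\<And>a b. generated_relation x y I a b \<Longrightarrow> V a = b"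
    using extend_linear_relation[of H1 H2 C "generated_relation x y I",
        OF H1 H2 \<open>0 \<le> C\<close> mem generated_relation_add generated_relation_scale bound dense]
    by metis
  moreover have "V (x i) = y i" if "i \<in> I" for i
    using V(3)[OF generated_relation.step[OF that generated_relation.zero, of x y 1]] by (simp add: scaleC_one)
  ultimately show ?thesis using that by blast
qed

text \<open>Inner products of linear combinations depend only on the Gram matrix of the generators.
  The second slot is expanded first, for a single generator in the first slot; then the first slot
  follows.\<close>

lemma generated_relation_gram:
  assumes H1: "inner_product_space H1" and H2: "inner_product_space H2"
    and x: "\<And>i. i \<in> I \<Longrightarrow> x i \<in> hset H1" and y: "\<And>i. i \<in> I \<Longrightarrow> y i \<in> hset H2"
    and gram: "\<And>i j. i \<in> I \<Longrightarrow> j \<in> I \<Longrightarrow> hip H2 (y i) (y j) = hip H1 (x i) (x j)"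
    and ab: "generated_relation x y I a b" and ab': "generated_relation x y I a' b'"
  shows "hip H2 b b' = hip H1 a a'"
proof -
  note mem = generated_relation_mem[OF _ H1 H2 x y]
  have one: "hip H2 (y i) b' = hip H1 (x i) a'" if i: "i \<in> I" for i
    using ab'
  proof induction
    case zero
    then show ?case using i x y by (simp add: hip_zero_right[OF H1] hip_zero_right[OF H2])
  next
    case (step j a b c)
    then show ?case
      using i x y mem[OF step(2)]
      by (simp add: hip_add_right[OF H1] hip_add_right[OF H2] hset_scale[OF H1] hset_scale[OF H2]
          hip_scale_right[OF H1] hip_scale_right[OF H2] gram)
  qed
  show ?thesis
    using ab
  proof induction
    case zero
    then show ?case using mem[OF ab'] by (simp add: hip_zero_left[OF H1] hip_zero_left[OF H2])
  next
    case (step j a b c)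
    then show ?case
      using x y mem[OF step(2)] mem[OF ab']
      by (simp add: hip_add_left[OF H1] hip_add_left[OF H2] hset_scale[OF H1] hset_scale[OF H2]
          hip_scale_left[OF H1] hip_scale_left[OF H2] one)
  qed
qed

lemma isometries_bounded: "V \<in> isometries E F \<Longrightarrow> V \<in> bounded_ops E F"
  by (auto simp: isometries_def intro!: bounded_opsI[of _ _ _ 1])

text \<open>Polarisation: the norm of x + y yields the real part, and the i-fold of x the imaginary
  part.\<close>

lemma isometry_hip:
  assumes E: "inner_product_space E" and F: "inner_product_space F" and V: "V \<in> isometries E F"
    and x: "x \<in> hset E" and y: "y \<in> hset E"
  shows "hip F (V x) (V y) = hip E x y"
proof -
  have lin: "V \<in> linear_ops E F" and nrm: "\<And>x. x \<in> hset E \<Longrightarrow> hnorm F (V x) = hnorm E x"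
    using V by (auto simp: isometries_def)
  have Re_eq: "Re (hip F (V x) (V y)) = Re (hip E x y)" if x: "x \<in> hset E" and y: "y \<in> hset E" for x y
    using hnorm_add_sq[OF E x y] hnorm_add_sq[OF F op_mem[OF lin x] op_mem[OF lin y]]
      nrm[OF x] nrm[OF y] nrm[OF hset_add[OF E x y]] op_add[OF lin x y] by simp
  have "Re (hip F (V (\<i> *\<^sub>C x)) (V y)) = Re (hip E (\<i> *\<^sub>C x) y)"
    by (intro Re_eq hset_scale[OF E] x y)
  then have "Im (hip F (V x) (V y)) = Im (hip E x y)"
    using x y by (simp add: op_scale[OF lin] hip_scale_left[OF E] hip_scale_left[OF F] op_mem[OF lin])
  then show ?thesis using Re_eq[OF x y] by (simp add: complex_eq_iff)
qed

lemma extend_isometry: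
  assumes H1: "hilbert_space H1" and H2: "hilbert_space H2"
    and total: "total_in H1 (x ` I)" and y: "\<And>i. i \<in> I \<Longrightarrow> y i \<in> hset H2"
    and gram: "\<And>i j. i \<in> I \<Longrightarrow> j \<in> I \<Longrightarrow> hip H2 (y i) (y j) = hip H1 (x i) (x j)"
  obtains V where "V \<in> isometries H1 H2" "\<And>i. i \<in> I \<Longrightarrow> V (x i) = y i"
proof -
  note ips = hilbert_space_ips[OF H1] hilbert_space_ips[OF H2]
  have x: "x i \<in> hset H1" if "i \<in> I" for i
    using total that by (auto simp: total_in_def)
  have norm_le: "hnorm H2 b \<le> 1 * hnorm H1 a" if "generated_relation x y I a b" for a b
    using generated_relation_gram[OF ips x y gram that that] by (simp add: hnorm_def)
  obtain V where V: "V \<in> bounded_ops H1 H2" "\<And>i. i \<in> I \<Longrightarrow> V (x i) = y i"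
    by (rule extend_generators[OF ips(1) H2 zero_le_one total, of y]) (use y in simp, use norm_le in simp, metis)
  \<comment> \<open>The extension gives only a contraction. Equality of norms on the whole space
    follows from this identity, for which equality of the Gram matrices need only be used on
    generators.\<close>
  have "adj H1 H2 V \<circ> V = id_op H1"
  proof (rule bounded_ops_eq_on_total[OF H1 ips(1) _ _ total])
    show "adj H1 H2 V \<circ> V \<in> bounded_ops H1 H1"
      by (rule bounded_ops_comp[OF adj_bounded[OF H1 ips(2) V(1)] V(1) ips(1,2,1)])
    show "id_op H1 \<in> bounded_ops H1 H1"
      by (rule bounded_opsI[OF linear_opsI, where C = 1])
        (auto simp: id_op_def zero_ext_def hset_add[OF ips(1)] hset_scale[OF ips(1)])
    fix z assume "z \<in> x ` I"
    then obtain i where i: "i \<in> I" "z = x i" by blast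
    have "adj H1 H2 V (y i) = x i"
    proof (rule total_hip_ext[OF ips(1) total])
      show "hip H1 s (adj H1 H2 V (y i)) = hip H1 s (x i)" if "s \<in> x ` I" for s
        using that i x y gram V(2) hip_adj[OF H1 ips(2) V(1), of "y i" s] by auto
    qed (use i x y adj_mem[OF H1 ips(2) V(1)] in auto)
    then show "(adj H1 H2 V \<circ> V) z = id_op H1 z"
      using i V(2) x by (simp add: id_op_def zero_ext_def)
  qed
  then have "adj H1 H2 V (V z) = z" if "z \<in> hset H1" for z
    using that by (auto simp: fun_eq_iff id_op_def zero_ext_def)
  then have "hnorm H2 (V z) = hnorm H1 z" if "z \<in> hset H1" for z
    using hip_adj[OF H1 ips(2) V(1) op_mem[OF bounded_ops_linear[OF V(1)] that] that] that
    by (simp add: hnorm_def)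
  then have "V \<in> isometries H1 H2"
    using V(1) by (simp add: isometries_def bounded_ops_linear)
  then show ?thesis using that V(2) by blast
qed

text \<open>Some bound for \<open>T\<close>, however bad, makes it continuous, and continuity
  carries the better constant from the span to the whole space. Used to keep the quadratic decay of
  a Taylor remainder.\<close>

lemma bound_from_total:
  assumes H1: "inner_product_space H1" and H2: "inner_product_space H2" and T: "T \<in> bounded_ops H1 H2"
    and total: "total_in H1 S" and C: "\<And>x. x \<in> cspan S \<Longrightarrow> hnorm H2 (T x) \<le> C * hnorm H1 x"
    and x: "x \<in> hset H1"
  shows "hnorm H2 (T x) \<le> C * hnorm H1 x"
proof -
  note lin = bounded_ops_linear[OF T]
  obtain X where X: "\<And>n. X n \<in> cspan S" "\<And>n. X n \<in> hset H1" "(\<lambda>n. hnorm H1 (X n - x)) \<longlonglongrightarrow> 0"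
    using total_approx_seq[OF H1 total x] by metis
  obtain D where D: "\<And>x. x \<in> hset H1 \<Longrightarrow> hnorm H2 (T x) \<le> D * hnorm H1 x"
    using bounded_ops_bound[OF T H1] by metis
  have "(\<lambda>n. hnorm H2 (T (X n) - T x)) \<longlonglongrightarrow> 0"
  proof (rule Lim_null_comparison)
    show "\<forall>\<^sub>F n in sequentially. norm (hnorm H2 (T (X n) - T x)) \<le> D * hnorm H1 (X n - x)"
      using D[of "X _ - x"] X(2) x op_mem[OF lin]
      by (auto simp: op_diff[OF lin H1] hset_diff[OF H1] hset_diff[OF H2] hnorm_nonneg[OF H2])
    show "(\<lambda>n. D * hnorm H1 (X n - x)) \<longlonglongrightarrow> 0"
      using X(3) by (rule tendsto_mult_right_zero)
  qed
  then have "(\<lambda>n. hnorm H2 (T (X n))) \<longlonglongrightarrow> hnorm H2 (T x)"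
    using X(2) x op_mem[OF lin] by (intro tendsto_hnorm[OF H2]) auto
  moreover have "(\<lambda>n. C * hnorm H1 (X n)) \<longlonglongrightarrow> C * hnorm H1 x"
    using X x by (intro tendsto_mult_left tendsto_hnorm[OF H1])
  ultimately show ?thesis
    using C[OF X(1)] by (intro tendsto_le[OF sequentially_bot]) auto
qed

section \<open>Schur products\<close>

text \<open>Induction by one Gram-Schmidt step. Writing e_q = e'_q + c_q u with u the last vector
  and e'_q orthogonal to u splits the Gram matrix into that of the e'_q plus the rank-one matrix n
  c_q cnj(c_p). The rank-one part gives the quadratic form of b at c; since e'_m = 0, the rest is a
  sum of size m.\<close>

lemma Schur_product_nonneg:
  fixes b :: "nat \<Rightarrow> nat \<Rightarrow> complex"
  assumes F: "inner_product_space F"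
    and "\<And>j. j < m \<Longrightarrow> e j \<in> hset F"
    and "\<And>c. (\<Sum>p<m. \<Sum>q<m. c q * cnj (c p) * b q p) \<in> \<real>\<^sub>\<ge>\<^sub>0"
  shows "(\<Sum>p<m. \<Sum>q<m. b q p * hip F (e q) (e p)) \<in> \<real>\<^sub>\<ge>\<^sub>0"
  using assms(2,3)
proof (induction m arbitrary: e)
  case 0
  then show ?case by simp
next
  case (Suc m)
  define u where "u = e m"
  define n where "n = (hnorm F u)\<^sup>2"
  define c where "c q = hip F (e q) u / of_real n" for q
  define e' where "e' q = e q - c q *\<^sub>C u" for q
  have u: "u \<in> hset F" using Suc.prems(1) by (simp add: u_def)
  have e: "e q \<in> hset F" if "q < Suc m" for q
    using Suc.prems(1) that by simp
  have e'_mem: "e' q \<in> hset F" if "q < Suc m" for q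
    using e[OF that] u by (simp add: e'_def hset_diff[OF F] hset_scale[OF F])
  \<comment> \<open>For u = 0 the division in \<open>c\<close> yields 0, and the identity still
    holds because both sides vanish.\<close>
  have cn: "hip F (e q) u = of_real n * c q" if "q < Suc m" for q
    using e[OF that] u by (cases "u = 0") (auto simp: c_def n_def hip_zero_right[OF F] hnorm_eq_zero[OF F])
  have nu: "hip F u u = of_real n"
    using u by (simp add: n_def hip_self[OF F])
  have e'm: "e' m = 0"
  proof (cases "u = 0")
    case False
    then have "c m = 1"
      using u hnorm_eq_zero[OF F u] by (simp add: c_def u_def[symmetric] nu n_def)
    then show ?thesis by (simp add: e'_def u_def scaleC_one)
  qed (simp add: e'_def u_def)
  have split: "hip F (e q) (e p) = hip F (e' q) (e' p) + of_real n * (c q * cnj (c p))"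
    if q: "q < Suc m" and p: "p < Suc m" for p q
  proof -
    have "hip F u (e p) = of_real n * cnj (c p)"
      using hip_commute[OF F e[OF p] u] cn[OF p] by simp
    then show ?thesis
      using e[OF q] e[OF p] u
      by (simp add: e'_def hip_diff_left[OF F] hip_diff_right[OF F] hset_scale[OF F] hset_diff[OF F]
          hip_scale_left[OF F] hip_scale_right[OF F] cn[OF q] nu algebra_simps)
  qed
  have "(\<Sum>p<Suc m. \<Sum>q<Suc m. b q p * hip F (e q) (e p))
      = (\<Sum>p<Suc m. \<Sum>q<Suc m. b q p * hip F (e' q) (e' p))
        + of_real n * (\<Sum>p<Suc m. \<Sum>q<Suc m. c q * cnj (c p) * b q p)"
    unfolding sum_distrib_left sum.distrib[symmetric]
    by (intro sum.cong refl) (simp add: split algebra_simps)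
  also have "(\<Sum>p<Suc m. \<Sum>q<Suc m. b q p * hip F (e' q) (e' p))
      = (\<Sum>p<m. \<Sum>q<m. b q p * hip F (e' q) (e' p))"
    using e'm e'_mem by (simp add: hip_zero_left[OF F] hip_zero_right[OF F] hset_zero[OF F])
  finally have eq: "(\<Sum>p<Suc m. \<Sum>q<Suc m. b q p * hip F (e q) (e p))
      = (\<Sum>p<m. \<Sum>q<m. b q p * hip F (e' q) (e' p))
        + of_real n * (\<Sum>p<Suc m. \<Sum>q<Suc m. c q * cnj (c p) * b q p)" .
  have "(\<Sum>p<m. \<Sum>q<m. b q p * hip F (e' q) (e' p)) \<in> \<real>\<^sub>\<ge>\<^sub>0"
  proof (rule Suc.IH)
    show "e' j \<in> hset F" if "j < m" for j using e'_mem that by simp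
    show "(\<Sum>p<m. \<Sum>q<m. d q * cnj (d p) * b q p) \<in> \<real>\<^sub>\<ge>\<^sub>0" for d
      \<comment> \<open>A zero last coefficient restricts positivity of b to its leading block of
        size m.\<close>
      using Suc.prems(2)[of "d(m := 0)"] by simp
  qed
  moreover have "of_real n * (\<Sum>p<Suc m. \<Sum>q<Suc m. c q * cnj (c p) * b q p) \<in> \<real>\<^sub>\<ge>\<^sub>0"
    by (intro nonneg_Reals_mult_I Suc.prems(2)) (auto simp: n_def simp del: of_real_power)
  ultimately show ?case
    unfolding eq by (rule nonneg_Reals_add_I)
qed

section \<open>Uniform boundedness\<close>

text \<open>Sokal's gliding-hump argument, which does not use the Baire category theorem.\<close>

lemma weakly_bounded_imp_bounded:
  assumes H: "hilbert_space H" and Y: "Y \<subseteq> hset H"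
    and weak: "\<And>x. x \<in> hset H \<Longrightarrow> \<exists>B. \<forall>y\<in>Y. cmod (hip H x y) \<le> B"
  obtains B where "\<And>y. y \<in> Y \<Longrightarrow> hnorm H y \<le> B"
proof (rule ccontr)
  assume "\<not> thesis"
  then have unb: "\<exists>y\<in>Y. hnorm H y > B" for B
    using that by (meson not_le)
  note ips = hilbert_space_ips[OF H]
  \<comment> \<open>The factor 3^n compensates for the size (1/3)^n of the n-th hump, the factor n
    makes the pairing exceed every bound, and 2 pays for the half that the later humps may
    cancel.\<close>
  have "\<exists>y\<in>Y. hnorm H y > 2 * real n * 3 ^ n" for n
    using unb by blast
  then obtain y where yY: "\<And>n. y n \<in> Y" and y_big: "\<And>n. hnorm H (y n) > 2 * real n * 3 ^ n"
    by metis
  have y: "y n \<in> hset H" for n using yY Y by blast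
  have y_pos: "hnorm H (y n) > 0" for n
    using y_big[of n] by (rule le_less_trans[rotated]) simp
  define v where "v n = of_real ((1/3) ^ n / hnorm H (y n)) *\<^sub>C y n" for n
  have v: "v n \<in> hset H" for n by (simp add: v_def hset_scale[OF ips] y)
  have v_norm: "hnorm H (v n) = (1/3) ^ n" for n
    using y_pos[of n] by (simp add: v_def hnorm_scale[OF ips] y norm_divide norm_power)
  have v_hip: "cmod (hip H (v n) (y n)) = (1/3) ^ n * hnorm H (y n)" for n
    using y_pos[of n] by (simp add: v_def hip_scale_left[OF ips] y norm_mult norm_divide norm_power
        hip_self[OF ips] power2_eq_square)
  \<comment> \<open>The sign of the hump is chosen so that the pairing with \<open>y n\<close> is
    large. One sign always works: the pairings of x + v and x - v with \<open>y n\<close> differ by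
    2 <v, y n>, so they cannot both be smaller than |<v, y n>|.\<close>
  define x where "x = rec_nat 0 (\<lambda>n a. if (1/3) ^ n * hnorm H (y n) \<le> cmod (hip H (a + v n) (y n))
      then a + v n else a - v n)"
  have x0: "x 0 = 0" by (simp add: x_def)
  have xSuc: "x (Suc n) = (if (1/3) ^ n * hnorm H (y n) \<le> cmod (hip H (x n + v n) (y n))
      then x n + v n else x n - v n)" for n
    by (simp add: x_def)
  have x: "x n \<in> hset H" for n
    by (induction n) (auto simp: x0 xSuc hset_zero[OF ips] hset_add[OF ips] hset_diff[OF ips] v)
  have step: "hnorm H (x (Suc n) - x n) = (1/3) ^ n" for n
    using v_norm[of n] hnorm_minus[OF ips v, of n] by (simp add: xSuc)
  have large: "(1/3) ^ n * hnorm H (y n) \<le> cmod (hip H (x (Suc n)) (y n))" for n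
  proof (cases "(1/3) ^ n * hnorm H (y n) \<le> cmod (hip H (x n + v n) (y n))")
    case False
    have "2 * hip H (v n) (y n) = hip H (x n + v n) (y n) - hip H (x n - v n) (y n)"
      by (simp add: hip_add_left[OF ips] hip_diff_left[OF ips] x v y)
    then have "cmod (2 * hip H (v n) (y n)) \<le> cmod (hip H (x n + v n) (y n)) + cmod (hip H (x n - v n) (y n))"
      by (simp only: norm_triangle_ineq4)
    then have "2 * ((1/3) ^ n * hnorm H (y n)) \<le> cmod (hip H (x n + v n) (y n)) + cmod (hip H (x n - v n) (y n))"
      by (simp add: norm_mult v_hip)
    then show ?thesis using False unfolding xSuc by simp
  qed (simp add: xSuc)
  \<comment> \<open>Sum of the geometric series of hump sizes; 3/2 is 1/(1 - 1/3).\<close>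
  have dist: "hnorm H (x (n + k) - x n) \<le> 3/2 * ((1/3) ^ n - (1/3) ^ (n + k))" for n k
  proof (induction k)
    case 0
    then show ?case by (simp add: hnorm_zero[OF ips])
  next
    case (Suc k)
    have "hnorm H (x (n + Suc k) - x n) \<le> hnorm H (x (Suc (n + k)) - x (n + k)) + hnorm H (x (n + k) - x n)"
      using hnorm_triangle_diff[OF ips x x x] by simp
    also have "\<dots> \<le> (1/3) ^ (n + k) + 3/2 * ((1/3) ^ n - (1/3) ^ (n + k))"
      using Suc step by simp
    also have "\<dots> = 3/2 * ((1/3) ^ n - (1/3) ^ (n + Suc k))"
      by (simp add: algebra_simps)
    finally show ?case .
  qed
  have dist': "hnorm H (x m - x n) \<le> 3/2 * (1/3) ^ n" if "m \<ge> n" for m n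
  proof -
    have "hnorm H (x (n + (m - n)) - x n) \<le> 3/2 * (1/3) ^ n"
      by (rule order_trans[OF dist]) simp
    then show ?thesis using that by simp
  qed
  have "Cauchy_in H x"
    unfolding Cauchy_in_def
  proof (intro conjI allI impI x)
    fix e :: real assume e: "e > 0"
    obtain N where N: "(1/3::real) ^ N < e / 3"
      using real_arch_pow_inv[of "e/3" "1/3"] e by auto
    have "hnorm H (x m - x n) < e" if "m \<ge> N" "n \<ge> N" for m n
      using hnorm_triangle_diff[OF ips x x x, of m n N] hnorm_diff_commute[OF ips x x, of N n]
        dist'[OF that(1)] dist'[OF that(2)] N by linarith
    then show "\<exists>N. \<forall>m\<ge>N. \<forall>n\<ge>N. hnorm H (x m - x n) < e" by blast
  qed
  then obtain z where z: "z \<in> hset H" and lim: "(\<lambda>n. hnorm H (x n - z)) \<longlonglongrightarrow> 0"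
    by (rule hilbert_complete[OF H])
  have z_dist: "hnorm H (z - x n) \<le> 3/2 * (1/3) ^ n" for n
  proof (rule tendsto_le[OF sequentially_bot _ tendsto_const])
    show "(\<lambda>m. hnorm H (x m - z) + 3/2 * (1/3) ^ n) \<longlonglongrightarrow> 3/2 * (1/3) ^ n"
      using tendsto_add[OF lim tendsto_const] by simp
    show "\<forall>\<^sub>F m in sequentially. hnorm H (z - x n) \<le> hnorm H (x m - z) + 3/2 * (1/3) ^ n"
      using eventually_ge_at_top[of n]
    proof eventually_elim
      case (elim m)
      then show ?case
        using hnorm_triangle_diff[OF ips z x x, of n m] hnorm_diff_commute[OF ips z x, of m]
          dist'[OF elim] by linarith
    qed
  qed
  obtain B where B: "\<And>y. y \<in> Y \<Longrightarrow> cmod (hip H z y) \<le> B"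
    using weak[OF z] by blast
  obtain n :: nat where n: "real n > B"
    using reals_Archimedean2 by blast
  \<comment> \<open>Everything added after the n-th hump has norm at most 3/2 (1/3)^(n+1), half of
    (1/3)^n; it can destroy at most half of the pairing secured in \<open>large\<close>.\<close>
  have "cmod (hip H (z - x (Suc n)) (y n)) \<le> hnorm H (z - x (Suc n)) * hnorm H (y n)"
    by (intro Cauchy_Schwarz[OF ips] hset_diff[OF ips] z x y)
  also have "\<dots> \<le> 1/2 * (1/3) ^ n * hnorm H (y n)"
    using z_dist[of "Suc n"] y_pos[of n] by (intro mult_right_mono) auto
  finally have "cmod (hip H (z - x (Suc n)) (y n)) \<le> 1/2 * (1/3) ^ n * hnorm H (y n)" .
  moreover have "hip H (x (Suc n)) (y n) = hip H z (y n) - hip H (z - x (Suc n)) (y n)"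
    by (simp add: hip_diff_left[OF ips] z x y)
  then have "cmod (hip H (x (Suc n)) (y n)) \<le> cmod (hip H z (y n)) + cmod (hip H (z - x (Suc n)) (y n))"
    by (simp only: norm_triangle_ineq4)
  ultimately have "1/2 * (1/3) ^ n * hnorm H (y n) \<le> cmod (hip H z (y n))"
    using large[of n] by linarith
  also have "\<dots> \<le> B" using B yY by blast
  finally have "(1/3) ^ n * hnorm H (y n) \<le> 2 * B" by simp
  then have "hnorm H (y n) \<le> 2 * B * 3 ^ n"
    by (simp add: power_divide divide_le_eq)
  also have "\<dots> \<le> 2 * real n * 3 ^ n"
    using n by simp
  finally show False using y_big[of n] by simp
qed

text \<open>A Hellinger-Toeplitz argument. The adjoint vectors of the unit ball of the span are
  weakly bounded, since |<f, s'>| = |<T f, s>| \<le> ||T f||; uniform boundedness bounds them in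
  norm, and duality returns the bound for \<open>T\<close>. It is what makes multiplication by a
  coordinate bounded on a module.\<close>

lemma bounded_of_dense_adjoint:
  assumes H1: "hilbert_space H1" and H2: "inner_product_space H2" and T: "T \<in> linear_ops H1 H2"
    and total: "total_in H2 S"
    and adj: "\<And>s. s \<in> S \<Longrightarrow> \<exists>s'\<in>hset H1. \<forall>f\<in>hset H1. hip H2 (T f) s = hip H1 f s'"
  shows "T \<in> bounded_ops H1 H2"
proof -
  note ips1 = hilbert_space_ips[OF H1]
  have S: "S \<subseteq> hset H2" using total by (simp add: total_in_def)
  have adj_span: "s \<in> hset H2 \<and> (\<exists>s'\<in>hset H1. \<forall>f\<in>hset H1. hip H2 (T f) s = hip H1 f s')" if "s \<in> cspan S" for s
    using that
  proof (induction rule: complex_vector.span_induct_alt)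
    case base
    show ?case
      using hset_zero[OF ips1] op_mem[OF T]
      by (intro conjI bexI[of _ 0]) (auto simp: hset_zero[OF H2] hip_zero_right[OF ips1] hip_zero_right[OF H2])
  next
    case (step c x y)
    obtain y' where y': "y' \<in> hset H1" "\<forall>f\<in>hset H1. hip H2 (T f) y = hip H1 f y'"
      using step by blast
    obtain x' where x': "x' \<in> hset H1" "\<forall>f\<in>hset H1. hip H2 (T f) x = hip H1 f x'"
      using adj step by blast
    have mem: "x \<in> hset H2" "y \<in> hset H2" using S step by auto
    show ?case
      using x' y' mem op_mem[OF T]
      by (intro conjI bexI[of _ "c *\<^sub>C x' + y'"])
        (simp_all add: hset_add[OF H2] hset_scale[OF H2] hset_add[OF ips1] hset_scale[OF ips1]
          hip_add_right[OF H2] hip_scale_right[OF H2] hip_add_right[OF ips1] hip_scale_right[OF ips1])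
  qed
  \<comment> \<open>The image of the unit ball of the span of \<open>S\<close> under the densely
    defined adjoint.\<close>
  define Y where "Y = {s' \<in> hset H1. \<exists>s\<in>cspan S. hnorm H2 s \<le> 1 \<and> (\<forall>f\<in>hset H1. hip H2 (T f) s = hip H1 f s')}"
  have "\<exists>B. \<forall>y\<in>Y. cmod (hip H1 f y) \<le> B" if f: "f \<in> hset H1" for f
  proof (intro exI ballI)
    fix y assume "y \<in> Y"
    then obtain s where s: "s \<in> cspan S" "hnorm H2 s \<le> 1" "hip H2 (T f) s = hip H1 f y"
      using f by (auto simp: Y_def)
    have "cmod (hip H1 f y) \<le> hnorm H2 (T f) * hnorm H2 s"
      using Cauchy_Schwarz[OF H2 op_mem[OF T f], of s] adj_span[OF s(1)] s(3) by simp
    also have "\<dots> \<le> hnorm H2 (T f)"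
      using mult_left_mono[OF s(2) hnorm_nonneg[OF H2 op_mem[OF T f]]] by simp
    finally show "cmod (hip H1 f y) \<le> hnorm H2 (T f)" .
  qed
  moreover have "Y \<subseteq> hset H1" by (auto simp: Y_def)
  ultimately obtain B where B: "\<And>y. y \<in> Y \<Longrightarrow> hnorm H1 y \<le> B"
    using weakly_bounded_imp_bounded[OF H1] by metis
  have span_bound: "cmod (hip H2 (T f) s) \<le> B * hnorm H1 f * hnorm H2 s" if f: "f \<in> hset H1" and s: "s \<in> cspan S" for f s
  proof (cases "s = 0")
    case True
    then show ?thesis using op_mem[OF T f] hnorm_zero[OF H2] by (simp add: hip_zero_right[OF H2])
  next
    case False
    have sH: "s \<in> hset H2" using adj_span[OF s] by simp
    have n: "hnorm H2 s > 0" using False hnorm_nonneg[OF H2 sH] hnorm_eq_zero[OF H2 sH] by simp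
    define u where "u = of_real (inverse (hnorm H2 s)) *\<^sub>C s"
    have u: "u \<in> cspan S" "hnorm H2 u \<le> 1" "u \<in> hset H2"
      using n s sH by (simp_all add: u_def hnorm_scale[OF H2] norm_inverse hset_scale[OF H2] complex_vector.span_scale)
    obtain u' where u': "u' \<in> hset H1" "\<forall>f\<in>hset H1. hip H2 (T f) u = hip H1 f u'"
      using adj_span[OF u(1)] by blast
    then have "hnorm H1 u' \<le> B"
      using u by (intro B) (auto simp: Y_def)
    have "cmod (hip H2 (T f) u) = cmod (hip H1 f u')"
      using u' f by simp
    also have "\<dots> \<le> hnorm H1 f * hnorm H1 u'"
      by (intro Cauchy_Schwarz[OF ips1] f u')
    also have "\<dots> \<le> hnorm H1 f * B"
      by (intro mult_left_mono \<open>hnorm H1 u' \<le> B\<close> hnorm_nonneg[OF ips1] f)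
    finally have "cmod (hip H2 (T f) u) \<le> B * hnorm H1 f" by (simp add: mult.commute)
    moreover have "cmod (hip H2 (T f) u) = cmod (hip H2 (T f) s) / hnorm H2 s"
      using op_mem[OF T f] sH n
      by (simp add: u_def hip_scale_right[OF H2] norm_mult norm_inverse divide_inverse mult.commute)
    ultimately show ?thesis using n by (simp add: divide_le_eq)
  qed
  have "hnorm H2 (T f) \<le> B * hnorm H1 f" if f: "f \<in> hset H1" for f
  proof -
    obtain X where X: "\<And>n. X n \<in> cspan S" "\<And>n. X n \<in> hset H2" "(\<lambda>n. hnorm H2 (X n - T f)) \<longlonglongrightarrow> 0"
      using total_approx_seq[OF H2 total op_mem[OF T f]] by metis
    have "cmod (hip H2 (T f) (T f)) \<le> B * hnorm H1 f * hnorm H2 (T f)"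
    proof (rule tendsto_le[OF sequentially_bot])
      show "(\<lambda>n. cmod (hip H2 (T f) (X n))) \<longlonglongrightarrow> cmod (hip H2 (T f) (T f))"
        by (intro tendsto_norm tendsto_hip[OF H2] X op_mem[OF T f]) (simp add: hnorm_zero[OF H2])
      show "(\<lambda>n. B * hnorm H1 f * hnorm H2 (X n)) \<longlonglongrightarrow> B * hnorm H1 f * hnorm H2 (T f)"
        by (intro tendsto_mult_left tendsto_hnorm[OF H2] X op_mem[OF T f])
      show "\<forall>\<^sub>F n in sequentially. cmod (hip H2 (T f) (X n)) \<le> B * hnorm H1 f * hnorm H2 (X n)"
        using span_bound[OF f X(1)] by simp
    qed
    moreover obtain u where "u \<in> Y"
    proof -
      \<comment> \<open>A member of \<open>Y\<close> is needed to see that \<open>B\<close> is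
        nonnegative.\<close>
      have "0 \<in> Y"
        using hset_zero[OF ips1] op_mem[OF T] complex_vector.span_zero[of S] hnorm_zero[OF H2]
        by (force simp: Y_def hip_zero_right[OF ips1] hip_zero_right[OF H2])
      then show thesis by (rule that)
    qed
    then have "0 \<le> B" using B Y_def hnorm_nonneg[OF ips1] order_trans by blast
    ultimately show ?thesis
      by (intro hnorm_le_of_hip[OF H2 op_mem[OF T f]]) (auto simp: hnorm_nonneg[OF ips1] f)
  qed
  then show ?thesis by (rule bounded_opsI[OF T])
qed

section \<open>Reproducing kernel Hilbert spaces\<close>

lemma scaleC_fun_apply: "(a *\<^sub>C f) x = a *\<^sub>C f x"
  by (simp add: scaleC_fun_def)

definition eval_op :: "('x \<Rightarrow> 'e::complex_vector) hspace \<Rightarrow> 'x \<Rightarrow> ('x \<Rightarrow> 'e) \<Rightarrow> 'e"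
  where "eval_op H w = zero_ext (hset H) (\<lambda>f. f w)"

context
  fixes E :: "'e::complex_vector hspace" and X :: "'x set" and K :: "'x \<Rightarrow> 'x \<Rightarrow> 'e \<Rightarrow> 'e"
    and H :: "('x \<Rightarrow> 'e) hspace"
  assumes E: "hilbert_space E" and K: "is_kernel E X K" and H: "is_rkhs E X K H"
begin

lemma rkhs_hilbert: "hilbert_space H"
  using H by (simp add: is_rkhs_def)

lemma rkhs_ips: "inner_product_space H"
  by (rule hilbert_space_ips[OF rkhs_hilbert])

lemma rkhs_value: "f \<in> hset H \<Longrightarrow> w \<in> X \<Longrightarrow> f w \<in> hset E"
  using H by (simp add: is_rkhs_def)

lemma rkhs_total: "total_in H ((\<lambda>(w, \<eta>). kernel_fun X K w \<eta>) ` (X \<times> hset E))"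
proof -
  have "(\<lambda>(w, \<eta>). kernel_fun X K w \<eta>) ` (X \<times> hset E) = {kernel_fun X K w \<eta> | w \<eta>. w \<in> X \<and> \<eta> \<in> hset E}"
    by auto
  then show ?thesis using H by (simp add: is_rkhs_def)
qed

lemma kernel_fun_mem: "w \<in> X \<Longrightarrow> \<eta> \<in> hset E \<Longrightarrow> kernel_fun X K w \<eta> \<in> hset H"
  using rkhs_total by (auto simp: total_in_def)

lemma reproducing: "f \<in> hset H \<Longrightarrow> w \<in> X \<Longrightarrow> \<eta> \<in> hset E \<Longrightarrow> hip H f (kernel_fun X K w \<eta>) = hip E (f w) \<eta>"
  using H by (simp add: is_rkhs_def)

lemma kernel_bounded: "z \<in> X \<Longrightarrow> w \<in> X \<Longrightarrow> K z w \<in> bounded_ops E E"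
  using K by (simp add: is_kernel_def)

lemma kernel_mem: "z \<in> X \<Longrightarrow> w \<in> X \<Longrightarrow> \<eta> \<in> hset E \<Longrightarrow> K z w \<eta> \<in> hset E"
  by (rule op_mem[OF bounded_ops_linear[OF kernel_bounded]])

lemma kernel_fun_apply: "z \<in> X \<Longrightarrow> kernel_fun X K w \<eta> z = K z w \<eta>"
  by (simp add: kernel_fun_def zero_ext_def)

lemma kernel_fun_hip:
  "z \<in> X \<Longrightarrow> w \<in> X \<Longrightarrow> \<eta> \<in> hset E \<Longrightarrow> \<xi> \<in> hset E \<Longrightarrow>
    hip H (kernel_fun X K w \<eta>) (kernel_fun X K z \<xi>) = hip E (K z w \<eta>) \<xi>"
  using reproducing[OF kernel_fun_mem] by (simp add: kernel_fun_apply)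

lemma kernel_fun_scale:
  assumes "w \<in> X" "\<eta> \<in> hset E"
  shows "kernel_fun X K w (a *\<^sub>C \<eta>) = a *\<^sub>C kernel_fun X K w \<eta>"
  using assms op_scale[OF bounded_ops_linear[OF kernel_bounded]]
  by (auto simp: kernel_fun_def zero_ext_def fun_eq_iff scaleC_fun_apply)

text \<open>The kernel function is the adjoint of the point evaluation applied to \<eta>, so a bound
  for one is a bound for the other; concretely f is paired with the kernel function for \<eta> =
  f(w).\<close>

lemma eval_norm_le:
  assumes f: "f \<in> hset H" and w: "w \<in> X" and "0 \<le> C"
    and C: "\<And>\<eta>. \<eta> \<in> hset E \<Longrightarrow> hnorm H (kernel_fun X K w \<eta>) \<le> C * hnorm E \<eta>"
  shows "hnorm E (f w) \<le> C * hnorm H f"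
proof (rule hnorm_le_of_hip[OF hilbert_space_ips[OF E] rkhs_value[OF f w]])
  show "0 \<le> C * hnorm H f" using \<open>0 \<le> C\<close> f by (simp add: hnorm_nonneg[OF rkhs_ips])
  have "cmod (hip E (f w) (f w)) = cmod (hip H f (kernel_fun X K w (f w)))"
    using f w by (simp add: reproducing rkhs_value)
  also have "\<dots> \<le> hnorm H f * hnorm H (kernel_fun X K w (f w))"
    using f w by (intro Cauchy_Schwarz[OF rkhs_ips] kernel_fun_mem rkhs_value)
  also have "\<dots> \<le> hnorm H f * (C * hnorm E (f w))"
    using f w by (intro mult_left_mono C rkhs_value hnorm_nonneg[OF rkhs_ips])
  finally show "cmod (hip E (f w) (f w)) \<le> C * hnorm H f * hnorm E (f w)"
    by (simp add: algebra_simps)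
qed

lemma kernel_fun_norm_sq:
  assumes "w \<in> X" "\<eta> \<in> hset E"
  shows "(hnorm H (kernel_fun X K w \<eta>))\<^sup>2 = Re (hip E (K w w \<eta>) \<eta>)"
  using assms by (simp add: hnorm_sq[OF rkhs_ips] kernel_fun_mem kernel_fun_hip)

lemma kernel_fun_bounded:
  assumes w: "w \<in> X"
  obtains C where "C \<ge> 0" "\<And>\<eta>. \<eta> \<in> hset E \<Longrightarrow> hnorm H (kernel_fun X K w \<eta>) \<le> C * hnorm E \<eta>"
proof -
  note ips = hilbert_space_ips[OF E]
  obtain D where D: "D > 0" "\<And>x. x \<in> hset E \<Longrightarrow> hnorm E (K w w x) \<le> D * hnorm E x"
    using bounded_ops_bound[OF kernel_bounded[OF w w] ips] by metis
  \<comment> \<open>The squared norm of the kernel function is <K(w, w) \<eta>, \<eta>>, which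
    explains the square root of the bound for K(w, w).\<close>
  have "hnorm H (kernel_fun X K w \<eta>) \<le> sqrt D * hnorm E \<eta>" if \<eta>: "\<eta> \<in> hset E" for \<eta>
  proof (rule power2_le_imp_le)
    have "(hnorm H (kernel_fun X K w \<eta>))\<^sup>2 \<le> cmod (hip E (K w w \<eta>) \<eta>)"
      using kernel_fun_norm_sq[OF w \<eta>] complex_Re_le_cmod by simp
    also have "\<dots> \<le> hnorm E (K w w \<eta>) * hnorm E \<eta>"
      by (intro Cauchy_Schwarz[OF ips] kernel_mem w \<eta>)
    also have "\<dots> \<le> D * hnorm E \<eta> * hnorm E \<eta>"
      by (intro mult_right_mono D hnorm_nonneg[OF ips] \<eta>)
    also have "\<dots> = (sqrt D * hnorm E \<eta>)\<^sup>2"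
      using D(1) by (simp add: power_mult_distrib power2_eq_square)
    finally show "(hnorm H (kernel_fun X K w \<eta>))\<^sup>2 \<le> (sqrt D * hnorm E \<eta>)\<^sup>2" .
    show "0 \<le> sqrt D * hnorm E \<eta>" using D(1) hnorm_nonneg[OF ips \<eta>] by simp
  qed
  then show ?thesis using that[of "sqrt D"] D(1) by simp
qed

lemma eval_op_bounded:
  assumes "w \<in> X"
  shows "eval_op H w \<in> bounded_ops H E"
proof -
  obtain C where C: "C \<ge> 0" "\<And>\<eta>. \<eta> \<in> hset E \<Longrightarrow> hnorm H (kernel_fun X K w \<eta>) \<le> C * hnorm E \<eta>"
    using kernel_fun_bounded[OF assms] by metis
  show ?thesis
    by (rule bounded_opsI[OF linear_opsI, where C = C])
      (use assms in \<open>auto simp: eval_op_def zero_ext_def rkhs_value hset_add[OF rkhs_ips] hset_scale[OF rkhs_ips]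
        scaleC_fun_apply intro!: eval_norm_le C\<close>)
qed

text \<open>The reproducing property read as a statement on adjoints. It exhibits any kernel as
  evaluation at z composed with the adjoint of evaluation at w, the source of \<Phi> when a quotient
  kernel is given.\<close>

lemma adj_eval_op:
  assumes "w \<in> X" "\<eta> \<in> hset E"
  shows "adj H E (eval_op H w) \<eta> = kernel_fun X K w \<eta>"
  by (rule adj_eqI[OF rkhs_ips])
    (use assms in \<open>auto simp: kernel_fun_mem reproducing eval_op_def zero_ext_def\<close>)

end

text \<open>Both claims rest on \<open>hip_M\<close>: moving the scalar w_j across the inner product
  produces an adjoint vector for each kernel function. These vectors are total, which gives
  boundedness, and the vector found is then the value of the adjoint.\<close>

lemma M_op_bounded:
  fixes H :: "(complex ^ 'n \<Rightarrow> 'e::complex_vector) hspace"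
  assumes E: "hilbert_space E" and K: "is_kernel E \<Omega> K" and H: "is_rkhs E \<Omega> K H" and module: "is_module H"
  shows "M_op H j \<in> bounded_ops H H"
    and "w \<in> \<Omega> \<Longrightarrow> \<eta> \<in> hset E \<Longrightarrow>
      adj H H (M_op H j) (kernel_fun \<Omega> K w \<eta>) = cnj (w $ j) *\<^sub>C kernel_fun \<Omega> K w \<eta>"
proof -
  note ips = rkhs_ips[OF E K H] and ipsE = hilbert_space_ips[OF E]
  have M: "M_op H j f = coord_mult j f" "coord_mult j f \<in> hset H" if "f \<in> hset H" for f
    using that module by (auto simp: M_op_def zero_ext_def is_module_def)
  have lin: "M_op H j \<in> linear_ops H H"
  proof (rule linear_opsI)
    show "M_op H j x = 0" if "x \<notin> hset H" for x
      using that by (simp add: M_op_def zero_ext_def)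
    show "M_op H j (x + y) = M_op H j x + M_op H j y" if "x \<in> hset H" "y \<in> hset H" for x y
      using that hset_add[OF ips that] by (simp add: M coord_mult_def fun_eq_iff scaleC_add_right)
    show "M_op H j (a *\<^sub>C x) = a *\<^sub>C M_op H j x" if "x \<in> hset H" for a x
      using that hset_scale[OF ips that]
      by (simp add: M coord_mult_def fun_eq_iff scaleC_fun_apply scaleC_scaleC mult.commute)
  qed (simp add: M)
  have hip_M: "hip H (M_op H j f) (kernel_fun \<Omega> K w \<eta>) = hip H f (cnj (w $ j) *\<^sub>C kernel_fun \<Omega> K w \<eta>)"
    if f: "f \<in> hset H" and "w \<in> \<Omega>" "\<eta> \<in> hset E" for f w \<eta>
  proof -
    note k = kernel_fun_mem[OF E K H that(2,3)] and rep = reproducing[OF E K H _ that(2,3)]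
    show ?thesis
      using that k rkhs_value[OF E K H f that(2)]
      by (simp add: M rep hip_scale_right[OF ips]) (simp add: coord_mult_def hip_scale_left[OF ipsE])
  qed
  show "M_op H j \<in> bounded_ops H H"
  proof (rule bounded_of_dense_adjoint[OF rkhs_hilbert[OF E K H] ips lin rkhs_total[OF E K H]])
    fix s assume "s \<in> (\<lambda>(w, \<eta>). kernel_fun \<Omega> K w \<eta>) ` (\<Omega> \<times> hset E)"
    then obtain w \<eta> where w: "w \<in> \<Omega>" "\<eta> \<in> hset E" "s = kernel_fun \<Omega> K w \<eta>" by auto
    then show "\<exists>s'\<in>hset H. \<forall>f\<in>hset H. hip H (M_op H j f) s = hip H f s'"
      using hip_M hset_scale[OF ips kernel_fun_mem[OF E K H]] by blast
  qed
  show "adj H H (M_op H j) (kernel_fun \<Omega> K w \<eta>) = cnj (w $ j) *\<^sub>C kernel_fun \<Omega> K w \<eta>"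
    if "w \<in> \<Omega>" "\<eta> \<in> hset E"
    by (rule adj_eqI[OF ips]) (use that hip_M in \<open>auto simp: kernel_fun_mem[OF E K H] hset_scale[OF ips]\<close>)
qed

section \<open>Holomorphic functions with values in a normed space\<close>

text \<open>The constant is 32 = 2!/(1/4)^2, Cauchy's inequality for the second derivative on discs
  of radius 1/4. Taylor's estimate is used with \<open>n = 1\<close>, where it divides by
  \<open>fact 1\<close> and so gains no further factor. Linearity in \<open>M\<close> is what later
  matters.\<close>

lemma quadratic_remainder_disc:
  assumes hol: "\<phi> holomorphic_on ball 0 1" and M: "\<And>t. cmod t < 1 \<Longrightarrow> cmod (\<phi> t) \<le> M"
    and t: "cmod t \<le> 1/2"
  shows "cmod (\<phi> t - \<phi> 0 - deriv \<phi> 0 * t) \<le> 32 * M * (cmod t)\<^sup>2"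
proof -
  let ?S = "cball (0::complex) (1/2)"
  have "cmod ((deriv ^^ 0) \<phi> t - (\<Sum>i\<le>1. (deriv ^^ i) \<phi> 0 * (t - 0) ^ i / fact i))
      \<le> 32 * M * cmod (t - 0) ^ Suc 1 / fact 1"
  proof (rule field_Taylor[where f = "\<lambda>i. (deriv ^^ i) \<phi>" and n = 1])
    show "convex ?S" by simp
    show "((deriv ^^ i) \<phi> has_field_derivative (deriv ^^ Suc i) \<phi> x) (at x within ?S)" if "x \<in> ?S" for i x
    proof -
      have "(deriv ^^ i) \<phi> holomorphic_on ball 0 1"
        by (intro holomorphic_higher_deriv hol) simp
      then have "((deriv ^^ i) \<phi> has_field_derivative deriv ((deriv ^^ i) \<phi>) x) (at x)"
        using that by (intro holomorphic_derivI[of _ "ball 0 1"]) auto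
      then show ?thesis by (simp add: has_field_derivative_at_within)
    qed
    show "cmod ((deriv ^^ Suc 1) \<phi> x) \<le> 32 * M" if x: "x \<in> ?S" for x
    proof -
      \<comment> \<open>Centres have modulus at most 1/2, so these discs stay within modulus
        3/4.\<close>
      have sub: "cball x (1/4) \<subseteq> ball 0 1"
      proof
        fix y assume "y \<in> cball x (1/4)"
        then show "y \<in> ball 0 1"
          using x norm_triangle_ineq4[of x "x - y"] by (auto simp: dist_norm)
      qed
      have "cmod ((deriv ^^ 2) \<phi> x) \<le> fact 2 * M / (1/4) ^ 2"
      proof (rule Cauchy_inequality)
        show "\<phi> holomorphic_on ball x (1/4)"
          using hol sub ball_subset_cball[of x "1/4"] by (meson holomorphic_on_subset subset_trans)
        show "continuous_on (cball x (1/4)) \<phi>"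
          using hol sub holomorphic_on_imp_continuous_on holomorphic_on_subset by blast
        show "cmod (\<phi> y) \<le> M" if "cmod (x - y) = 1/4" for y
        proof -
          have "y \<in> cball x (1/4)" using that by (simp add: dist_norm)
          then show ?thesis using sub M by (auto simp: subset_iff)
        qed
      qed simp
      then show ?thesis by (simp add: numeral_2_eq_2)
    qed
    show "0 \<in> ?S" "t \<in> ?S" using t by auto
  qed
  then show ?thesis
    by (simp add: power2_eq_square algebra_simps)
qed

text \<open>The pointwise clause of \<open>differentiable_into\<close> with the derivative made
  explicit, since estimates for \<open>D\<close> and its dependence on a vector argument are
  needed.\<close>

definition complex_derivative_at ::
  "(complex \<Rightarrow> complex) \<Rightarrow> 'v::complex_vector set \<Rightarrow> ('v \<Rightarrow> real) \<Rightarrow>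
   (complex ^ 'n \<Rightarrow> 'v) \<Rightarrow> complex ^ 'n \<Rightarrow> (complex ^ 'n \<Rightarrow> 'v) \<Rightarrow> bool" where
  "complex_derivative_at \<sigma> V \<nu> f z D \<longleftrightarrow>
     (\<forall>h. D h \<in> V) \<and> (\<forall>h k. D (h + k) = D h + D k) \<and> (\<forall>a h. D (a *s h) = \<sigma> a *\<^sub>C D h) \<and>
     ((\<lambda>h. \<nu> (f (z + h) - f z - D h) / norm h) \<longlongrightarrow> 0) (at 0)"

lemma differentiable_into_iff:
  "differentiable_into \<sigma> V \<nu> \<Omega> f \<longleftrightarrow>
     (\<forall>z\<in>\<Omega>. f z \<in> V) \<and> (\<forall>z\<in>\<Omega>. \<exists>D. complex_derivative_at \<sigma> V \<nu> f z D)"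
  by (simp add: differentiable_into_def complex_derivative_at_def)

lemma complex_derivative_atD:
  assumes "complex_derivative_at \<sigma> V \<nu> f z D"
  shows "D h \<in> V" "D (h + k) = D h + D k" "D (a *s h) = \<sigma> a *\<^sub>C D h"
    "((\<lambda>h. \<nu> (f (z + h) - f z - D h) / norm h) \<longlongrightarrow> 0) (at 0)"
  using assms by (auto simp: complex_derivative_at_def)

lemma eventually_at_0_in_open:
  fixes z :: "complex ^ 'n"
  assumes "open \<Omega>" "z \<in> \<Omega>"
  shows "\<forall>\<^sub>F h in at 0. z + h \<in> \<Omega>"
proof -
  obtain e where e: "e > 0" "ball z e \<subseteq> \<Omega>"
    using assms open_contains_ball by blast
  have "\<forall>\<^sub>F h in at 0. dist h (0 :: complex ^ 'n) < e"
    using e(1) unfolding eventually_at by (intro exI[of _ e]) auto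
  then show ?thesis
    by (rule eventually_mono) (use e(2) in \<open>auto simp: subset_iff dist_norm\<close>)
qed

text \<open>Domination of one remainder by another. The comparison is asked only for small h,
  because nothing is known about the functions outside the open set; nonnegativity is a hypothesis
  since \<nu>' is an arbitrary function.\<close>

lemma complex_derivative_at_transform:
  fixes z :: "complex ^ 'n"
  assumes D: "complex_derivative_at \<sigma> V \<nu> f z D"
    and D': "\<And>h. D' h \<in> V'" "\<And>h k. D' (h + k) = D' h + D' k" "\<And>a h. D' (a *s h) = \<sigma>' a *\<^sub>C D' h"
    and nonneg: "\<forall>\<^sub>F h in at 0. 0 \<le> \<nu>' (f' (z + h) - f' z - D' h)"
    and le: "\<forall>\<^sub>F h in at 0. \<nu>' (f' (z + h) - f' z - D' h) \<le> C * \<nu> (f (z + h) - f z - D h)"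
  shows "complex_derivative_at \<sigma>' V' \<nu>' f' z D'"
  unfolding complex_derivative_at_def
proof (intro conjI allI D')
  show "((\<lambda>h. \<nu>' (f' (z + h) - f' z - D' h) / norm h) \<longlongrightarrow> 0) (at 0)"
  proof (rule Lim_null_comparison)
    show "\<forall>\<^sub>F h in at 0. norm (\<nu>' (f' (z + h) - f' z - D' h) / norm h)
        \<le> C * (\<nu> (f (z + h) - f z - D h) / norm h)"
      using nonneg le by eventually_elim (simp add: divide_right_mono)
    show "((\<lambda>h. C * (\<nu> (f (z + h) - f z - D h) / norm h)) \<longlongrightarrow> 0) (at 0)"
      by (rule tendsto_mult_right_zero[OF complex_derivative_atD(4)[OF D]])
  qed
qed

lemma norm_vector_smult: "norm (s *s (w :: complex ^ 'n)) = cmod s * norm w"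
  by (simp add: norm_vec_def L2_set_def norm_mult power_mult_distrib sum_distrib_left[symmetric]
      real_sqrt_mult)

text \<open>A bounded map commutes with taking remainders. Allowing it to be linear over \<sigma>'
  covers conjugate-linear maps, and in particular passage to the adjoint, which turns holomorphic
  functions into anti-holomorphic ones.\<close>

lemma complex_derivative_at_linear_image:
  fixes \<Omega> :: "(complex ^ 'n) set"
  assumes D: "complex_derivative_at \<sigma> V \<nu> f z D" and \<Omega>: "open \<Omega>" and z: "z \<in> \<Omega>"
    and f: "\<And>w. w \<in> \<Omega> \<Longrightarrow> f w \<in> V" and diff: "\<And>x y. x \<in> V \<Longrightarrow> y \<in> V \<Longrightarrow> x - y \<in> V"
    and mem: "\<And>x. x \<in> V \<Longrightarrow> \<Lambda> x \<in> V'" and add: "\<And>x y. x \<in> V \<Longrightarrow> y \<in> V \<Longrightarrow> \<Lambda> (x + y) = \<Lambda> x + \<Lambda> y"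
    and scale: "\<And>a x. x \<in> V \<Longrightarrow> \<Lambda> (a *\<^sub>C x) = \<sigma>' a *\<^sub>C \<Lambda> x"
    and bound: "\<And>x. x \<in> V \<Longrightarrow> 0 \<le> \<nu>' (\<Lambda> x) \<and> \<nu>' (\<Lambda> x) \<le> C * \<nu> x"
  shows "complex_derivative_at (\<lambda>a. \<sigma>' (\<sigma> a)) V' \<nu>' (\<lambda>w. \<Lambda> (f w)) z (\<lambda>h. \<Lambda> (D h))"
proof (rule complex_derivative_at_transform[OF D])
  note DD = complex_derivative_atD[OF D]
  show "\<Lambda> (D h) \<in> V'" "\<Lambda> (D (h + k)) = \<Lambda> (D h) + \<Lambda> (D k)" "\<Lambda> (D (a *s h)) = \<sigma>' (\<sigma> a) *\<^sub>C \<Lambda> (D h)" for a h k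
    by (simp_all add: DD(1-3) mem add scale)
  have \<Lambda>_diff: "\<Lambda> (x - y) = \<Lambda> x - \<Lambda> y" if "x \<in> V" "y \<in> V" for x y
    using add[OF diff[OF that] that(2)] by simp
  have ev: "\<forall>\<^sub>F h in at 0. f (z + h) - f z - D h \<in> V \<and>
      \<Lambda> (f (z + h)) - \<Lambda> (f z) - \<Lambda> (D h) = \<Lambda> (f (z + h) - f z - D h)"
    using eventually_at_0_in_open[OF \<Omega> z] by eventually_elim (simp add: f z diff DD(1) \<Lambda>_diff)
  show "\<forall>\<^sub>F h in at 0. 0 \<le> \<nu>' (\<Lambda> (f (z + h)) - \<Lambda> (f z) - \<Lambda> (D h))"
    using ev by eventually_elim (simp add: bound)
  show "\<forall>\<^sub>F h in at 0. \<nu>' (\<Lambda> (f (z + h)) - \<Lambda> (f z) - \<Lambda> (D h)) \<le> C * \<nu> (f (z + h) - f z - D h)"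
    using ev by eventually_elim (simp add: bound)
qed

lemma differentiable_into_linear_image:
  fixes \<Omega> :: "(complex ^ 'n) set"
  assumes f: "differentiable_into \<sigma> V \<nu> \<Omega> f" and \<Omega>: "open \<Omega>"
    and diff: "\<And>x y. x \<in> V \<Longrightarrow> y \<in> V \<Longrightarrow> x - y \<in> V"
    and mem: "\<And>x. x \<in> V \<Longrightarrow> \<Lambda> x \<in> V'" and add: "\<And>x y. x \<in> V \<Longrightarrow> y \<in> V \<Longrightarrow> \<Lambda> (x + y) = \<Lambda> x + \<Lambda> y"
    and scale: "\<And>a x. x \<in> V \<Longrightarrow> \<Lambda> (a *\<^sub>C x) = \<sigma>' a *\<^sub>C \<Lambda> x"
    and bound: "\<And>x. x \<in> V \<Longrightarrow> 0 \<le> \<nu>' (\<Lambda> x) \<and> \<nu>' (\<Lambda> x) \<le> C * \<nu> x"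
  shows "differentiable_into (\<lambda>a. \<sigma>' (\<sigma> a)) V' \<nu>' \<Omega> (\<lambda>w. \<Lambda> (f w))"
proof -
  have f_mem: "f w \<in> V" if "w \<in> \<Omega>" for w
    using f that by (simp add: differentiable_into_iff)
  have "\<exists>D. complex_derivative_at (\<lambda>a. \<sigma>' (\<sigma> a)) V' \<nu>' (\<lambda>w. \<Lambda> (f w)) z D" if z: "z \<in> \<Omega>" for z
  proof -
    obtain D where D: "complex_derivative_at \<sigma> V \<nu> f z D"
      using f z unfolding differentiable_into_iff by blast
    have "complex_derivative_at (\<lambda>a. \<sigma>' (\<sigma> a)) V' \<nu>' (\<lambda>w. \<Lambda> (f w)) z (\<lambda>h. \<Lambda> (D h))"
      by (rule complex_derivative_at_linear_image[OF D \<Omega> z]) (fact f_mem diff mem add scale bound)+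
    then show ?thesis by blast
  qed
  then show ?thesis by (simp add: differentiable_into_iff f_mem mem)
qed

lemma complex_derivative_at_cong:
  fixes \<Omega> :: "(complex ^ 'n) set"
  assumes \<Omega>: "open \<Omega>" and E: "inner_product_space E"
    and f: "complex_derivative_at \<sigma> (hset E) (hnorm E) f w D" and w: "w \<in> \<Omega>"
    and eq: "\<And>v. v \<in> \<Omega> \<Longrightarrow> f v = f' v" and mem: "\<And>v. v \<in> \<Omega> \<Longrightarrow> f v \<in> hset E"
  shows "complex_derivative_at \<sigma> (hset E) (hnorm E) f' w D"
proof (rule complex_derivative_at_transform[OF f, where C = 1])
  note D = complex_derivative_atD[OF f]
  show "D h \<in> hset E" "D (h + k) = D h + D k" "D (a *s h) = \<sigma> a *\<^sub>C D h" for a h k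
    by (rule D)+
  show "\<forall>\<^sub>F h in at 0. 0 \<le> hnorm E (f' (w + h) - f' w - D h)"
    using eventually_at_0_in_open[OF \<Omega> w]
    by eventually_elim (use w mem D in \<open>simp add: hnorm_nonneg[OF E] hset_diff[OF E] eq[symmetric]\<close>)
  show "\<forall>\<^sub>F h in at 0. hnorm E (f' (w + h) - f' w - D h) \<le> 1 * hnorm E (f (w + h) - f w - D h)"
    using eventually_at_0_in_open[OF \<Omega> w]
    by eventually_elim (simp add: w eq)
qed

lemma differentiable_into_cong:
  fixes \<Omega> :: "(complex ^ 'n) set"
  assumes \<Omega>: "open \<Omega>" and E: "inner_product_space E"
    and f: "differentiable_into \<sigma> (hset E) (hnorm E) \<Omega> f" and eq: "\<And>v. v \<in> \<Omega> \<Longrightarrow> f v = f' v"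
  shows "differentiable_into \<sigma> (hset E) (hnorm E) \<Omega> f'"
proof -
  have mem: "f v \<in> hset E" if "v \<in> \<Omega>" for v
    using f that by (simp add: differentiable_into_iff)
  show ?thesis
    unfolding differentiable_into_iff
  proof (intro conjI ballI)
    show "f' z \<in> hset E" if "z \<in> \<Omega>" for z
      using mem[OF that] eq[OF that] by simp
    show "\<exists>D. complex_derivative_at \<sigma> (hset E) (hnorm E) f' z D" if z: "z \<in> \<Omega>" for z
    proof -
      obtain D where "complex_derivative_at \<sigma> (hset E) (hnorm E) f z D"
        using f z unfolding differentiable_into_iff by blast
      then have "complex_derivative_at \<sigma> (hset E) (hnorm E) f' z D"
        by (rule complex_derivative_at_cong[OF \<Omega> E _ z]) (erule eq mem)+
      then show ?thesis by blast
    qed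
  qed
qed

section \<open>Derivatives in a Hilbert space and Cauchy estimates on complex lines\<close>

context
  fixes E :: "'e::complex_vector hspace" and \<Omega> :: "(complex ^ 'n) set"
  assumes E: "inner_product_space E" and open_\<Omega>: "open \<Omega>"
begin

lemma complex_derivative_at_add:
  assumes f: "complex_derivative_at \<sigma> (hset E) (hnorm E) f z D"
    and f': "complex_derivative_at \<sigma> (hset E) (hnorm E) f' z D'"
    and mem: "\<And>w. w \<in> \<Omega> \<Longrightarrow> f w \<in> hset E" "\<And>w. w \<in> \<Omega> \<Longrightarrow> f' w \<in> hset E" and z: "z \<in> \<Omega>"
  shows "complex_derivative_at \<sigma> (hset E) (hnorm E) (\<lambda>w. f w + f' w) z (\<lambda>h. D h + D' h)"
  unfolding complex_derivative_at_def
proof (intro conjI allI)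
  note D = complex_derivative_atD[OF f] and D' = complex_derivative_atD[OF f']
  show "D h + D' h \<in> hset E" for h
    by (intro hset_add[OF E] D D')
  show "D (h + k) + D' (h + k) = D h + D' h + (D k + D' k)" for h k
    by (simp add: D(2) D'(2))
  show "D (a *s h) + D' (a *s h) = \<sigma> a *\<^sub>C (D h + D' h)" for a h
    by (simp add: D(3) D'(3) scaleC_add_right)
  show "((\<lambda>h. hnorm E (f (z + h) + f' (z + h) - (f z + f' z) - (D h + D' h)) / norm h) \<longlongrightarrow> 0) (at 0)"
  proof (rule Lim_null_comparison)
    show "\<forall>\<^sub>F h in at 0. norm (hnorm E (f (z + h) + f' (z + h) - (f z + f' z) - (D h + D' h)) / norm h)
      \<le> hnorm E (f (z + h) - f z - D h) / norm h + hnorm E (f' (z + h) - f' z - D' h) / norm h"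
      using eventually_at_0_in_open[OF open_\<Omega> z]
    proof eventually_elim
      case (elim h)
      have m: "f (z + h) - f z - D h \<in> hset E" "f' (z + h) - f' z - D' h \<in> hset E"
        by (intro hset_diff[OF E] mem elim z D(1) D'(1))+
      have eq: "f (z + h) + f' (z + h) - (f z + f' z) - (D h + D' h)
          = (f (z + h) - f z - D h) + (f' (z + h) - f' z - D' h)" by simp
      show ?case
        unfolding eq using hnorm_triangle[OF E m] hnorm_nonneg[OF E hset_add[OF E m]]
        by (simp add: add_divide_distrib[symmetric] divide_right_mono)
    qed
    show "((\<lambda>h. hnorm E (f (z + h) - f z - D h) / norm h + hnorm E (f' (z + h) - f' z - D' h) / norm h)
        \<longlongrightarrow> 0) (at 0)"
      using tendsto_add[OF D(4) D'(4)] by simp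
  qed
qed

lemma complex_derivative_at_scale:
  assumes f: "complex_derivative_at \<sigma> (hset E) (hnorm E) f z D"
    and mem: "\<And>w. w \<in> \<Omega> \<Longrightarrow> f w \<in> hset E" and z: "z \<in> \<Omega>"
  shows "complex_derivative_at \<sigma> (hset E) (hnorm E) (\<lambda>w. c *\<^sub>C f w) z (\<lambda>h. c *\<^sub>C D h)"
  using complex_derivative_at_linear_image[OF f open_\<Omega> z mem hset_diff[OF E],
      where \<Lambda> = "\<lambda>x. c *\<^sub>C x" and \<sigma>' = "\<lambda>a. a" and \<nu>' = "hnorm E" and V' = "hset E" and C = "cmod c"]
  by (simp add: hset_scale[OF E] scaleC_add_right scaleC_scaleC mult.commute hnorm_scale[OF E] hnorm_nonneg[OF E])

text \<open>Boundedness is not part of the notion of derivative; it follows from the finite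
  dimension of the domain by expanding h in the standard basis.\<close>

lemma complex_derivative_bounded:
  fixes z :: "complex ^ 'n"
  assumes f: "complex_derivative_at \<sigma> (hset E) (hnorm E) f z D" and \<sigma>: "\<And>a. cmod (\<sigma> a) = cmod a"
  obtains C where "C \<ge> 0" "\<And>h. hnorm E (D h) \<le> C * norm h"
proof -
  note D = complex_derivative_atD[OF f]
  have D0: "D 0 = 0" using D(2)[of 0 0] by simp
  have D_sum: "D (\<Sum>i\<in>I. g i) = (\<Sum>i\<in>I. D (g i))" for g and I :: "'n set"
    by (induction I rule: infinite_finite_induct) (auto simp: D0 D(2))
  have norm_sum: "hnorm E (\<Sum>i\<in>I. g i) \<le> (\<Sum>i\<in>I. hnorm E (g i))"
    if "\<And>i. g i \<in> hset E" for g and I :: "'n set"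
  proof (induction I rule: infinite_finite_induct)
    case (insert x F)
    then show ?case
      using hnorm_triangle[OF E that[of x] hset_sum[OF E, of F g]] that by fastforce
  qed (auto simp: hnorm_zero[OF E])
  have "hnorm E (D h) \<le> (\<Sum>i\<in>UNIV. hnorm E (D (axis i 1))) * norm h" for h
  proof -
    have "D h = D (\<Sum>i\<in>UNIV. (h $ i) *s axis i 1)"
      by (simp only: basis_expansion)
    also have "\<dots> = (\<Sum>i\<in>UNIV. \<sigma> (h $ i) *\<^sub>C D (axis i 1))"
      by (simp only: D_sum D(3))
    also have "hnorm E \<dots> \<le> (\<Sum>i\<in>UNIV. hnorm E (\<sigma> (h $ i) *\<^sub>C D (axis i 1)))"
      by (intro norm_sum hset_scale[OF E] D(1))
    also have "\<dots> \<le> (\<Sum>i\<in>UNIV. hnorm E (D (axis i 1)) * norm h)"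
    proof (rule sum_mono)
      show "hnorm E (\<sigma> (h $ i) *\<^sub>C D (axis i 1)) \<le> hnorm E (D (axis i 1)) * norm h" for i
        using mult_right_mono[OF Finite_Cartesian_Product.norm_nth_le[of h i] hnorm_nonneg[OF E D(1)[of "axis i 1"]]]
        by (simp add: hnorm_scale[OF E] D(1) \<sigma> mult.commute)
    qed
    finally show ?thesis by (simp add: sum_distrib_right)
  qed
  moreover have "0 \<le> (\<Sum>i\<in>UNIV. hnorm E (D (axis i 1)))"
    by (intro sum_nonneg hnorm_nonneg[OF E] D(1))
  ultimately show ?thesis using that by blast
qed

text \<open>Intended for compact balls: each function of the space is bounded there, which is the
  weak boundedness that the uniform boundedness principle asks for.\<close>

lemma continuous_on_hnorm_holomorphic:
  assumes hol: "holomorphic_into (hset E) (hnorm E) \<Omega> f"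
  shows "continuous_on \<Omega> (\<lambda>z. hnorm E (f z))"
proof (rule continuous_at_imp_continuous_on, rule ballI)
  fix z assume z: "z \<in> \<Omega>"
  have mem: "f w \<in> hset E" if "w \<in> \<Omega>" for w
    using hol that by (simp add: differentiable_into_iff)
  obtain D where f: "complex_derivative_at (\<lambda>a. a) (hset E) (hnorm E) f z D"
    using hol z unfolding differentiable_into_iff by blast
  note D = complex_derivative_atD[OF f]
  obtain C where C: "\<And>h. hnorm E (D h) \<le> C * norm h"
    using complex_derivative_bounded[OF f] by metis
  have "((\<lambda>h. hnorm E (f (z + h)) - hnorm E (f z)) \<longlongrightarrow> 0) (at 0)"
  proof (rule Lim_null_comparison)
    show "\<forall>\<^sub>F h in at 0. norm (hnorm E (f (z + h)) - hnorm E (f z))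
      \<le> hnorm E (f (z + h) - f z - D h) / norm h * norm h + C * norm h"
      using eventually_at_0_in_open[OF open_\<Omega> z]
    proof eventually_elim
      case (elim h)
      have m: "f (z + h) - f z \<in> hset E" by (intro hset_diff[OF E] mem elim z)
      have "\<bar>hnorm E (f (z + h)) - hnorm E (f z)\<bar> \<le> hnorm E (f (z + h) - f z)"
        by (intro hnorm_reverse_triangle[OF E] mem elim z)
      also have "\<dots> \<le> hnorm E (f (z + h) - f z - D h) + hnorm E (D h)"
        using hnorm_triangle[OF E hset_diff[OF E m D(1)] D(1), of h h] by simp
      finally show ?case
        using C[of h] hnorm_zero[OF E] D(2)[of 0 0] by (cases "h = 0") auto
    qed
    show "((\<lambda>h. hnorm E (f (z + h) - f z - D h) / norm h * norm h + C * norm h) \<longlongrightarrow> 0) (at 0)"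
      by (rule tendsto_eq_intros D(4) refl | simp)+
  qed
  then have "((\<lambda>h. hnorm E (f (z + h))) \<longlongrightarrow> hnorm E (f z)) (at 0)"
    by (rule LIM_zero_cancel)
  then show "isCont (\<lambda>z. hnorm E (f z)) z"
    unfolding isCont_def by (subst LIM_offset_zero_iff) simp_all
qed

text \<open>Restriction to a complex line and pairing with a fixed vector give a scalar function of
  one variable, to which Cauchy's inequality applies. Since v is nonzero, s v approaches 0 without
  reaching it, so the limit defining D can be composed with the line.\<close>

lemma hip_along_line_derivative:
  assumes f: "complex_derivative_at (\<lambda>a. a) (hset E) (hnorm E) f (z + t *s v) D"
    and mem: "\<And>w. w \<in> \<Omega> \<Longrightarrow> f w \<in> hset E" and z: "z + t *s v \<in> \<Omega>" and v: "v \<noteq> 0" and e: "e \<in> hset E"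
  shows "((\<lambda>t. hip E (f (z + t *s v)) e) has_field_derivative hip E (D v) e) (at t)"
  unfolding DERIV_def
proof -
  note D = complex_derivative_atD[OF f]
  let ?w = "z + t *s v"
  let ?q = "\<lambda>h. hnorm E (f (?w + h) - f ?w - D h) / norm h"
  have lim: "filterlim (\<lambda>s. s *s v) (at 0) (at 0)"
    unfolding filterlim_at
  proof
    show "\<forall>\<^sub>F s in at 0. s *s v \<in> UNIV \<and> s *s v \<noteq> 0"
      using v by (auto simp: eventually_at_filter vec_eq_iff)
    have "((\<lambda>s. norm (s *s v)) \<longlongrightarrow> 0) (at 0)"
      unfolding norm_vector_smult by (rule tendsto_eq_intros refl | simp)+
    then show "((\<lambda>s. s *s v) \<longlongrightarrow> 0) (at 0)"
      by (simp add: tendsto_norm_zero_iff)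
  qed
  have "((\<lambda>s. (hip E (f (z + (t + s) *s v)) e - hip E (f (z + t *s v)) e) / s - hip E (D v) e) \<longlongrightarrow> 0) (at 0)"
  proof (rule Lim_null_comparison)
    show "\<forall>\<^sub>F s in at 0. cmod ((hip E (f (z + (t + s) *s v)) e - hip E (f (z + t *s v)) e) / s - hip E (D v) e)
        \<le> ?q (s *s v) * (norm v * hnorm E e)"
      using eventually_compose_filterlim[OF eventually_at_0_in_open[OF open_\<Omega> z] lim]
        eventually_neq_at_within[of 0 0 UNIV]
    proof eventually_elim
      case (elim s)
      have w: "z + (t + s) *s v = ?w + s *s v" by (simp add: vec_eq_iff algebra_simps)
      have m: "f (?w + s *s v) \<in> hset E" "f ?w \<in> hset E" "D v \<in> hset E" "D (s *s v) \<in> hset E"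
        using elim mem z D(1) by auto
      have "(hip E (f (?w + s *s v)) e - hip E (f ?w) e) / s - hip E (D v) e
          = hip E (f (?w + s *s v) - f ?w - D (s *s v)) e / s"
      proof -
        have "hip E (f (?w + s *s v) - f ?w - D (s *s v)) e
            = hip E (f (?w + s *s v)) e - hip E (f ?w) e - s * hip E (D v) e"
          using m e by (simp only: hip_diff_left[OF E] hset_diff[OF E] D(3) hip_scale_left[OF E])
        then show ?thesis
          using elim by (simp add: diff_divide_distrib)
      qed
      also have "cmod \<dots> \<le> hnorm E (f (?w + s *s v) - f ?w - D (s *s v)) * hnorm E e / cmod s"
        unfolding norm_divide by (intro divide_right_mono Cauchy_Schwarz[OF E] hset_diff[OF E] m e) simp
      also have "\<dots> = ?q (s *s v) * (norm v * hnorm E e)"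
        using elim v by (simp add: norm_vector_smult)
      finally show ?case unfolding w .
    qed
    show "((\<lambda>s. ?q (s *s v) * (norm v * hnorm E e)) \<longlongrightarrow> 0) (at 0)"
      by (intro tendsto_mult_left_zero filterlim_compose[OF D(4) lim])
  qed
  then show "(\<lambda>h. (hip E (f (z + (t + h) *s v)) e - hip E (f (z + t *s v)) e) / h) \<midarrow>0\<rightarrow> hip E (D v) e"
    by (rule LIM_zero_cancel)
qed

text \<open>The quadratic Cauchy estimate on each complex line, tested against the remainder itself.\<close>

lemma holomorphic_quadratic_remainder:
  assumes hol: "holomorphic_into (hset E) (hnorm E) \<Omega> f" and r: "r > 0" and ball: "ball z r \<subseteq> \<Omega>"
    and M: "\<And>w. w \<in> ball z r \<Longrightarrow> hnorm E (f w) \<le> M"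
    and f: "complex_derivative_at (\<lambda>a. a) (hset E) (hnorm E) f z D" and h: "norm h \<le> r/2"
  shows "hnorm E (f (z + h) - f z - D h) \<le> 32 * M * (norm h / r)\<^sup>2"
proof (cases "h = 0")
  case True
  then show ?thesis
    using complex_derivative_atD(2)[OF f, of 0 0] hnorm_zero[OF E] by simp
next
  case False
  have mem: "f w \<in> hset E" if "w \<in> \<Omega>" for w
    using hol that by (simp add: differentiable_into_iff)
  have z: "z \<in> \<Omega>" using ball r by auto
  \<comment> \<open>The line is scaled so that v has norm r: the unit disc then maps into the ball
    of radius r, and h sits at parameter t \<le> 1/2, where the one-variable estimate
    applies.\<close>
  define t where "t = norm h / r"
  define v where "v = of_real (inverse t) *s h"
  have t: "t > 0" "t \<le> 1/2" using False r h by (simp_all add: t_def divide_le_eq)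
  have v: "norm v = r" "v \<noteq> 0"
  proof -
    show "norm v = r" using False r by (simp add: v_def norm_vector_smult t_def norm_inverse norm_divide)
    then show "v \<noteq> 0" using r by auto
  qed
  have h_eq: "of_real t *s v = h" using t by (simp add: v_def vec_eq_iff)
  have in_ball: "z + s *s v \<in> ball z r" if "cmod s < 1" for s
    using that v r by (simp add: dist_norm norm_vector_smult)
  define e where "e = f (z + h) - f z - D h"
  have zh: "z + h \<in> \<Omega>" using in_ball[of "of_real t"] t ball by (auto simp: h_eq)
  have e: "e \<in> hset E"
    unfolding e_def by (intro hset_diff[OF E] mem zh z complex_derivative_atD(1)[OF f])
  define \<phi> where "\<phi> s = hip E (f (z + s *s v)) e" for s
  have "\<phi> field_differentiable at s" if "cmod s < 1" for s
  proof -
    have w: "z + s *s v \<in> \<Omega>" using in_ball[OF that] ball by blast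
    then obtain D' where "complex_derivative_at (\<lambda>a. a) (hset E) (hnorm E) f (z + s *s v) D'"
      using hol unfolding differentiable_into_iff by blast
    from hip_along_line_derivative[OF this mem w v(2) e]
    show ?thesis unfolding \<phi>_def field_differentiable_def by blast
  qed
  then have hol_\<phi>: "\<phi> holomorphic_on ball 0 1"
    by (auto simp: holomorphic_on_def field_differentiable_at_within)
  have "(\<phi> has_field_derivative hip E (D v) e) (at 0)"
    using hip_along_line_derivative[of f z 0 v D e] f mem z v e unfolding \<phi>_def by simp
  then have deriv: "deriv \<phi> 0 = hip E (D v) e"
    by (rule DERIV_imp_deriv)
  have "cmod (\<phi> s) \<le> M * hnorm E e" if "cmod s < 1" for s
  proof -
    have "cmod (\<phi> s) \<le> hnorm E (f (z + s *s v)) * hnorm E e"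
      unfolding \<phi>_def using in_ball[OF that] ball by (intro Cauchy_Schwarz[OF E] mem e) auto
    also have "\<dots> \<le> M * hnorm E e"
      by (intro mult_right_mono M in_ball that hnorm_nonneg[OF E] e)
    finally show ?thesis .
  qed
  from quadratic_remainder_disc[OF hol_\<phi> this, of "of_real t"]
  have "cmod (\<phi> (of_real t) - \<phi> 0 - deriv \<phi> 0 * of_real t) \<le> 32 * M * t\<^sup>2 * hnorm E e"
    using t by (simp add: algebra_simps)
  also have "\<phi> (of_real t) - \<phi> 0 - deriv \<phi> 0 * of_real t = hip E e e"
  proof -
    have Dh: "D h = of_real t *\<^sub>C D v"
      using complex_derivative_atD(3)[OF f, of "of_real t" v] by (simp add: h_eq)
    show ?thesis
      using mem[OF zh] mem[OF z] complex_derivative_atD(1)[OF f] e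
      unfolding \<phi>_def deriv h_eq
      by (subst (2) e_def) (simp add: hip_diff_left[OF E] hset_diff[OF E] Dh hip_scale_left[OF E] hset_scale[OF E] mult.commute)
  qed
  finally have "cmod (hip E e e) \<le> 32 * M * t\<^sup>2 * hnorm E e" .
  moreover have "0 \<le> M" using M[of z] r hnorm_nonneg[OF E mem[OF z]] by simp
  ultimately show ?thesis
    unfolding t_def e_def[symmetric] by (intro hnorm_le_of_hip[OF E e]) auto
qed

text \<open>A vector k of length r/2 in the direction of h has remainder at most 32 M/4 = 8 M and
  increment at most 2 M, so ||D k|| \<le> 10 M; rescaling from r/2 gives 20 M/r. Only the linear
  dependence on M is used later.\<close>

lemma holomorphic_derivative_bound:
  assumes hol: "holomorphic_into (hset E) (hnorm E) \<Omega> f" and r: "r > 0" and ball: "ball z r \<subseteq> \<Omega>"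
    and M: "\<And>w. w \<in> ball z r \<Longrightarrow> hnorm E (f w) \<le> M"
    and f: "complex_derivative_at (\<lambda>a. a) (hset E) (hnorm E) f z D"
  shows "hnorm E (D h) \<le> 20 * M / r * norm h"
proof (cases "h = 0")
  case True
  then show ?thesis
    using complex_derivative_atD(2)[OF f, of 0 0] hnorm_zero[OF E] by simp
next
  case False
  note D = complex_derivative_atD[OF f]
  have mem: "f w \<in> hset E" if "w \<in> \<Omega>" for w
    using hol that by (simp add: differentiable_into_iff)
  define c where "c = r / 2 / norm h"
  define k where "k = of_real c *s h"
  have c: "c > 0" using r False by (simp add: c_def)
  have k: "norm k = r/2" using False r by (simp add: k_def norm_vector_smult c_def norm_divide norm_mult)
  have z: "z \<in> ball z r" "z + k \<in> ball z r" using k r by (auto simp: dist_norm)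
  have zO: "z \<in> \<Omega>" "z + k \<in> \<Omega>" using z ball by auto
  have m: "f (z + k) - f z \<in> hset E" by (intro hset_diff[OF E] mem zO)
  have "hnorm E (f (z + k) - f z - D k) \<le> 32 * M * (norm k / r)\<^sup>2"
    using k by (intro holomorphic_quadratic_remainder[OF hol r ball M f]) auto
  also have "\<dots> = 8 * M" using r by (simp add: k power2_eq_square)
  finally have 1: "hnorm E (f (z + k) - f z - D k) \<le> 8 * M" .
  have "hnorm E (D k) \<le> hnorm E (f (z + k) - f z) + hnorm E (f (z + k) - f z - D k)"
    using hnorm_diff_triangle[OF E m hset_diff[OF E m D(1)], of k] by simp
  also have "hnorm E (f (z + k) - f z) \<le> M + M"
    using hnorm_diff_triangle[OF E mem[OF zO(2)] mem[OF zO(1)]] M[OF z(1)] M[OF z(2)] by simp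
  finally have "hnorm E (D k) \<le> 10 * M" using 1 by simp
  moreover have "hnorm E (D k) = c * hnorm E (D h)"
    using c by (simp add: k_def D(3) hnorm_scale[OF E] D(1))
  ultimately show ?thesis
    using False r by (simp add: c_def field_simps)
qed

end

text \<open>Each f pairs with the kernel functions over a compact ball as <f(w), \<eta>>, which is
  bounded by continuity of ||f(w)||. Uniform boundedness turns these separate bounds into one bound
  for all kernel functions with ||\<eta>|| \<le> 1.\<close>

lemma rkhs_locally_bounded:
  fixes \<Omega> :: "(complex ^ 'n) set" and E :: "'e::complex_vector hspace"
  assumes E: "hilbert_space E" and K: "is_kernel E \<Omega> K" and H: "is_rkhs E \<Omega> K H" and \<Omega>: "open \<Omega>"
    and hol: "\<And>f. f \<in> hset H \<Longrightarrow> holomorphic_into (hset E) (hnorm E) \<Omega> f" and z: "z \<in> \<Omega>"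
  obtains r C where "r > 0" "ball z r \<subseteq> \<Omega>" "0 \<le> C"
    "\<And>w \<eta>. w \<in> ball z r \<Longrightarrow> \<eta> \<in> hset E \<Longrightarrow> hnorm H (kernel_fun \<Omega> K w \<eta>) \<le> C * hnorm E \<eta>"
proof -
  note ips = rkhs_ips[OF E K H] and ipsE = hilbert_space_ips[OF E]
  obtain r where r: "r > 0" "cball z r \<subseteq> \<Omega>"
    using \<Omega> z open_contains_cball by blast
  \<comment> \<open>Closed balls supply compactness; the conclusion is only claimed on the open
    ball.\<close>
  define Y where "Y = {kernel_fun \<Omega> K w \<eta> | w \<eta>. w \<in> cball z r \<and> \<eta> \<in> hset E \<and> hnorm E \<eta> \<le> 1}"
  have "\<exists>B. \<forall>y\<in>Y. cmod (hip H f y) \<le> B" if f: "f \<in> hset H" for f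
  proof -
    have "compact ((\<lambda>w. hnorm E (f w)) ` cball z r)"
      using continuous_on_subset[OF continuous_on_hnorm_holomorphic[OF ipsE \<Omega> hol[OF f]] r(2)]
      by (intro compact_continuous_image) auto
    then obtain B where B: "\<And>w. w \<in> cball z r \<Longrightarrow> \<bar>hnorm E (f w)\<bar> \<le> B"
      using compact_imp_bounded bounded_real by (metis (no_types, lifting) image_eqI)
    have "cmod (hip H f y) \<le> B" if "y \<in> Y" for y
    proof -
      obtain w \<eta> where w: "w \<in> cball z r" "\<eta> \<in> hset E" "hnorm E \<eta> \<le> 1" "y = kernel_fun \<Omega> K w \<eta>"
        using \<open>y \<in> Y\<close> by (auto simp: Y_def)
      have w\<Omega>: "w \<in> \<Omega>" using w(1) r by blast
      have "cmod (hip H f y) \<le> hnorm E (f w) * hnorm E \<eta>"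
        using Cauchy_Schwarz[OF ipsE rkhs_value[OF E K H f w\<Omega>] w(2)]
        by (simp add: w(4) reproducing[OF E K H f w\<Omega> w(2)])
      also have "\<dots> \<le> hnorm E (f w) * 1"
        by (intro mult_left_mono w(3) hnorm_nonneg[OF ipsE] rkhs_value[OF E K H f w\<Omega>])
      also have "\<dots> \<le> B" using B[OF w(1)] by simp
      finally show ?thesis .
    qed
    then show ?thesis by blast
  qed
  moreover have "Y \<subseteq> hset H"
    using r(2) kernel_fun_mem[OF E K H] by (auto simp: Y_def)
  ultimately obtain B where B: "\<And>y. y \<in> Y \<Longrightarrow> hnorm H y \<le> B"
    using weakly_bounded_imp_bounded[OF rkhs_hilbert[OF E K H]] by metis
  have "hnorm H (kernel_fun \<Omega> K w \<eta>) \<le> \<bar>B\<bar> * hnorm E \<eta>" if w: "w \<in> ball z r" and \<eta>: "\<eta> \<in> hset E" for w \<eta>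
  proof -
    have w\<Omega>: "w \<in> \<Omega>" using w r(2) ball_subset_cball by blast
    show ?thesis
    proof (cases "\<eta> = 0")
      case True
      have "kernel_fun \<Omega> K w \<eta> = 0"
        using kernel_fun_scale[OF E K H w\<Omega> \<eta>, of 0] True by simp
      then show ?thesis using True hnorm_zero[OF ips] hnorm_zero[OF ipsE] by simp
    next
      case False
      then have n: "hnorm E \<eta> > 0" using hnorm_nonneg[OF ipsE \<eta>] hnorm_eq_zero[OF ipsE \<eta>] by simp
      define u where "u = of_real (inverse (hnorm E \<eta>)) *\<^sub>C \<eta>"
      have u: "u \<in> hset E" "hnorm E u = 1"
        using n \<eta> by (simp_all add: u_def hset_scale[OF ipsE] hnorm_scale[OF ipsE] norm_inverse)
      have "kernel_fun \<Omega> K w u \<in> Y" using w u by (force simp: Y_def)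
      then have "hnorm H (kernel_fun \<Omega> K w u) \<le> \<bar>B\<bar>" using B by fastforce
      moreover have "hnorm H (kernel_fun \<Omega> K w u) = hnorm H (kernel_fun \<Omega> K w \<eta>) / hnorm E \<eta>"
        using n by (simp add: u_def kernel_fun_scale[OF E K H w\<Omega> \<eta>] hnorm_scale[OF ips]
            kernel_fun_mem[OF E K H w\<Omega> \<eta>] norm_inverse divide_inverse)
      ultimately show ?thesis using n by (simp add: divide_le_eq)
    qed
  qed
  then show ?thesis
    using that[of r "\<bar>B\<bar>"] r ball_subset_cball by (meson abs_ge_zero subset_trans)
qed

text \<open>For fixed f the derivative and the remainder of \<Phi>(w) f are at most 20 M/r ||h||
  ||f|| and 32 M/r^2 ||h||^2 ||f||. The first bound extends the derivatives on the span to operators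
  \<open>D h\<close>; the second is uniform in f and hence a bound in operator norm that is
  o(||h||).\<close>

lemma holomorphic_into_opnormI:
  fixes \<Omega> :: "(complex ^ 'n) set" and E :: "'e::complex_vector hspace" and F :: "'f::complex_vector hspace"
  assumes E: "hilbert_space E" and F: "hilbert_space F" and \<Omega>: "open \<Omega>"
    and \<Phi>: "\<And>z. z \<in> \<Omega> \<Longrightarrow> \<Phi> z \<in> bounded_ops F E" and total: "total_in F S"
    and hol: "\<And>f. f \<in> S \<Longrightarrow> holomorphic_into (hset E) (hnorm E) \<Omega> (\<lambda>z. \<Phi> z f)"
    and loc_bdd: "\<And>z. z \<in> \<Omega> \<Longrightarrow> \<exists>r>0. \<exists>C. \<forall>w\<in>\<Omega> \<inter> ball z r. \<forall>f\<in>hset F. hnorm E (\<Phi> w f) \<le> C * hnorm F f"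
  shows "holomorphic_into (bounded_ops F E) (opnorm F E) \<Omega> \<Phi>"
  unfolding differentiable_into_iff
proof (intro conjI ballI \<Phi>)
  fix z assume z: "z \<in> \<Omega>"
  note ipsE = hilbert_space_ips[OF E] and ipsF = hilbert_space_ips[OF F]
  have S: "S \<subseteq> hset F" using total by (simp add: total_in_def)
  have span_mem: "f \<in> hset F" if "f \<in> cspan S" for f
    using cspan_subset_hset[OF ipsF S] that by blast
  have lin: "\<Phi> w \<in> linear_ops F E" if "w \<in> \<Omega>" for w
    using \<Phi>[OF that] by (rule bounded_ops_linear)
  have \<Phi>_mem: "\<Phi> w f \<in> hset E" if "w \<in> \<Omega>" "f \<in> hset F" for w f
    using op_mem[OF lin] that by blast
  let ?deriv = "\<lambda>f w. complex_derivative_at (\<lambda>a. a) (hset E) (hnorm E) (\<lambda>v. \<Phi> v f) w"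
  have span_deriv_add: "?deriv (f + f') w (\<lambda>h. D h + D' h)"
    if "?deriv f w D" "?deriv f' w D'" "f \<in> hset F" "f' \<in> hset F" "w \<in> \<Omega>" for f f' w D D'
    by (rule complex_derivative_at_cong[OF \<Omega> ipsE complex_derivative_at_add[OF ipsE \<Omega> that(1,2)]])
      (use that in \<open>simp_all add: \<Phi>_mem op_add[OF lin] hset_add[OF ipsE]\<close>)
  have span_deriv_scale: "?deriv (c *\<^sub>C f) w (\<lambda>h. c *\<^sub>C D h)"
    if "?deriv f w D" "f \<in> hset F" "w \<in> \<Omega>" for c f w D
    by (rule complex_derivative_at_cong[OF \<Omega> ipsE complex_derivative_at_scale[OF ipsE \<Omega> that(1)]])
      (use that in \<open>simp_all add: \<Phi>_mem op_scale[OF lin] hset_scale[OF ipsE]\<close>)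
  have "f \<in> hset F \<and> (\<exists>D. ?deriv f w D)" if f: "f \<in> cspan S" and w: "w \<in> \<Omega>" for f w
    using f
  proof (induction rule: complex_vector.span_induct_alt)
    case base
    obtain D where "?deriv 0 w D"
    proof
      show "?deriv 0 w (\<lambda>_. 0)"
        unfolding complex_derivative_at_def
      proof (intro conjI allI)
        have "\<forall>\<^sub>F h in at 0. hnorm E (\<Phi> (w + h) 0 - \<Phi> w 0 - 0) / norm h = 0"
          using eventually_at_0_in_open[OF \<Omega> w]
          by eventually_elim (simp add: op_zero[OF lin ipsF] w hnorm_zero[OF ipsE])
        then show "((\<lambda>h. hnorm E (\<Phi> (w + h) 0 - \<Phi> w 0 - 0) / norm h) \<longlongrightarrow> 0) (at 0)"
          by (rule tendsto_eventually)
      qed (simp_all add: hset_zero[OF ipsE])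
    qed
    then show ?case using hset_zero[OF ipsF] by blast
  next
    case (step c x y)
    have xy: "x \<in> hset F" "c *\<^sub>C x \<in> hset F" "y \<in> hset F"
      using S step hset_scale[OF ipsF] by auto
    obtain D where D: "?deriv x w D"
      using hol[OF step(1)] w unfolding differentiable_into_iff by blast
    obtain D' where D': "?deriv y w D'" using step by blast
    show ?case
      using span_deriv_add[OF span_deriv_scale[OF D xy(1) w, of c] D' xy(2,3) w] hset_add[OF ipsF xy(2,3)]
      by blast
  qed
  then have span_deriv: "\<exists>D. ?deriv f w D" if "f \<in> cspan S" "w \<in> \<Omega>" for f w
    using that by blast
  have span_hol: "holomorphic_into (hset E) (hnorm E) \<Omega> (\<lambda>w. \<Phi> w f)" if "f \<in> cspan S" for f
    unfolding differentiable_into_iff using span_deriv[OF that] \<Phi>_mem span_mem[OF that] by blast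
  obtain r where r: "r > 0" "ball z r \<subseteq> \<Omega>"
    and "\<exists>C. \<forall>w\<in>\<Omega> \<inter> ball z r. \<forall>f\<in>hset F. hnorm E (\<Phi> w f) \<le> C * hnorm F f"
  proof -
    obtain r1 where r1: "r1 > 0" "\<exists>C. \<forall>w\<in>\<Omega> \<inter> ball z r1. \<forall>f\<in>hset F. hnorm E (\<Phi> w f) \<le> C * hnorm F f"
      using loc_bdd[OF z] by blast
    obtain r2 where r2: "r2 > 0" "ball z r2 \<subseteq> \<Omega>"
      using \<Omega> z open_contains_ball by blast
    have sub: "ball z (min r1 r2) \<subseteq> ball z r1" "ball z (min r1 r2) \<subseteq> ball z r2"
      by auto
    show thesis
    proof (rule that)
      show "min r1 r2 > 0" using r1 r2 by simp
      show "ball z (min r1 r2) \<subseteq> \<Omega>" using r2 sub by blast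
      show "\<exists>C. \<forall>w\<in>\<Omega> \<inter> ball z (min r1 r2). \<forall>f\<in>hset F. hnorm E (\<Phi> w f) \<le> C * hnorm F f"
        using r1(2) sub(1) by blast
    qed
  qed
  then obtain C0 where C0: "\<And>w f. w \<in> ball z r \<Longrightarrow> f \<in> hset F \<Longrightarrow> hnorm E (\<Phi> w f) \<le> C0 * hnorm F f"
    using r by blast
  define M where "M = \<bar>C0\<bar>"
  have M0: "M \<ge> 0" by (simp add: M_def)
  have M: "hnorm E (\<Phi> w f) \<le> M * hnorm F f" if "w \<in> ball z r" "f \<in> hset F" for w f
    using C0[OF that] mult_right_mono[OF abs_ge_self[of C0] hnorm_nonneg[OF ipsF that(2)]]
    unfolding M_def by linarith
  \<comment> \<open>For fixed h, this relates f to any derivative of \<Phi>(w) f at z in direction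
    h. It is a relation rather than a map: uniqueness of the value comes out of the norm bound
    during extension.\<close>
  define R where "R h f b \<longleftrightarrow> f \<in> cspan S \<and> (\<exists>D. ?deriv f z D \<and> b = D h)" for h f b
  have "\<exists>V. V \<in> bounded_ops F E \<and> (\<forall>f b. R h f b \<longrightarrow> V f = b)" for h
  proof -
    obtain V where "V \<in> bounded_ops F E" "\<And>f b. R h f b \<Longrightarrow> V f = b"
    proof (rule extend_linear_relation[OF ipsF E, of "20 * M / r * norm h" "R h"])
      show "0 \<le> 20 * M / r * norm h" using M0 r by simp
      show "a \<in> hset F \<and> b \<in> hset E" if "R h a b" for a b
        using that span_mem complex_derivative_atD(1) unfolding R_def by blast
      show "R h (a + a') (b + b')" if "R h a b" "R h a' b'" for a b a' b'
        using that span_deriv_add[OF _ _ span_mem span_mem z] complex_vector.span_add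
        unfolding R_def by blast
      show "R h (c *\<^sub>C a) (c *\<^sub>C b)" if "R h a b" for c a b
        using that span_deriv_scale[OF _ span_mem z] complex_vector.span_scale
        unfolding R_def by blast
      show "hnorm E b \<le> 20 * M / r * norm h * hnorm F a" if ab: "R h a b" for a b
      proof -
        obtain D where a: "a \<in> cspan S" and D: "?deriv a z D" "b = D h"
          using ab unfolding R_def by blast
        have "hnorm E (D h) \<le> 20 * (M * hnorm F a) / r * norm h"
          by (rule holomorphic_derivative_bound[OF ipsE \<Omega> span_hol[OF a] r M D(1)]) (simp_all add: span_mem a)
        then show ?thesis by (simp add: D(2) algebra_simps)
      qed
      show "\<exists>a b. R h a b \<and> hnorm F (x - a) < e" if "x \<in> hset F" "e > 0" for x e
        using total that span_deriv z unfolding R_def total_in_def by blast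
    qed metis
    then show ?thesis by blast
  qed
  then obtain D where D: "\<And>h. D h \<in> bounded_ops F E" "\<And>h f b. R h f b \<Longrightarrow> D h f = b"
    by metis
  have D_eq: "D h f = D' h" if "f \<in> cspan S" "?deriv f z D'" for h f D'
    using D(2) that unfolding R_def by blast
  have D_bdd: "(\<lambda>x. \<Phi> (z + h) x - \<Phi> z x - D h x) \<in> bounded_ops F E" if "z + h \<in> \<Omega>" for h
    by (intro bounded_ops_diff \<Phi> z that D(1) ipsE ipsF)
  have rem: "opnorm F E (\<Phi> (z + h) - \<Phi> z - D h) \<le> 32 * M / r\<^sup>2 * (norm h)\<^sup>2" if h: "norm h < r/2" for h
  proof (rule opnorm_le[OF ipsF])
    show "0 \<le> 32 * M / r\<^sup>2 * (norm h)\<^sup>2" using M0 by simp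
    have "z + h \<in> ball z r" using h r by (simp add: dist_norm)
    then have zh: "z + h \<in> \<Omega>" using r by blast
    have "hnorm E (\<Phi> (z + h) x - \<Phi> z x - D h x) \<le> 32 * M / r\<^sup>2 * (norm h)\<^sup>2 * hnorm F x" if x: "x \<in> hset F" for x
    \<comment> \<open>The remainder is an operator already known to be bounded, so the sharp
      constant may be checked on the span, where \<open>D h\<close> is a genuine derivative.\<close>
    proof (rule bound_from_total[OF ipsF ipsE D_bdd[OF zh] total _ x])
      fix f assume f: "f \<in> cspan S"
      obtain D' where D': "?deriv f z D'" using span_deriv[OF f z] by blast
      have "hnorm E (\<Phi> (z + h) f - \<Phi> z f - D' h) \<le> 32 * (M * hnorm F f) * (norm h / r)\<^sup>2"
        by (rule holomorphic_quadratic_remainder[OF ipsE \<Omega> span_hol[OF f] r M D'])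
          (use h f in \<open>simp_all add: span_mem\<close>)
      then show "hnorm E (\<Phi> (z + h) f - \<Phi> z f - D h f) \<le> 32 * M / r\<^sup>2 * (norm h)\<^sup>2 * hnorm F f"
        by (simp add: D_eq[OF f D'] power_divide algebra_simps)
    qed
    then show "hnorm E ((\<Phi> (z + h) - \<Phi> z - D h) x) \<le> 32 * M / r\<^sup>2 * (norm h)\<^sup>2 * hnorm F x"
      if "x \<in> hset F" for x using that by simp
  qed
  have "complex_derivative_at (\<lambda>a. a) (bounded_ops F E) (opnorm F E) \<Phi> z D"
    unfolding complex_derivative_at_def
  proof (intro conjI allI D(1))
    \<comment> \<open>The operators \<open>D h\<close> were chosen separately for each h. Relations
      between them are checked on \<open>S\<close>, where one derivative D' describes all of
      them.\<close>
    show "D (h + k) = D h + D k" for h k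
    proof (rule bounded_ops_eq_on_total[OF F ipsE D(1) _ total])
      show "D h + D k \<in> bounded_ops F E"
        using bounded_ops_add[OF D(1) D(1) ipsF ipsE] by (simp add: plus_fun_def)
      fix f assume "f \<in> S"
      then have f: "f \<in> cspan S" by (rule complex_vector.span_base)
      obtain D' where D': "?deriv f z D'" using span_deriv[OF f z] by blast
      show "D (h + k) f = (D h + D k) f"
        by (simp add: D_eq[OF f D'] complex_derivative_atD(2)[OF D'])
    qed
    show "D (a *s h) = a *\<^sub>C D h" for a h
    proof (rule bounded_ops_eq_on_total[OF F ipsE D(1) _ total])
      show "a *\<^sub>C D h \<in> bounded_ops F E"
        using bounded_ops_scale[OF D(1) ipsF ipsE] by (simp add: scaleC_fun_def)
      fix f assume "f \<in> S"
      then have f: "f \<in> cspan S" by (rule complex_vector.span_base)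
      obtain D' where D': "?deriv f z D'" using span_deriv[OF f z] by blast
      show "D (a *s h) f = (a *\<^sub>C D h) f"
        by (simp add: scaleC_fun_apply D_eq[OF f D'] complex_derivative_atD(3)[OF D'])
    qed
    show "((\<lambda>h. opnorm F E (\<Phi> (z + h) - \<Phi> z - D h) / norm h) \<longlongrightarrow> 0) (at 0)"
    proof (rule Lim_null_comparison)
      have ev: "\<forall>\<^sub>F h in at 0. dist h (0 :: complex ^ 'n) < r/2"
        using r(1) unfolding eventually_at by (intro exI[of _ "r/2"]) auto
      show "\<forall>\<^sub>F h in at 0. norm (opnorm F E (\<Phi> (z + h) - \<Phi> z - D h) / norm h) \<le> 32 * M / r\<^sup>2 * norm h"
        using ev eventually_neq_at_within[of 0 0 UNIV] eventually_at_0_in_open[OF \<Omega> z]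
      proof eventually_elim
        case (elim h)
        have "0 \<le> opnorm F E (\<Phi> (z + h) - \<Phi> z - D h)"
          using opnorm_nonneg[OF D_bdd ipsF ipsE] elim(3) by (simp add: fun_diff_def)
        then have "norm (opnorm F E (\<Phi> (z + h) - \<Phi> z - D h) / norm h)
            \<le> 32 * M / r\<^sup>2 * (norm h)\<^sup>2 / norm h"
          using rem[of h] elim(1) by (simp add: divide_right_mono del: times_divide_eq_left)
        also have "\<dots> = 32 * M / r\<^sup>2 * norm h"
          using elim(2) by (simp add: power2_eq_square)
        finally show ?case .
      qed
      show "((\<lambda>h :: complex ^ 'n. 32 * M / r\<^sup>2 * norm h) \<longlongrightarrow> 0) (at 0)"
        by (rule tendsto_mult_right_zero) (rule tendsto_eq_intros refl | simp)+
    qed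
  qed
  then show "\<exists>D. complex_derivative_at (\<lambda>a. a) (bounded_ops F E) (opnorm F E) \<Phi> z D" by blast
qed

section \<open>Holomorphy of operator products\<close>

lemma bounded_ops_minus:
  assumes "inner_product_space E" "inner_product_space F" "S \<in> bounded_ops E F" "T \<in> bounded_ops E F"
  shows "S - T \<in> bounded_ops E F"
  using bounded_ops_diff[OF assms(3,4,1,2)] by (simp add: fun_diff_def)

lemma holomorphic_into_apply:
  fixes \<Omega> :: "(complex ^ 'n) set"
  assumes E: "inner_product_space E" and F: "inner_product_space F" and \<Omega>: "open \<Omega>"
    and \<Phi>: "holomorphic_into (bounded_ops F E) (opnorm F E) \<Omega> \<Phi>" and f: "f \<in> hset F"
  shows "holomorphic_into (hset E) (hnorm E) \<Omega> (\<lambda>z. \<Phi> z f)"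
proof (rule differentiable_into_linear_image[OF \<Phi> \<Omega> bounded_ops_minus[OF F E],
      where \<Lambda> = "\<lambda>T. T f" and \<sigma>' = "\<lambda>a. a" and C = "hnorm F f"])
  fix T assume T: "T \<in> bounded_ops F E"
  show "T f \<in> hset E" by (rule op_mem[OF bounded_ops_linear[OF T] f])
  then show "0 \<le> hnorm E (T f) \<and> hnorm E (T f) \<le> hnorm F f * opnorm F E T"
    using opnorm_bound[OF T F E f] by (simp add: hnorm_nonneg[OF E] mult.commute)
qed (simp_all add: scaleC_fun_apply)

lemma adj_add:
  assumes F: "hilbert_space F" and E: "inner_product_space E"
    and S: "S \<in> bounded_ops F E" and T: "T \<in> bounded_ops F E"
  shows "adj F E (\<lambda>x. S x + T x) = (\<lambda>y. adj F E S y + adj F E T y)"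
proof
  fix y
  show "adj F E (\<lambda>x. S x + T x) y = adj F E S y + adj F E T y"
  proof (cases "y \<in> hset E")
    case True
    note ipsF = hilbert_space_ips[OF F]
    note mem = adj_mem[OF F E S True] adj_mem[OF F E T True] op_mem[OF bounded_ops_linear[OF S]] op_mem[OF bounded_ops_linear[OF T]]
    show ?thesis
      by (rule adj_eqI[OF ipsF True])
        (use True mem in \<open>simp_all add: hset_add[OF ipsF] hip_add_left[OF E] hip_add_right[OF ipsF]
          hip_adj[OF F E S True] hip_adj[OF F E T True]\<close>)
  qed (simp add: adj_off)
qed

lemma adj_scale:
  assumes F: "hilbert_space F" and E: "inner_product_space E" and S: "S \<in> bounded_ops F E"
  shows "adj F E (\<lambda>x. a *\<^sub>C S x) = (\<lambda>y. cnj a *\<^sub>C adj F E S y)"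
proof
  fix y
  show "adj F E (\<lambda>x. a *\<^sub>C S x) y = cnj a *\<^sub>C adj F E S y"
  proof (cases "y \<in> hset E")
    case True
    note ipsF = hilbert_space_ips[OF F]
    note mem = adj_mem[OF F E S True] op_mem[OF bounded_ops_linear[OF S]]
    show ?thesis
      by (rule adj_eqI[OF ipsF True])
        (use True mem in \<open>simp_all add: hset_scale[OF ipsF] hip_scale_left[OF E] hip_scale_right[OF ipsF]
          hip_adj[OF F E S True]\<close>)
  qed (simp add: adj_off)
qed

text \<open>With w fixed the map T to T B is linear; with z fixed, T goes to \<Phi>(z) times the
  adjoint of T, a conjugate-linear map. Both are bounded in operator norm, so each variable inherits
  differentiability of the right kind from \<Phi>.\<close>

lemma sesqui_holomorphic_factorization:
  fixes \<Omega> :: "(complex ^ 'n) set"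
  assumes E: "hilbert_space E" and F: "hilbert_space F" and \<Omega>: "open \<Omega>"
    and \<Phi>: "holomorphic_into (bounded_ops F E) (opnorm F E) \<Omega> \<Phi>"
  shows "sesqui_holomorphic E \<Omega> (\<lambda>z w. \<Phi> z \<circ> adj F E (\<Phi> w))"
  unfolding sesqui_holomorphic_def
proof (intro conjI ballI)
  note ipsE = hilbert_space_ips[OF E] and ipsF = hilbert_space_ips[OF F]
  have mem: "\<Phi> w \<in> bounded_ops F E" if "w \<in> \<Omega>" for w
    using \<Phi> that by (simp add: differentiable_into_iff)
  {
    fix w assume "w \<in> \<Omega>"
    then have B: "adj F E (\<Phi> w) \<in> bounded_ops E F" (is "?B \<in> _")
      by (rule adj_bounded[OF F ipsE mem])
    obtain C where C: "C > 0" "\<And>x. x \<in> hset E \<Longrightarrow> hnorm F (?B x) \<le> C * hnorm E x"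
      using bounded_ops_bound[OF B ipsE] by metis
    show "holomorphic_into (bounded_ops E E) (opnorm E E) \<Omega> (\<lambda>z. \<Phi> z \<circ> ?B)"
    proof (rule differentiable_into_linear_image[OF \<Phi> \<Omega> bounded_ops_minus[OF ipsF ipsE],
          where \<Lambda> = "\<lambda>T. T \<circ> ?B" and \<sigma>' = "\<lambda>a. a" and C = C])
      fix T assume T: "T \<in> bounded_ops F E"
      show TB: "T \<circ> ?B \<in> bounded_ops E E" by (rule bounded_ops_comp[OF T B ipsE ipsF ipsE])
      have T0: "0 \<le> opnorm F E T" by (rule opnorm_nonneg[OF T ipsF ipsE])
      have "opnorm E E (T \<circ> ?B) \<le> C * opnorm F E T"
      proof (rule opnorm_le[OF ipsE])
        fix x assume x: "x \<in> hset E"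
        have "hnorm E (T (?B x)) \<le> opnorm F E T * hnorm F (?B x)"
          by (intro opnorm_bound[OF T ipsF ipsE] op_mem[OF bounded_ops_linear[OF B]] x)
        also have "\<dots> \<le> opnorm F E T * (C * hnorm E x)"
          by (intro mult_left_mono C(2) x T0)
        finally show "hnorm E ((T \<circ> ?B) x) \<le> C * opnorm F E T * hnorm E x"
          by (simp add: algebra_simps)
      qed (use C(1) T0 in simp)
      then show "0 \<le> opnorm E E (T \<circ> ?B) \<and> opnorm E E (T \<circ> ?B) \<le> C * opnorm F E T"
        using opnorm_nonneg[OF TB ipsE ipsE] by simp
    qed (simp_all add: fun_eq_iff scaleC_fun_apply)
  }
  {
    fix z assume z: "z \<in> \<Omega>"
    note lin = bounded_ops_linear[OF mem[OF z]]
    obtain C where C: "C > 0" "\<And>x. x \<in> hset F \<Longrightarrow> hnorm E (\<Phi> z x) \<le> C * hnorm F x"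
      using bounded_ops_bound[OF mem[OF z] ipsF] by metis
    \<comment> \<open>The claim includes arguments off the carrier, where the adjoint is 0; this
      lets the operator identities below be proved for all arguments at once.\<close>
    have adj_in: "adj F E T x \<in> hset F" if "T \<in> bounded_ops F E" for T x
      using adj_mem[OF F ipsE that, of x] adj_off[of x E F T] hset_zero[OF ipsF] by (cases "x \<in> hset E") auto
    have "differentiable_into (\<lambda>a. cnj a) (bounded_ops E E) (opnorm E E) \<Omega> (\<lambda>w. \<Phi> z \<circ> adj F E (\<Phi> w))"
    proof (rule differentiable_into_linear_image[OF \<Phi> \<Omega> bounded_ops_minus[OF ipsF ipsE],
          where \<Lambda> = "\<lambda>T. \<Phi> z \<circ> adj F E T" and \<sigma>' = cnj and C = C])
      fix T assume T: "T \<in> bounded_ops F E"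
      show AT: "\<Phi> z \<circ> adj F E T \<in> bounded_ops E E"
        by (rule bounded_ops_comp[OF mem[OF z] adj_bounded[OF F ipsE T] ipsE ipsF ipsE])
      show "\<Phi> z \<circ> adj F E (S + T) = (\<Phi> z \<circ> adj F E S) + (\<Phi> z \<circ> adj F E T)"
        if S: "S \<in> bounded_ops F E" for S
        using adj_add[OF F ipsE S T] adj_in[OF S] adj_in[OF T]
        by (simp add: plus_fun_def fun_eq_iff op_add[OF lin])
      show "\<Phi> z \<circ> adj F E (a *\<^sub>C T) = cnj a *\<^sub>C (\<Phi> z \<circ> adj F E T)" for a
        using adj_scale[OF F ipsE T, of a] adj_in[OF T]
        by (simp add: scaleC_fun_def fun_eq_iff op_scale[OF lin])
      have T0: "0 \<le> opnorm F E T" by (rule opnorm_nonneg[OF T ipsF ipsE])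
      have "opnorm E E (\<Phi> z \<circ> adj F E T) \<le> C * opnorm F E T"
      proof (rule opnorm_le[OF ipsE])
        fix x assume x: "x \<in> hset E"
        have "hnorm F (adj F E T x) \<le> opnorm F E T * hnorm E x"
          by (rule adj_bound[OF F ipsE T x T0]) (rule opnorm_bound[OF T ipsF ipsE])
        then have "C * hnorm F (adj F E T x) \<le> C * (opnorm F E T * hnorm E x)"
          using C(1) by simp
        then show "hnorm E ((\<Phi> z \<circ> adj F E T) x) \<le> C * opnorm F E T * hnorm E x"
          using C(2)[OF adj_in[OF T], of x] by (simp add: mult.assoc)
      qed (use C(1) T0 in simp)
      then show "0 \<le> opnorm E E (\<Phi> z \<circ> adj F E T) \<and> opnorm E E (\<Phi> z \<circ> adj F E T) \<le> C * opnorm F E T"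
        using opnorm_nonneg[OF AT ipsE ipsE] by simp
    qed
    then show "antiholomorphic_into (bounded_ops E E) (opnorm E E) \<Omega> (\<lambda>w. \<Phi> z \<circ> adj F E (\<Phi> w))"
      by simp
  }
qed

section \<open>Existence of reproducing kernel Hilbert spaces\<close>

lemma Cauchy_in_bounded:
  assumes H: "inner_product_space H" and F: "Cauchy_in H F"
  obtains B where "B > 0" "\<And>n. hnorm H (F n) \<le> B"
proof -
  have mem: "F n \<in> hset H" for n using F by (simp add: Cauchy_in_def)
  obtain N where N: "\<And>m n. m \<ge> N \<Longrightarrow> n \<ge> N \<Longrightarrow> hnorm H (F m - F n) < 1"
    using F unfolding Cauchy_in_def by (meson zero_less_one)
  define B where "B = (\<Sum>n\<le>N. hnorm H (F n)) + 1"
  have le: "hnorm H (F n) \<le> (\<Sum>n\<le>N. hnorm H (F n))" if "n \<le> N" for n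
    using that by (intro member_le_sum) (auto simp: hnorm_nonneg[OF H mem])
  have "hnorm H (F n) \<le> B" for n
  proof (cases "n \<le> N")
    case True
    then show ?thesis using le by (simp add: B_def add_increasing2)
  next
    case False
    have "hnorm H (F n) \<le> hnorm H (F n - F N) + hnorm H (F N)"
      using hnorm_triangle[OF H hset_diff[OF H mem mem] mem, of n N N] by simp
    then show ?thesis using N[of n N] le[of N] False by (simp add: B_def)
  qed
  moreover have "B > 0" unfolding B_def by (intro add_nonneg_pos sum_nonneg hnorm_nonneg[OF H mem]) simp
  ultimately show ?thesis using that by blast
qed

lemma Cauchy_in_add:
  assumes H: "inner_product_space H" and F: "Cauchy_in H F" and G: "Cauchy_in H G"
  shows "Cauchy_in H (\<lambda>n. F n + G n)"
  unfolding Cauchy_in_def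
proof (intro conjI allI impI)
  have mem: "F n \<in> hset H" "G n \<in> hset H" for n using F G by (simp_all add: Cauchy_in_def)
  show "F n + G n \<in> hset H" for n by (intro hset_add[OF H] mem)
  fix e :: real assume "e > 0"
  then have e: "e/2 > 0" by simp
  obtain N where N: "\<And>m n. m \<ge> N \<Longrightarrow> n \<ge> N \<Longrightarrow> hnorm H (F m - F n) < e/2"
    using F e unfolding Cauchy_in_def by meson
  obtain N' where N': "\<And>m n. m \<ge> N' \<Longrightarrow> n \<ge> N' \<Longrightarrow> hnorm H (G m - G n) < e/2"
    using G e unfolding Cauchy_in_def by meson
  have "hnorm H (F m + G m - (F n + G n)) < e" if "m \<ge> max N N'" "n \<ge> max N N'" for m n
  proof -
    have "F m + G m - (F n + G n) = (F m - F n) + (G m - G n)" by simp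
    then have "hnorm H (F m + G m - (F n + G n)) \<le> hnorm H (F m - F n) + hnorm H (G m - G n)"
      using hnorm_triangle[OF H] hset_diff[OF H] mem by metis
    then show ?thesis using N[of m n] N'[of m n] that by simp
  qed
  then show "\<exists>N. \<forall>m\<ge>N. \<forall>n\<ge>N. hnorm H (F m + G m - (F n + G n)) < e" by blast
qed

lemma Cauchy_in_lipschitz:
  assumes F: "Cauchy_in H F" and mem: "\<And>n. G n \<in> hset H'"
    and le: "\<And>m n. hnorm H' (G m - G n) \<le> C * hnorm H (F m - F n)" and C: "C > 0"
  shows "Cauchy_in H' G"
  unfolding Cauchy_in_def
proof (intro conjI allI impI mem)
  fix e :: real assume "e > 0"
  then have "e/C > 0" using C by simp
  then obtain N where N: "\<And>m n. m \<ge> N \<Longrightarrow> n \<ge> N \<Longrightarrow> hnorm H (F m - F n) < e/C"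
    using F unfolding Cauchy_in_def by meson
  have "hnorm H' (G m - G n) < e" if "m \<ge> N" "n \<ge> N" for m n
    using le[of m n] N[OF that] C by (simp add: pos_less_divide_eq mult.commute)
  then show "\<exists>N. \<forall>m\<ge>N. \<forall>n\<ge>N. hnorm H' (G m - G n) < e" by blast
qed

lemma Cauchy_in_scale:
  assumes H: "inner_product_space H" and F: "Cauchy_in H F"
  shows "Cauchy_in H (\<lambda>n. c *\<^sub>C F n)"
proof (rule Cauchy_in_lipschitz[OF F, where C = "cmod c + 1"])
  have mem: "F n \<in> hset H" for n using F by (simp add: Cauchy_in_def)
  show "c *\<^sub>C F n \<in> hset H" for n by (intro hset_scale[OF H] mem)
  show "hnorm H (c *\<^sub>C F m - c *\<^sub>C F n) \<le> (cmod c + 1) * hnorm H (F m - F n)" for m n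
    by (simp add: complex_vector.scale_right_diff_distrib[symmetric] hnorm_scale[OF H] hset_diff[OF H] mem
        mult_right_mono hnorm_nonneg[OF H])
  show "0 < cmod c + 1" by (simp add: add_nonneg_pos)
qed

text \<open>The completion of a space of functions with a reproducing property is again a space of
  functions: a Cauchy sequence is represented by its pointwise limit.\<close>

lemma reproducing_space_completion:
  fixes E :: "'e::complex_vector hspace" and X :: "'x set" and k :: "'x \<Rightarrow> 'e \<Rightarrow> 'x \<Rightarrow> 'e"
    and H0 :: "('x \<Rightarrow> 'e) hspace"
  assumes E: "hilbert_space E" and H0: "inner_product_space H0"
    and value0: "\<And>f w. f \<in> hset H0 \<Longrightarrow> w \<in> X \<Longrightarrow> f w \<in> hset E"
    and off0: "\<And>f w. f \<in> hset H0 \<Longrightarrow> w \<notin> X \<Longrightarrow> f w = 0"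
    and k: "\<And>w \<eta>. w \<in> X \<Longrightarrow> \<eta> \<in> hset E \<Longrightarrow> k w \<eta> \<in> hset H0"
    and span: "hset H0 \<subseteq> cspan {k w \<eta> | w \<eta>. w \<in> X \<and> \<eta> \<in> hset E}"
    and rep0: "\<And>f w \<eta>. f \<in> hset H0 \<Longrightarrow> w \<in> X \<Longrightarrow> \<eta> \<in> hset E \<Longrightarrow> hip H0 f (k w \<eta>) = hip E (f w) \<eta>"
    and bound: "\<And>w. w \<in> X \<Longrightarrow> \<exists>C. \<forall>\<eta>\<in>hset E. hnorm H0 (k w \<eta>) \<le> C * hnorm E \<eta>"
  obtains H where "hilbert_space H"
    "\<And>f w. f \<in> hset H \<Longrightarrow> w \<in> X \<Longrightarrow> f w \<in> hset E" "\<And>f w. f \<in> hset H \<Longrightarrow> w \<notin> X \<Longrightarrow> f w = 0"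
    "hset H0 \<subseteq> hset H" "\<And>f e. f \<in> hset H \<Longrightarrow> e > 0 \<Longrightarrow> \<exists>g\<in>hset H0. hnorm H (f - g) < e"
    "\<And>f w \<eta>. f \<in> hset H \<Longrightarrow> w \<in> X \<Longrightarrow> \<eta> \<in> hset E \<Longrightarrow> hip H f (k w \<eta>) = hip E (f w) \<eta>"
proof -
  note ipsE = hilbert_space_ips[OF E]
  \<comment> \<open>Bounded evaluations make Cauchy sequences pointwise Cauchy and let norm-null
    sequences vanish pointwise.\<close>
  have eval: "\<exists>C>0. \<forall>f\<in>hset H0. hnorm E (f w) \<le> C * hnorm H0 f" if w: "w \<in> X" for w
  proof -
    obtain C where C: "\<forall>\<eta>\<in>hset E. hnorm H0 (k w \<eta>) \<le> C * hnorm E \<eta>" using bound[OF w] by blast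
    have "hnorm E (f w) \<le> (\<bar>C\<bar> + 1) * hnorm H0 f" if f: "f \<in> hset H0" for f
    proof (rule hnorm_le_of_hip[OF ipsE value0[OF f w]])
      note fw = value0[OF f w]
      have n: "0 \<le> hnorm H0 f" "0 \<le> hnorm E (f w)" using hnorm_nonneg[OF H0 f] hnorm_nonneg[OF ipsE fw] by auto
      then show "0 \<le> (\<bar>C\<bar> + 1) * hnorm H0 f" by simp
      have "cmod (hip E (f w) (f w)) \<le> hnorm H0 f * hnorm H0 (k w (f w))"
        using Cauchy_Schwarz[OF H0 f k[OF w fw]] by (simp add: rep0[OF f w fw])
      also have "\<dots> \<le> hnorm H0 f * ((\<bar>C\<bar> + 1) * hnorm E (f w))"
        using C fw n order_trans[OF _ mult_right_mono[of C "\<bar>C\<bar> + 1" "hnorm E (f w)"]]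
        by (intro mult_left_mono) auto
      finally show "cmod (hip E (f w) (f w)) \<le> (\<bar>C\<bar> + 1) * hnorm H0 f * hnorm E (f w)"
        by (simp add: algebra_simps)
    qed
    then show ?thesis by (intro exI[of _ "\<bar>C\<bar> + 1"]) (auto simp: add_nonneg_pos)
  qed
  \<comment> \<open>The sequence \<open>F\<close> represents \<open>f\<close>: it is Cauchy in norm
    and tends to \<open>f\<close> at every point. Values off \<open>X\<close> are fixed at 0 so that
    \<open>f\<close> is determined.\<close>
  define rep where "rep F f \<longleftrightarrow> Cauchy_in H0 F \<and> (\<forall>w. w \<notin> X \<longrightarrow> f w = 0) \<and>
    (\<forall>w\<in>X. f w \<in> hset E \<and> (\<lambda>n. hnorm E (F n w - f w)) \<longlonglongrightarrow> 0)" for F :: "nat \<Rightarrow> 'x \<Rightarrow> 'e" and f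
  have rep_mem: "F n \<in> hset H0" if "rep F f" for F f n
    using that by (simp add: rep_def Cauchy_in_def)
  have rep_add: "rep (\<lambda>n. F n + G n) (f + g)" if F: "rep F f" and G: "rep G g" for F G f g
    unfolding rep_def
  proof (intro conjI allI ballI impI)
    show "Cauchy_in H0 (\<lambda>n. F n + G n)"
      using F G by (intro Cauchy_in_add[OF H0]) (simp_all add: rep_def)
    show "(f + g) w = 0" if "w \<notin> X" for w using F G that by (simp add: rep_def)
    fix w assume w: "w \<in> X"
    have fg: "f w \<in> hset E" "g w \<in> hset E" using F G w by (auto simp: rep_def)
    then show "(f + g) w \<in> hset E" by (simp add: hset_add[OF ipsE])
    show "(\<lambda>n. hnorm E ((F n + G n) w - (f + g) w)) \<longlonglongrightarrow> 0"
    proof (rule Lim_null_comparison)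
      show "(\<lambda>n. hnorm E (F n w - f w) + hnorm E (G n w - g w)) \<longlonglongrightarrow> 0"
        using F G w tendsto_add[of "\<lambda>n. hnorm E (F n w - f w)" 0 _ "\<lambda>n. hnorm E (G n w - g w)" 0]
        by (simp add: rep_def)
      have "norm (hnorm E ((F n + G n) w - (f + g) w)) \<le> hnorm E (F n w - f w) + hnorm E (G n w - g w)" for n
      proof -
        have m: "F n w - f w \<in> hset E" "G n w - g w \<in> hset E"
          by (intro hset_diff[OF ipsE] value0[OF rep_mem[OF F] w] value0[OF rep_mem[OF G] w] fg)+
        have eq: "(F n + G n) w - (f + g) w = (F n w - f w) + (G n w - g w)" by simp
        show ?thesis
          unfolding eq using hnorm_triangle[OF ipsE m] hnorm_nonneg[OF ipsE hset_add[OF ipsE m]] by simp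
      qed
      then show "\<forall>\<^sub>F n in sequentially. norm (hnorm E ((F n + G n) w - (f + g) w))
          \<le> hnorm E (F n w - f w) + hnorm E (G n w - g w)" by simp
    qed
  qed
  have rep_scale: "rep (\<lambda>n. c *\<^sub>C F n) (c *\<^sub>C f)" if F: "rep F f" for F f c
    unfolding rep_def
  proof (intro conjI allI ballI impI)
    show "Cauchy_in H0 (\<lambda>n. c *\<^sub>C F n)"
      using F by (intro Cauchy_in_scale[OF H0]) (simp add: rep_def)
    show "(c *\<^sub>C f) w = 0" if "w \<notin> X" for w using F that by (simp add: rep_def scaleC_fun_apply)
    fix w assume w: "w \<in> X"
    have fw: "f w \<in> hset E" using F w by (auto simp: rep_def)
    then show "(c *\<^sub>C f) w \<in> hset E" by (simp add: hset_scale[OF ipsE] scaleC_fun_apply)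
    have "(\<lambda>n. cmod c * hnorm E (F n w - f w)) \<longlonglongrightarrow> 0"
      using F w by (intro tendsto_mult_right_zero) (simp add: rep_def)
    then show "(\<lambda>n. hnorm E ((c *\<^sub>C F n) w - (c *\<^sub>C f) w)) \<longlonglongrightarrow> 0"
      by (simp add: scaleC_fun_apply complex_vector.scale_right_diff_distrib[symmetric] hnorm_scale[OF ipsE]
          hset_diff[OF ipsE] value0[OF rep_mem[OF F] w] fw)
  qed
  have rep_diff: "rep (\<lambda>n. F n - G n) (f - g)" if "rep F f" "rep G g" for F G f g
    using rep_add[OF that(1) rep_scale[OF that(2), of "-1"]] by simp
  have rep_const: "rep (\<lambda>_. f) f" if "f \<in> hset H0" for f
    using that value0 off0 by (simp add: rep_def Cauchy_in_def hnorm_zero[OF H0] hnorm_zero[OF ipsE])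
  \<comment> \<open>Pairing with a kernel function is evaluation, so pointwise convergence to 0
    gives weak convergence to 0 against the span, which contains all of \<open>H0\<close>.\<close>
  have hip_null: "(\<lambda>n. hip H0 (F n) g) \<longlonglongrightarrow> 0" if F: "rep F 0" and g: "g \<in> hset H0" for F g
  proof -
    have "g \<in> hset H0 \<and> (\<lambda>n. hip H0 (F n) g) \<longlonglongrightarrow> 0"
      if "g \<in> cspan {k w \<eta> | w \<eta>. w \<in> X \<and> \<eta> \<in> hset E}" for g
      using that
    proof (induction rule: complex_vector.span_induct_alt)
      case base
      show ?case
        using hset_zero[OF H0] hip_zero_right[OF H0 rep_mem[OF F]] by (simp add: zero_fun_def)
    next
      case (step c x y)
      then obtain w \<eta> where w: "w \<in> X" "\<eta> \<in> hset E" "x = k w \<eta>" by blast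
      have x: "x \<in> hset H0" using w k by simp
      have "(\<lambda>n. hip H0 (F n) x) \<longlonglongrightarrow> 0"
      proof (rule Lim_null_comparison)
        show "(\<lambda>n. hnorm E (F n w) * hnorm E \<eta>) \<longlonglongrightarrow> 0"
          using F w by (intro tendsto_mult_left_zero) (simp add: rep_def)
        show "\<forall>\<^sub>F n in sequentially. cmod (hip H0 (F n) x) \<le> hnorm E (F n w) * hnorm E \<eta>"
          using Cauchy_Schwarz[OF ipsE value0[OF rep_mem[OF F] w(1)] w(2)]
          by (simp add: w rep0[OF rep_mem[OF F]])
      qed
      from tendsto_add[OF tendsto_mult_right_zero[OF this, of "cnj c"] conjunct2[OF step(2)]]
      have "(\<lambda>n. hip H0 (F n) (c *\<^sub>C x + y)) \<longlonglongrightarrow> 0"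
        using step(2) x by (simp add: hip_add_right[OF H0 rep_mem[OF F]] hip_scale_right[OF H0 rep_mem[OF F]] hset_scale[OF H0])
      moreover have "c *\<^sub>C x + y \<in> hset H0"
        using step x by (simp add: hset_add[OF H0] hset_scale[OF H0])
      ultimately show ?case by (simp add: plus_fun_def)
    qed
    then show ?thesis using g span by blast
  qed
  \<comment> \<open>The heart of the completion: a Cauchy sequence that vanishes pointwise in the
    limit vanishes in norm. In ||F_n||^2 = <F_n, F_n - F_N> + <F_n, F_N> the first term is small by
    the Cauchy property and boundedness, the second by \<open>hip_null\<close> for fixed N. Hence
    the limit function loses no information.\<close>
  have null: "(\<lambda>n. hnorm H0 (F n)) \<longlonglongrightarrow> 0" if F: "rep F 0" for F
  proof -
    note mem = rep_mem[OF F]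
    have C: "Cauchy_in H0 F" using F by (simp add: rep_def)
    obtain B where B: "B > 0" "\<And>n. hnorm H0 (F n) \<le> B"
      using Cauchy_in_bounded[OF H0 C] by metis
    have "(\<lambda>n. (hnorm H0 (F n))\<^sup>2) \<longlonglongrightarrow> 0"
      unfolding LIMSEQ_def
    proof (intro allI impI)
      fix e :: real assume e: "e > 0"
      then have "e / 2 / B > 0" using B by simp
      then obtain N where N: "\<And>m n. m \<ge> N \<Longrightarrow> n \<ge> N \<Longrightarrow> hnorm H0 (F m - F n) < e / 2 / B"
        using C unfolding Cauchy_in_def by meson
      have "\<forall>\<^sub>F n in sequentially. dist (hip H0 (F n) (F N)) 0 < e / 2"
        using hip_null[OF F mem, of N] e tendstoD half_gt_zero by blast
      then obtain N' where N': "\<And>n. n \<ge> N' \<Longrightarrow> cmod (hip H0 (F n) (F N)) < e / 2"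
        by (auto simp: eventually_sequentially)
      have "dist ((hnorm H0 (F n))\<^sup>2) 0 < e" if n: "n \<ge> max N N'" for n
      proof -
        have "hip H0 (F n) (F n) = hip H0 (F n) (F n - F N) + hip H0 (F n) (F N)"
          by (simp add: hip_diff_right[OF H0] mem)
        then have "(hnorm H0 (F n))\<^sup>2 \<le> cmod (hip H0 (F n) (F n - F N)) + cmod (hip H0 (F n) (F N))"
          using hnorm_sq[OF H0 mem, of n] complex_Re_le_cmod norm_triangle_ineq order_trans by metis
        moreover have "cmod (hip H0 (F n) (F n - F N)) \<le> B * (e / 2 / B)"
        proof (rule order_trans[OF Cauchy_Schwarz[OF H0 mem hset_diff[OF H0 mem mem]]])
          show "hnorm H0 (F n) * hnorm H0 (F n - F N) \<le> B * (e / 2 / B)"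
            using B N[of n N] n by (intro mult_mono) (auto simp: hnorm_nonneg[OF H0] hset_diff[OF H0] mem less_imp_le)
        qed
        ultimately show ?thesis using N'[of n] n B by simp
      qed
      then show "\<exists>no. \<forall>n\<ge>no. dist ((hnorm H0 (F n))\<^sup>2) 0 < e" by blast
    qed
    from tendsto_real_sqrt[OF this] show ?thesis
      by (simp add: hnorm_nonneg[OF H0 mem])
  qed
  have hip_diff_le: "cmod (hip H0 a b - hip H0 a' b') \<le> hnorm H0 (a - a') * hnorm H0 b + hnorm H0 a' * hnorm H0 (b - b')"
    if "a \<in> hset H0" "b \<in> hset H0" "a' \<in> hset H0" "b' \<in> hset H0" for a b a' b'
  proof -
    have "hip H0 a b - hip H0 a' b' = hip H0 (a - a') b + hip H0 a' (b - b')"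
      using that by (simp add: hip_diff_left[OF H0] hip_diff_right[OF H0])
    then have "cmod (hip H0 a b - hip H0 a' b') \<le> cmod (hip H0 (a - a') b) + cmod (hip H0 a' (b - b'))"
      by (simp add: norm_triangle_ineq)
    also have "\<dots> \<le> hnorm H0 (a - a') * hnorm H0 b + hnorm H0 a' * hnorm H0 (b - b')"
      using that by (intro add_mono Cauchy_Schwarz[OF H0] hset_diff[OF H0])
    finally show ?thesis .
  qed
  have conv: "convergent (\<lambda>n. hip H0 (F n) (G n))" if F: "Cauchy_in H0 F" and G: "Cauchy_in H0 G" for F G
  proof -
    have mem: "F n \<in> hset H0" "G n \<in> hset H0" for n using F G by (auto simp: Cauchy_in_def)
    obtain B where B: "B > 0" "\<And>n. hnorm H0 (F n) \<le> B" using Cauchy_in_bounded[OF H0 F] by metis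
    obtain B' where B': "B' > 0" "\<And>n. hnorm H0 (G n) \<le> B'" using Cauchy_in_bounded[OF H0 G] by metis
    have "Cauchy (\<lambda>n. hip H0 (F n) (G n))"
      unfolding Cauchy_def
    proof (intro allI impI)
      fix e :: real assume e: "e > 0"
      then have pos: "e / 2 / B' > 0" "e / 2 / B > 0" using B B' by simp_all
      obtain N where N: "\<And>m n. m \<ge> N \<Longrightarrow> n \<ge> N \<Longrightarrow> hnorm H0 (F m - F n) < e / 2 / B'"
        using F pos(1) unfolding Cauchy_in_def by meson
      obtain N' where N': "\<And>m n. m \<ge> N' \<Longrightarrow> n \<ge> N' \<Longrightarrow> hnorm H0 (G m - G n) < e / 2 / B"
        using G pos(2) unfolding Cauchy_in_def by meson
      have "dist (hip H0 (F m) (G m)) (hip H0 (F n) (G n)) < e" if "m \<ge> max N N'" "n \<ge> max N N'" for m n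
      proof -
        have "hnorm H0 (F m - F n) * hnorm H0 (G m) \<le> hnorm H0 (F m - F n) * B'"
          by (intro mult_left_mono B' hnorm_nonneg[OF H0] hset_diff[OF H0] mem)
        also have "\<dots> < e / 2" using N[of m n] that B' by (simp add: pos_less_divide_eq)
        finally have 1: "hnorm H0 (F m - F n) * hnorm H0 (G m) < e / 2" .
        have "hnorm H0 (F n) * hnorm H0 (G m - G n) \<le> B * hnorm H0 (G m - G n)"
          by (intro mult_right_mono B hnorm_nonneg[OF H0] hset_diff[OF H0] mem)
        also have "\<dots> < e / 2" using N'[of m n] that B by (simp add: pos_less_divide_eq mult.commute)
        finally have 2: "hnorm H0 (F n) * hnorm H0 (G m - G n) < e / 2" .
        show ?thesis
          using hip_diff_le[OF mem(1) mem(2) mem(1) mem(2), of m m n n] 1 2 by (simp add: dist_norm)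
      qed
      then show "\<exists>M. \<forall>m\<ge>M. \<forall>n\<ge>M. dist (hip H0 (F m) (G m)) (hip H0 (F n) (G n)) < e" by blast
    qed
    then show ?thesis by (rule Cauchy_convergent)
  qed
  \<comment> \<open>The inner product is defined through a chosen representative;
    \<open>ip_lim\<close> shows, by means of \<open>null\<close>, that any other gives the same
    limit.\<close>
  define some_rep where "some_rep f = (SOME F. rep F f)" for f
  have some_rep: "rep (some_rep f) f" if "rep F f" for F f
    unfolding some_rep_def by (rule someI[where P = "\<lambda>F. rep F f", OF that])
  define H where "H = \<lparr>hset = {f. \<exists>F. rep F f},
    hip = (\<lambda>f g. lim (\<lambda>n. hip H0 (some_rep f n) (some_rep g n)))\<rparr>"
  have in_H: "f \<in> hset H \<longleftrightarrow> (\<exists>F. rep F f)" for f by (simp add: H_def)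
  have ip_lim: "(\<lambda>n. hip H0 (F n) (G n)) \<longlonglongrightarrow> hip H f g" if F: "rep F f" and G: "rep G g" for F G f g
  proof -
    let ?F = "some_rep f" and ?G = "some_rep g"
    note F' = some_rep[OF F] and G' = some_rep[OF G]
    note mem = rep_mem[OF F] rep_mem[OF G] rep_mem[OF F'] rep_mem[OF G']
    have lim: "(\<lambda>n. hip H0 (?F n) (?G n)) \<longlonglongrightarrow> hip H f g"
      using conv[of ?F ?G] F' G' by (simp add: H_def convergent_LIMSEQ_iff rep_def)
    obtain B where B: "B > 0" "\<And>n. hnorm H0 (?F n) \<le> B"
      using Cauchy_in_bounded[OF H0, of ?F] F' by (metis rep_def)
    obtain B' where B': "B' > 0" "\<And>n. hnorm H0 (G n) \<le> B'"
      using Cauchy_in_bounded[OF H0, of G] G by (metis rep_def)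
    have "(\<lambda>n. hip H0 (F n) (G n) - hip H0 (?F n) (?G n)) \<longlonglongrightarrow> 0"
    proof (rule Lim_null_comparison)
      have "cmod (hip H0 (F n) (G n) - hip H0 (?F n) (?G n))
          \<le> hnorm H0 (F n - ?F n) * B' + B * hnorm H0 (G n - ?G n)" for n
        by (rule order_trans[OF hip_diff_le[OF mem]], intro add_mono mult_left_mono mult_right_mono B B')
          (simp_all add: hnorm_nonneg[OF H0] hset_diff[OF H0] mem)
      then show "\<forall>\<^sub>F n in sequentially. cmod (hip H0 (F n) (G n) - hip H0 (?F n) (?G n))
          \<le> hnorm H0 (F n - ?F n) * B' + B * hnorm H0 (G n - ?G n)" by simp
      have "(\<lambda>n. hnorm H0 (F n - ?F n)) \<longlonglongrightarrow> 0" "(\<lambda>n. hnorm H0 (G n - ?G n)) \<longlonglongrightarrow> 0"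
        using null[of "\<lambda>n. F n - ?F n"] null[of "\<lambda>n. G n - ?G n"] rep_diff[OF F F'] rep_diff[OF G G'] by simp_all
      from tendsto_add[OF tendsto_mult_left_zero[OF this(1)] tendsto_mult_right_zero[OF this(2)]]
      show "(\<lambda>n. hnorm H0 (F n - ?F n) * B' + B * hnorm H0 (G n - ?G n)) \<longlonglongrightarrow> 0" by simp
    qed
    from tendsto_add[OF this lim] show ?thesis by simp
  qed
  have ips: "inner_product_space H"
    unfolding inner_product_space_def
  proof (intro conjI ballI allI impI)
    show "csubspace (hset H)"
    proof (rule complex_vector.subspaceI)
      show "0 \<in> hset H" unfolding in_H using rep_const[OF hset_zero[OF H0]] by blast
      show "x + y \<in> hset H" if "x \<in> hset H" "y \<in> hset H" for x y
        using that rep_add unfolding in_H by blast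
      show "c *\<^sub>C x \<in> hset H" if "x \<in> hset H" for c x
        using that rep_scale unfolding in_H by blast
    qed
    show "hip H (x + y) z = hip H x z + hip H y z" if "x \<in> hset H" "y \<in> hset H" "z \<in> hset H" for x y z
    proof -
      obtain F G J where F: "rep F x" and G: "rep G y" and J: "rep J z" using \<open>x \<in> hset H\<close> \<open>y \<in> hset H\<close> \<open>z \<in> hset H\<close> in_H by blast
      have "(\<lambda>n. hip H0 (F n) (J n) + hip H0 (G n) (J n)) \<longlonglongrightarrow> hip H (x + y) z"
        using ip_lim[OF rep_add[OF F G] J] by (simp add: hip_add_left[OF H0] rep_mem[OF F] rep_mem[OF G] rep_mem[OF J])
      then show ?thesis
        using tendsto_add[OF ip_lim[OF F J] ip_lim[OF G J]] LIMSEQ_unique by blast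
    qed
    show "hip H (a *\<^sub>C x) y = a * hip H x y" if "x \<in> hset H" "y \<in> hset H" for a x y
    proof -
      obtain F G where F: "rep F x" and G: "rep G y" using \<open>x \<in> hset H\<close> \<open>y \<in> hset H\<close> in_H by blast
      have "(\<lambda>n. a * hip H0 (F n) (G n)) \<longlonglongrightarrow> hip H (a *\<^sub>C x) y"
        using ip_lim[OF rep_scale[OF F, of a] G] by (simp add: hip_scale_left[OF H0] rep_mem[OF F] rep_mem[OF G])
      then show ?thesis
        using tendsto_mult_left[OF ip_lim[OF F G], of a] LIMSEQ_unique by blast
    qed
    show "hip H y x = cnj (hip H x y)" if "x \<in> hset H" "y \<in> hset H" for x y
    proof -
      obtain F G where F: "rep F x" and G: "rep G y" using \<open>x \<in> hset H\<close> \<open>y \<in> hset H\<close> in_H by blast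
      have "(\<lambda>n. cnj (hip H0 (F n) (G n))) \<longlonglongrightarrow> hip H y x"
        using ip_lim[OF G F] by (simp add: hip_commute[OF H0 rep_mem[OF F] rep_mem[OF G]])
      then show ?thesis
        using tendsto_cnj[OF ip_lim[OF F G]] LIMSEQ_unique by blast
    qed
    fix x assume "x \<in> hset H"
    then obtain F where F: "rep F x" using in_H by blast
    have lim: "(\<lambda>n. of_real ((hnorm H0 (F n))\<^sup>2)) \<longlonglongrightarrow> hip H x x"
      using ip_lim[OF F F] by (simp only: hip_self[OF H0 rep_mem[OF F]])
    from tendsto_Re[OF this] have lim_Re: "(\<lambda>n. (hnorm H0 (F n))\<^sup>2) \<longlonglongrightarrow> Re (hip H x x)" by simp
    show "0 \<le> Re (hip H x x)"
      by (rule LIMSEQ_le_const[OF lim_Re]) simp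
    \<comment> \<open>The representing sequence then tends to 0 in norm, hence at every point
      because evaluations are bounded, and its pointwise limit is x.\<close>
    assume "hip H x x = 0"
    then have "(\<lambda>n. hnorm H0 (F n)) \<longlonglongrightarrow> 0"
      using tendsto_real_sqrt[OF lim_Re] by (simp add: hnorm_nonneg[OF H0 rep_mem[OF F]])
    have "x w = 0" for w
    proof (cases "w \<in> X")
      case True
      obtain C where C: "\<And>f. f \<in> hset H0 \<Longrightarrow> hnorm E (f w) \<le> C * hnorm H0 f" using eval[OF True] by blast
      have "(\<lambda>n. hnorm E (F n w - 0)) \<longlonglongrightarrow> 0"
      proof (rule Lim_null_comparison)
        show "\<forall>\<^sub>F n in sequentially. norm (hnorm E (F n w - 0)) \<le> C * hnorm H0 (F n)"
          using C[OF rep_mem[OF F]] by (simp add: hnorm_nonneg[OF ipsE] value0[OF rep_mem[OF F] True])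
        show "(\<lambda>n. C * hnorm H0 (F n)) \<longlonglongrightarrow> 0"
          using \<open>(\<lambda>n. hnorm H0 (F n)) \<longlonglongrightarrow> 0\<close> by (rule tendsto_mult_right_zero)
      qed
      moreover have "(\<lambda>n. hnorm E (F n w - x w)) \<longlonglongrightarrow> 0" "x w \<in> hset E"
        using F True by (simp_all add: rep_def)
      ultimately show ?thesis
        using hnorm_limit_unique[OF ipsE, of "\<lambda>n. F n w" "x w" 0] value0[OF rep_mem[OF F] True] hset_zero[OF ipsE]
        by blast
    qed (use F in \<open>simp add: rep_def\<close>)
    then show "x = 0" by (simp add: fun_eq_iff)
  qed
  have H0_H: "f \<in> hset H" if "f \<in> hset H0" for f
    using rep_const[OF that] in_H by blast
  have norm_lim: "(\<lambda>n. hnorm H0 (F n)) \<longlonglongrightarrow> hnorm H f" if F: "rep F f" for F f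
    using tendsto_real_sqrt[OF tendsto_Re[OF ip_lim[OF F F]]] by (simp add: hnorm_def)
  have hip_H0: "hip H f g = hip H0 f g" if "f \<in> hset H0" "g \<in> hset H0" for f g
    using ip_lim[OF rep_const[OF that(1)] rep_const[OF that(2)]] LIMSEQ_unique tendsto_const by metis
  have norm_H0: "hnorm H f = hnorm H0 f" if "f \<in> hset H0" for f
    using that by (simp add: hnorm_def hip_H0)
  have rep_conv: "(\<lambda>j. hnorm H (F j - f)) \<longlonglongrightarrow> 0" if F: "rep F f" for F f
    unfolding LIMSEQ_def
  proof (intro allI impI)
    fix e :: real assume e: "e > 0"
    then have "e/2 > 0" by simp
    then obtain N where N: "\<And>m n. m \<ge> N \<Longrightarrow> n \<ge> N \<Longrightarrow> hnorm H0 (F m - F n) < e/2"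
      using F unfolding rep_def Cauchy_in_def by meson
    have "dist (hnorm H (F j - f)) 0 < e" if j: "j \<ge> N" for j
    proof -
      have r: "rep (\<lambda>n. F j - F n) (F j - f)"
        by (rule rep_diff[OF rep_const[OF rep_mem[OF F]] F])
      have "hnorm H (F j - f) \<le> e/2"
      proof (rule LIMSEQ_le_const2[OF norm_lim[OF r]])
        show "\<exists>N. \<forall>n\<ge>N. hnorm H0 (F j - F n) \<le> e/2" using N[OF j] by (meson less_imp_le)
      qed
      moreover have "0 \<le> hnorm H (F j - f)" using hnorm_nonneg[OF ips] r in_H by blast
      ultimately show ?thesis using e by simp
    qed
    then show "\<exists>no. \<forall>n\<ge>no. dist (hnorm H (F n - f)) 0 < e" by blast
  qed
  have dense: "\<exists>g\<in>hset H0. hnorm H (f - g) < e" if f: "f \<in> hset H" and e: "e > 0" for f e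
  proof -
    obtain F where F: "rep F f" using f in_H by blast
    have "\<forall>\<^sub>F n in sequentially. hnorm H (F n - f) < e"
      using order_tendstoD(2)[OF rep_conv[OF F] e] .
    then obtain n where "hnorm H (F n - f) < e" by (auto simp: eventually_sequentially)
    then show ?thesis
      using rep_mem[OF F] H0_H f hnorm_diff_commute[OF ips] by (metis (no_types, lifting))
  qed
  have "hilbert_space H"
    unfolding hilbert_space_iff
  proof (intro conjI allI impI ips)
    fix S assume S: "Cauchy_in H S"
    then have S_mem: "S n \<in> hset H" for n by (simp add: Cauchy_in_def)
    \<comment> \<open>A Cauchy sequence of the completion is replaced by one in \<open>H0\<close> at
      distance tending to 0, which represents its own pointwise limit.\<close>
    have "\<exists>g\<in>hset H0. hnorm H (S n - g) < inverse (Suc n)" for n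
      using dense[OF S_mem, of "inverse (Suc n)" n] by simp
    then obtain G where G: "\<And>n. G n \<in> hset H0" "\<And>n. hnorm H (S n - G n) < inverse (Suc n)"
      by metis
    have SG: "(\<lambda>n. hnorm H (S n - G n)) \<longlonglongrightarrow> 0"
    proof (rule Lim_null_comparison[OF _ LIMSEQ_inverse_real_of_nat])
      show "\<forall>\<^sub>F n in sequentially. norm (hnorm H (S n - G n)) \<le> inverse (real (Suc n))"
        using G S_mem H0_H by (simp add: less_imp_le hnorm_nonneg[OF ips] hset_diff[OF ips])
    qed
    have G_C: "Cauchy_in H0 G"
      unfolding Cauchy_in_def
    proof (intro conjI allI impI G(1))
      fix e :: real assume e: "e > 0"
      then have e3: "e/3 > 0" by simp
      obtain N where N: "\<And>m n. m \<ge> N \<Longrightarrow> n \<ge> N \<Longrightarrow> hnorm H (S m - S n) < e/3"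
        using S e3 unfolding Cauchy_in_def by meson
      obtain N' where N': "\<And>n. n \<ge> N' \<Longrightarrow> hnorm H (S n - G n) < e/3"
        using order_tendstoD(2)[OF SG e3] by (auto simp: eventually_sequentially)
      have "hnorm H0 (G m - G n) < e" if "m \<ge> max N N'" "n \<ge> max N N'" for m n
      proof -
        have "hnorm H (G m - G n) \<le> hnorm H (G m - S m) + (hnorm H (S m - S n) + hnorm H (S n - G n))"
          using hnorm_triangle_diff[OF ips H0_H[OF G(1)] S_mem H0_H[OF G(1)], of m n m]
            hnorm_triangle_diff[OF ips S_mem S_mem H0_H[OF G(1)], of m n n] by linarith
        then show ?thesis
          using N[of m n] N'[of m] N'[of n] that hnorm_diff_commute[OF ips H0_H[OF G(1)] S_mem, of m m]
            norm_H0[OF hset_diff[OF H0 G(1) G(1)], of m n] by simp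
      qed
      then show "\<exists>N. \<forall>m\<ge>N. \<forall>n\<ge>N. hnorm H0 (G m - G n) < e" by blast
    qed
    have "\<exists>y. y \<in> hset E \<and> (\<lambda>n. hnorm E (G n w - y)) \<longlonglongrightarrow> 0" if w: "w \<in> X" for w
    proof -
      obtain C where C: "C > 0" "\<And>f. f \<in> hset H0 \<Longrightarrow> hnorm E (f w) \<le> C * hnorm H0 f" using eval[OF w] by blast
      have "Cauchy_in E (\<lambda>n. G n w)"
      proof (rule Cauchy_in_lipschitz[OF G_C _ _ C(1)])
        show "hnorm E (G m w - G n w) \<le> C * hnorm H0 (G m - G n)" for m n
          using C(2)[OF hset_diff[OF H0 G(1) G(1)], of m n] by simp
      qed (rule value0[OF G(1) w])
      then show ?thesis using hilbert_complete[OF E] by blast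
    qed
    then obtain y where y: "\<And>w. w \<in> X \<Longrightarrow> y w \<in> hset E \<and> (\<lambda>n. hnorm E (G n w - y w)) \<longlonglongrightarrow> 0"
      by metis
    define f where "f = zero_ext X y"
    have rep_f: "rep G f"
      using G_C y by (simp add: rep_def f_def zero_ext_def)
    have f: "f \<in> hset H" using rep_f in_H by blast
    have "(\<lambda>n. hnorm H (S n - f)) \<longlonglongrightarrow> 0"
    proof (rule Lim_null_comparison)
      show "(\<lambda>n. hnorm H (S n - G n) + hnorm H (G n - f)) \<longlonglongrightarrow> 0"
        using tendsto_add[OF SG rep_conv[OF rep_f]] by simp
      show "\<forall>\<^sub>F n in sequentially. norm (hnorm H (S n - f)) \<le> hnorm H (S n - G n) + hnorm H (G n - f)"
        using hnorm_triangle_diff[OF ips S_mem H0_H[OF G(1)] f]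
        by (simp add: hnorm_nonneg[OF ips] hset_diff[OF ips] S_mem f)
    qed
    then show "\<exists>x\<in>hset H. (\<lambda>n. hnorm H (S n - x)) \<longlonglongrightarrow> 0" using f by blast
  qed
  moreover have "hip H f (k w \<eta>) = hip E (f w) \<eta>" if f: "f \<in> hset H" and w: "w \<in> X" "\<eta> \<in> hset E" for f w \<eta>
  proof -
    obtain F where F: "rep F f" using f in_H by blast
    have "(\<lambda>n. hip E (F n w) \<eta>) \<longlonglongrightarrow> hip H f (k w \<eta>)"
      using ip_lim[OF F rep_const[OF k[OF w]]] by (simp add: rep0[OF rep_mem[OF F] w])
    moreover have "(\<lambda>n. hip E (F n w) \<eta>) \<longlonglongrightarrow> hip E (f w) \<eta>"
      using F w value0[OF rep_mem[OF F] w(1)]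
      by (intro tendsto_hip[OF ipsE]) (auto simp: rep_def hnorm_zero[OF ipsE])
    ultimately show ?thesis by (rule LIMSEQ_unique)
  qed
  moreover have "f w \<in> hset E" if "f \<in> hset H" "w \<in> X" for f w
    using that by (auto simp: in_H rep_def)
  moreover have "f w = 0" if "f \<in> hset H" "w \<notin> X" for f w
    using that by (auto simp: in_H rep_def)
  ultimately show ?thesis
    using that[of H] H0_H dense by blast
qed

section \<open>The Moore-Aronszajn construction\<close>

lemma kernel_positive:
  fixes m :: nat
  assumes "is_kernel E X K" "\<And>j. j < m \<Longrightarrow> x j \<in> X \<and> \<eta> j \<in> hset E"
  shows "(\<Sum>p<m. \<Sum>q<m. hip E (K (x p) (x q) (\<eta> q)) (\<eta> p)) \<in> \<real>\<^sub>\<ge>\<^sub>0"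
proof -
  have "\<forall>(m::nat) x \<eta>. (\<forall>j<m. x j \<in> X \<and> \<eta> j \<in> hset E) \<longrightarrow>
      (\<Sum>p<m. \<Sum>q<m. hip E (K (x p) (x q) (\<eta> q)) (\<eta> p)) \<in> \<real>\<^sub>\<ge>\<^sub>0"
    using assms(1) unfolding is_kernel_def by (rule conjunct2)
  then show ?thesis using assms(2) by blast
qed

lemma hip_sum_self:
  assumes H: "inner_product_space H" and f: "\<And>i. i \<in> I \<Longrightarrow> f i \<in> hset H"
  shows "hip H (\<Sum>i\<in>I. f i) (\<Sum>i\<in>I. f i) = (\<Sum>p\<in>I. \<Sum>q\<in>I. hip H (f q) (f p))"
proof -
  have "hip H (\<Sum>i\<in>I. f i) (\<Sum>i\<in>I. f i) = (\<Sum>p\<in>I. hip H (\<Sum>i\<in>I. f i) (f p))"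
    by (rule hip_sum_right[OF H f hset_sum[OF H f]])
  also have "\<dots> = (\<Sum>p\<in>I. \<Sum>q\<in>I. hip H (f q) (f p))"
    by (intro sum.cong refl hip_sum_left[OF H] f)
  finally show ?thesis .
qed

text \<open>Positivity includes that the sums are real. Two points, with the diagonal terms removed,
  show that <K(z,w) \<zeta>, \<xi>> + <K(w,z) \<xi>, \<zeta>> is real; taking \<zeta> to be \<eta>
  and its i-fold separates real and imaginary parts.\<close>

lemma kernel_hermitian:
  assumes E: "inner_product_space E" and K: "is_kernel E X K"
    and z: "z \<in> X" and w: "w \<in> X" and \<eta>: "\<eta> \<in> hset E" and \<xi>: "\<xi> \<in> hset E"
  shows "hip E (K w z \<xi>) \<eta> = cnj (hip E (K z w \<eta>) \<xi>)"
proof -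
  have lin: "K a b \<in> linear_ops E E" if "a \<in> X" "b \<in> X" for a b
    using K that by (intro bounded_ops_linear) (simp add: is_kernel_def)
  have diag: "Im (hip E (K a a \<zeta>) \<zeta>) = 0" if "a \<in> X" "\<zeta> \<in> hset E" for a \<zeta>
    using kernel_positive[OF K, of "Suc 0" "\<lambda>_. a" "\<lambda>_. \<zeta>"] that by (simp add: complex_nonneg_Reals_iff)
  have sum: "Im (hip E (K z w \<zeta>) \<xi> + hip E (K w z \<xi>) \<zeta>) = 0" if "\<zeta> \<in> hset E" for \<zeta>
    using kernel_positive[OF K, of 2 "\<lambda>j. if j = 0 then z else w" "\<lambda>j. if j = 0 then \<xi> else \<zeta>"]
      diag[OF z \<xi>] diag[OF w that] that z w \<xi>
    by (simp add: complex_nonneg_Reals_iff numeral_2_eq_2)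
  have "hip E (K z w (\<i> *\<^sub>C \<eta>)) \<xi> = \<i> * hip E (K z w \<eta>) \<xi>"
    by (simp add: op_scale[OF lin[OF z w] \<eta>] hip_scale_left[OF E] op_mem[OF lin[OF z w] \<eta>] \<xi>)
  moreover have "hip E (K w z \<xi>) (\<i> *\<^sub>C \<eta>) = - \<i> * hip E (K w z \<xi>) \<eta>"
    by (simp add: hip_scale_right[OF E] op_mem[OF lin[OF w z] \<xi>] \<eta>)
  ultimately show ?thesis
    using sum[OF \<eta>] sum[OF hset_scale[OF E \<eta>], of \<i>] by (simp add: complex_eq_iff)
qed

text \<open>The finite combinations of kernel functions form an inner product space of functions
  with the reproducing property, which is then completed. Formal combinations are kept as lists of
  pairs, so that addition is concatenation and repeated points are harmless.\<close>

theorem rkhs_exists: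
  fixes E :: "'e::complex_vector hspace" and X :: "'x set" and K :: "'x \<Rightarrow> 'x \<Rightarrow> 'e \<Rightarrow> 'e"
  assumes E: "hilbert_space E" and K: "is_kernel E X K"
  obtains H where "is_rkhs E X K H"
proof -
  note ipsE = hilbert_space_ips[OF E]
  have bdd: "K z w \<in> bounded_ops E E" if "z \<in> X" "w \<in> X" for z w
    using K that by (simp add: is_kernel_def)
  have lin: "K z w \<in> linear_ops E E" if "z \<in> X" "w \<in> X" for z w
    by (rule bounded_ops_linear[OF bdd[OF that]])
  have K_mem: "K z w \<eta> \<in> hset E" if "z \<in> X" "w \<in> X" "\<eta> \<in> hset E" for z w \<eta>
    using op_mem[OF lin] that by blast
  let ?k = "kernel_fun X K"
  have k_apply: "?k w \<eta> z = (if z \<in> X then K z w \<eta> else 0)" for w \<eta> z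
    by (simp add: kernel_fun_def zero_ext_def)
  define comb where "comb xs = (\<Sum>(w, \<eta>)\<leftarrow>xs. ?k w \<eta>)" for xs
  \<comment> \<open>The pairing of a function with a formal combination. Its dependence on the first
    argument is through the function alone by definition; for the list this has to be
    proved.\<close>
  define form where "form f xs = (\<Sum>(v, \<xi>)\<leftarrow>xs. hip E (f v) \<xi>)" for f :: "'x \<Rightarrow> 'e" and xs
  define valid where "valid xs \<longleftrightarrow> set xs \<subseteq> X \<times> hset E" for xs
  have comb_Nil: "comb [] = 0" and comb_Cons: "comb ((w, \<eta>) # xs) = ?k w \<eta> + comb xs"
    and comb_append: "comb (xs @ ys) = comb xs + comb ys" for w \<eta> xs ys
    by (simp_all add: comb_def)
  have form_Nil: "form f [] = 0" and form_Cons: "form f ((w, \<eta>) # xs) = hip E (f w) \<eta> + form f xs" for f w \<eta> xs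
    by (simp_all add: form_def)
  have valid_Cons: "valid ((w, \<eta>) # xs) \<longleftrightarrow> w \<in> X \<and> \<eta> \<in> hset E \<and> valid xs"
    and valid_append: "valid (xs @ ys) \<longleftrightarrow> valid xs \<and> valid ys" and valid_Nil: "valid []" for w \<eta> xs ys
    by (auto simp: valid_def)
  have comb_value: "comb xs v \<in> hset E" if "valid xs" "v \<in> X" for xs v
    using that(1)
  proof (induction xs)
    case (Cons a xs)
    then show ?case
      using that(2) K_mem by (cases a) (simp add: comb_Cons valid_Cons k_apply hset_add[OF ipsE])
  qed (simp add: comb_Nil hset_zero[OF ipsE])
  have comb_off: "comb xs v = 0" if "v \<notin> X" for xs v
  proof (induction xs)
    case (Cons a xs)
    then show ?case using that by (cases a) (simp add: comb_Cons k_apply)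
  qed (simp add: comb_Nil)
  have form_add: "form (f + g) ys = form f ys + form g ys"
    if "valid ys" "\<And>v. v \<in> X \<Longrightarrow> f v \<in> hset E" "\<And>v. v \<in> X \<Longrightarrow> g v \<in> hset E" for f g ys
    using that(1)
  proof (induction ys)
    case (Cons a ys)
    then show ?case
      using that(2,3) by (cases a) (simp add: form_Cons valid_Cons hip_add_left[OF ipsE])
  qed (simp add: form_Nil)
  have form_scale: "form (c *\<^sub>C f) ys = c * form f ys"
    if "valid ys" "\<And>v. v \<in> X \<Longrightarrow> f v \<in> hset E" for c f ys
    using that(1)
  proof (induction ys)
    case (Cons a ys)
    then show ?case
      using that(2) by (cases a) (simp add: form_Cons valid_Cons hip_scale_left[OF ipsE] scaleC_fun_apply distrib_left)
  qed (simp add: form_Nil)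
  have form_kernel: "form (?k w \<eta>) ys = cnj (hip E (comb ys w) \<eta>)"
    if "valid ys" "w \<in> X" "\<eta> \<in> hset E" for w \<eta> ys
    using that(1)
  proof (induction ys)
    case (Cons a ys)
    obtain v \<xi> where a: "a = (v, \<xi>)" by (cases a)
    have "v \<in> X" "\<xi> \<in> hset E" "valid ys" using Cons.prems by (auto simp: a valid_Cons)
    then show ?case
      using that(2,3) Cons.IH kernel_hermitian[OF ipsE K, of w v \<xi> \<eta>]
      by (simp add: a form_Cons comb_Cons k_apply hip_add_left[OF ipsE] K_mem comb_value)
  qed (simp add: form_Nil comb_Nil hip_zero_left[OF ipsE] that)
  \<comment> \<open>The right-hand side sees \<open>ys\<close> only through the function
    \<open>comb ys\<close>; hence so does the left, and the form is well defined on functions in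
    both arguments.\<close>
  have form_comm: "form (comb xs) ys = cnj (form (comb ys) xs)" if "valid xs" "valid ys" for xs ys
    using that(1)
  proof (induction xs)
    case Nil
    have "form 0 ys = 0"
      using that(2)
    proof (induction ys)
      case (Cons a ys)
      then show ?case by (cases a) (simp add: form_Cons valid_Cons hip_zero_left[OF ipsE])
    qed (simp add: form_Nil)
    then show ?case by (simp add: comb_Nil form_Nil zero_fun_def)
  next
    case (Cons a xs)
    obtain v \<xi> where a: "a = (v, \<xi>)" by (cases a)
    have *: "v \<in> X" "\<xi> \<in> hset E" "valid xs" using Cons.prems by (auto simp: a valid_Cons)
    have "form (?k v \<xi> + comb xs) ys = form (?k v \<xi>) ys + form (comb xs) ys"
      using * by (intro form_add that(2) comb_value) (auto simp: k_apply K_mem)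
    then show ?case
      using Cons.IH[OF *(3)] form_kernel[OF that(2) *(1,2)] by (simp add: a comb_Cons form_Cons plus_fun_def)
  qed
  have comb_nth: "comb xs = (\<Sum>q<length xs. ?k (fst (xs ! q)) (snd (xs ! q)))" for xs
    by (simp add: comb_def sum_list_sum_nth atLeast0LessThan case_prod_beta)
  have form_pos: "form (comb xs) xs \<in> \<real>\<^sub>\<ge>\<^sub>0" if xs: "valid xs" for xs
  proof -
    let ?x = "\<lambda>p. fst (xs ! p)" and ?\<eta> = "\<lambda>p. snd (xs ! p)"
    have mem: "?x p \<in> X \<and> ?\<eta> p \<in> hset E" if "p < length xs" for p
      using nth_mem[OF that] xs by (auto simp: valid_def)
    have comb_at: "comb xs v = (\<Sum>q<length xs. K v (?x q) (?\<eta> q))" if "v \<in> X" for v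
    proof -
      have "(\<Sum>q\<in>I. ?k (?x q) (?\<eta> q)) v = (\<Sum>q\<in>I. K v (?x q) (?\<eta> q))" for I :: "nat set"
        by (induction I rule: infinite_finite_induct) (simp_all add: k_apply that)
      then show ?thesis by (simp add: comb_nth)
    qed
    have "form (comb xs) xs = (\<Sum>p<length xs. hip E (comb xs (?x p)) (?\<eta> p))"
      by (simp add: form_def sum_list_sum_nth atLeast0LessThan case_prod_beta)
    also have "\<dots> = (\<Sum>p<length xs. \<Sum>q<length xs. hip E (K (?x p) (?x q) (?\<eta> q)) (?\<eta> p))"
    proof (rule sum.cong[OF refl])
      fix p assume "p \<in> {..<length xs}"
      then have p: "p < length xs" by simp
      show "hip E (comb xs (?x p)) (?\<eta> p) = (\<Sum>q<length xs. hip E (K (?x p) (?x q) (?\<eta> q)) (?\<eta> p))"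
        unfolding comb_at[OF conjunct1[OF mem[OF p]]]
        by (rule hip_sum_left[OF ipsE]) (use mem p in \<open>auto intro!: K_mem\<close>)
    qed
    also have "\<dots> \<in> \<real>\<^sub>\<ge>\<^sub>0"
      by (rule kernel_positive[OF K mem])
    finally show ?thesis .
  qed
  define repr where "repr g = (SOME ys. valid ys \<and> g = comb ys)" for g
  have repr: "valid (repr (comb ys)) \<and> comb ys = comb (repr (comb ys))" if "valid ys" for ys
    unfolding repr_def by (rule someI[of "\<lambda>zs. valid zs \<and> comb ys = comb zs" ys]) (simp add: that)
  define H0 where "H0 = \<lparr>hset = comb ` {xs. valid xs}, hip = (\<lambda>f g. form f (repr g))\<rparr>"
  have hip_H0: "hip H0 f (comb ys) = form f ys" if f: "f \<in> hset H0" and ys: "valid ys" for f ys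
  proof -
    obtain xs where xs: "valid xs" "f = comb xs" using f by (auto simp: H0_def)
    have "form (comb xs) (repr (comb ys)) = form (comb xs) ys"
      using form_comm[OF xs(1), of "repr (comb ys)"] form_comm[OF xs(1) ys] repr[OF ys] by simp
    then show ?thesis by (simp add: H0_def xs(2))
  qed
  have H0_E: "\<exists>xs. valid xs \<and> f = comb xs" if "f \<in> hset H0" for f
    using that by (auto simp: H0_def)
  have H0_I: "comb xs \<in> hset H0" if "valid xs" for xs
    using that by (auto simp: H0_def)
  have comb_scale: "\<exists>ys. valid ys \<and> c *\<^sub>C comb xs = comb ys" if "valid xs" for c xs
    using that
  proof (induction xs)
    case Nil
    show ?case by (intro exI[of _ "[]"]) (simp add: comb_Nil valid_Nil fun_eq_iff scaleC_fun_apply)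
  next
    case (Cons a xs)
    obtain v \<xi> where a: "a = (v, \<xi>)" by (cases a)
    have *: "v \<in> X" "\<xi> \<in> hset E" "valid xs" using Cons.prems by (auto simp: a valid_Cons)
    then obtain ys where ys: "valid ys" "c *\<^sub>C comb xs = comb ys" using Cons.IH by blast
    have "c *\<^sub>C ?k v \<xi> = ?k v (c *\<^sub>C \<xi>)"
      using * by (auto simp: fun_eq_iff scaleC_fun_apply k_apply op_scale[OF lin])
    then have "c *\<^sub>C comb (a # xs) = comb ((v, c *\<^sub>C \<xi>) # ys)"
      by (simp only: a comb_Cons scaleC_add_right ys(2))
    moreover have "valid ((v, c *\<^sub>C \<xi>) # ys)"
      using * ys by (simp add: valid_Cons hset_scale[OF ipsE])
    ultimately show ?case by blast
  qed
  have H0_value: "f w \<in> hset E" if "f \<in> hset H0" "w \<in> X" for f w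
    using H0_E[OF that(1)] comb_value that(2) by blast
  have k_H0: "?k w \<eta> \<in> hset H0" if "w \<in> X" "\<eta> \<in> hset E" for w \<eta>
    using H0_I[of "[(w, \<eta>)]"] that by (simp add: comb_Cons comb_Nil valid_Cons valid_Nil)
  have rep0: "hip H0 f (?k w \<eta>) = hip E (f w) \<eta>" if "f \<in> hset H0" "w \<in> X" "\<eta> \<in> hset E" for f w \<eta>
    using hip_H0[OF that(1), of "[(w, \<eta>)]"] that by (simp add: comb_Cons comb_Nil valid_Cons valid_Nil form_Cons form_Nil)
  have H0_add: "f + g \<in> hset H0" if "f \<in> hset H0" "g \<in> hset H0" for f g
    using H0_E[OF that(1)] H0_E[OF that(2)] comb_append valid_append H0_I by metis
  have H0_scale: "c *\<^sub>C f \<in> hset H0" if "f \<in> hset H0" for c f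
    using H0_E[OF that] comb_scale H0_I by metis
  have H0_comm: "hip H0 g f = cnj (hip H0 f g)" if "f \<in> hset H0" "g \<in> hset H0" for f g
  proof -
    obtain xs ys where "valid xs" "f = comb xs" "valid ys" "g = comb ys"
      using H0_E \<open>f \<in> hset H0\<close> \<open>g \<in> hset H0\<close> by metis
    then show ?thesis
      using hip_H0 form_comm that by (metis complex_cnj_cnj)
  qed
  have H0_hip_add: "hip H0 (f + g) u = hip H0 f u + hip H0 g u"
    if "f \<in> hset H0" "g \<in> hset H0" "u \<in> hset H0" for f g u
  proof -
    obtain ys where ys: "valid ys" "u = comb ys" using H0_E \<open>u \<in> hset H0\<close> by blast
    show ?thesis
      using form_add[OF ys(1) H0_value H0_value] that by (simp add: ys(2) hip_H0 ys(1) H0_add)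
  qed
  have H0_hip_scale: "hip H0 (c *\<^sub>C f) u = c * hip H0 f u" if "f \<in> hset H0" "u \<in> hset H0" for c f u
  proof -
    obtain ys where ys: "valid ys" "u = comb ys" using H0_E \<open>u \<in> hset H0\<close> by blast
    show ?thesis
      using form_scale[OF ys(1) H0_value] that by (simp add: ys(2) hip_H0 ys(1) H0_scale)
  qed
  have H0_pos: "hip H0 f f \<in> \<real>\<^sub>\<ge>\<^sub>0" if "f \<in> hset H0" for f
    using H0_E[OF that] hip_H0 form_pos H0_I by metis
  \<comment> \<open>The Cauchy-Schwarz lemma presupposes definiteness, so the semidefinite form is
    expanded by hand at f + c u, where u is the kernel function for \<eta> = f(w). Then a = <f, u> =
    <f(w), f(w)> must vanish.\<close>
  have H0_definite: "f = 0" if f: "f \<in> hset H0" and zero: "hip H0 f f = 0" for f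
  proof
    fix w
    show "f w = 0 w"
    proof (cases "w \<in> X")
      case True
      define u where "u = ?k w (f w)"
      define a where "a = hip H0 f u"
      define \<kappa> where "\<kappa> = Re (hip H0 u u)"
      \<comment> \<open>Adding 1 excludes division by 0 and ensures s \<kappa> \<le> 1, so the
        factor s \<kappa> - 2 in the expansion is negative.\<close>
      define s where "s = 1 / (\<kappa> + 1)"
      have u: "u \<in> hset H0" using k_H0 True H0_value[OF f] by (simp add: u_def)
      have \<kappa>: "hip H0 u u = of_real \<kappa>" "\<kappa> \<ge> 0"
        using H0_pos[OF u] by (auto simp: \<kappa>_def complex_nonneg_Reals_iff complex_eq_iff)
      have s: "s > 0" "s * \<kappa> \<le> 1" using \<kappa>(2) by (simp_all add: s_def)
      define c where "c = - of_real s * a"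
      have expand: "hip H0 (f + c *\<^sub>C u) (f + c *\<^sub>C u) = cnj c * a + c * cnj a + c * cnj c * of_real \<kappa>"
      proof -
        have cu: "c *\<^sub>C u \<in> hset H0" by (rule H0_scale[OF u])
        have fcu: "f + c *\<^sub>C u \<in> hset H0" by (rule H0_add[OF f cu])
        have 1: "hip H0 f (f + c *\<^sub>C u) = cnj c * a"
          using H0_comm[OF fcu f] H0_hip_add[OF f cu f] H0_hip_scale[OF u f, of c] H0_comm[OF f u] zero
          by (simp add: a_def)
        have 2: "hip H0 u (f + c *\<^sub>C u) = cnj a + cnj c * of_real \<kappa>"
          using H0_comm[OF fcu u] H0_hip_add[OF f cu u] H0_hip_scale[OF u u, of c] \<kappa>(1)
          by (simp add: a_def)
        show ?thesis
          using H0_hip_add[OF f cu fcu] H0_hip_scale[OF u fcu, of c] 1 2 by (simp add: algebra_simps)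
      qed
      have "0 \<le> Re (hip H0 (f + c *\<^sub>C u) (f + c *\<^sub>C u))"
        using H0_pos[OF H0_add[OF f H0_scale[OF u]]] by (simp add: complex_nonneg_Reals_iff)
      also have "\<dots> = (s * (cmod a)\<^sup>2) * (s * \<kappa> - 2)"
      proof -
        have aa: "a * cnj a = of_real ((cmod a)\<^sup>2)"
          by (simp only: complex_norm_square)
        have "cnj c * a = - (of_real s * (a * cnj a))" "c * cnj a = - (of_real s * (a * cnj a))"
          "c * cnj c * of_real \<kappa> = of_real s * of_real s * of_real \<kappa> * (a * cnj a)"
          by (simp_all add: c_def mult_ac)
        then have "hip H0 (f + c *\<^sub>C u) (f + c *\<^sub>C u) = of_real ((s * (cmod a)\<^sup>2) * (s * \<kappa> - 2))"
          unfolding expand aa by (simp add: algebra_simps)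
        then show ?thesis by simp
      qed
      finally have "0 \<le> (s * (cmod a)\<^sup>2) * (s * \<kappa> - 2)" .
      then have "s * (cmod a)\<^sup>2 \<le> 0"
        using s by (simp add: zero_le_mult_iff)
      then have "a = 0" using s by (simp add: mult_le_0_iff)
      then have "hip E (f w) (f w) = 0"
        using rep0[OF f True H0_value[OF f True]] by (simp add: a_def u_def)
      then show ?thesis using hip_self_zero[OF ipsE H0_value[OF f True]] by simp
    next
      case False
      then show ?thesis using H0_E[OF f] comb_off by auto
    qed
  qed
  have ips0: "inner_product_space H0"
    unfolding inner_product_space_def
  proof (intro conjI ballI allI impI)
    show "csubspace (hset H0)"
      using H0_I[OF valid_Nil] H0_add H0_scale by (intro complex_vector.subspaceI) (auto simp: comb_Nil)
    show "0 \<le> Re (hip H0 x x)" if "x \<in> hset H0" for x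
      using H0_pos[OF that] by (simp add: complex_nonneg_Reals_iff)
  qed (fact H0_hip_add H0_hip_scale H0_comm H0_definite)+
  let ?G = "{?k w \<eta> | w \<eta>. w \<in> X \<and> \<eta> \<in> hset E}"
  have comb_span: "comb xs \<in> cspan ?G" if "valid xs" for xs
    using that
  proof (induction xs)
    case (Cons a xs)
    obtain v \<xi> where a: "a = (v, \<xi>)" by (cases a)
    show ?case
      unfolding a comb_Cons
    proof (rule complex_vector.span_add)
      show "?k v \<xi> \<in> cspan ?G"
        by (rule complex_vector.span_base) (use Cons.prems a in \<open>auto simp: valid_Cons\<close>)
      show "comb xs \<in> cspan ?G"
        using Cons a by (simp add: valid_Cons)
    qed
  next
    case Nil
    show ?case unfolding comb_Nil by (rule complex_vector.span_zero)
  qed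
  then have span0: "hset H0 \<subseteq> cspan ?G" using H0_E by blast
  have bound0: "\<exists>C. \<forall>\<eta>\<in>hset E. hnorm H0 (?k w \<eta>) \<le> C * hnorm E \<eta>" if w: "w \<in> X" for w
  proof -
    obtain D where D: "D > 0" "\<And>x. x \<in> hset E \<Longrightarrow> hnorm E (K w w x) \<le> D * hnorm E x"
      using bounded_ops_bound[OF bdd[OF w w] ipsE] by metis
    have "hnorm H0 (?k w \<eta>) \<le> sqrt D * hnorm E \<eta>" if \<eta>: "\<eta> \<in> hset E" for \<eta>
    proof (rule power2_le_imp_le)
      have "(hnorm H0 (?k w \<eta>))\<^sup>2 = Re (hip E (K w w \<eta>) \<eta>)"
        using hnorm_sq[OF ips0 k_H0[OF w \<eta>]] rep0[OF k_H0[OF w \<eta>] w \<eta>] w by (simp add: k_apply)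
      also have "\<dots> \<le> hnorm E (K w w \<eta>) * hnorm E \<eta>"
        by (rule order_trans[OF complex_Re_le_cmod Cauchy_Schwarz[OF ipsE K_mem[OF w w \<eta>] \<eta>]])
      also have "\<dots> \<le> D * hnorm E \<eta> * hnorm E \<eta>"
        by (intro mult_right_mono D hnorm_nonneg[OF ipsE] \<eta>)
      also have "\<dots> = (sqrt D * hnorm E \<eta>)\<^sup>2"
        using D(1) by (simp add: power_mult_distrib power2_eq_square)
      finally show "(hnorm H0 (?k w \<eta>))\<^sup>2 \<le> (sqrt D * hnorm E \<eta>)\<^sup>2" .
      show "0 \<le> sqrt D * hnorm E \<eta>" using D(1) hnorm_nonneg[OF ipsE \<eta>] by simp
    qed
    then show ?thesis by blast
  qed
  have off0: "f w = 0" if "f \<in> hset H0" "w \<notin> X" for f w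
    using H0_E[OF that(1)] comb_off[OF that(2)] by auto
  show ?thesis
  proof (rule reproducing_space_completion[of E H0 X ?k])
    fix H
    assume H: "hilbert_space H"
      "\<And>f w. f \<in> hset H \<Longrightarrow> w \<in> X \<Longrightarrow> f w \<in> hset E" "\<And>f w. f \<in> hset H \<Longrightarrow> w \<notin> X \<Longrightarrow> f w = 0"
      "hset H0 \<subseteq> hset H" "\<And>f e. f \<in> hset H \<Longrightarrow> e > 0 \<Longrightarrow> \<exists>g\<in>hset H0. hnorm H (f - g) < e"
      "\<And>f w \<eta>. f \<in> hset H \<Longrightarrow> w \<in> X \<Longrightarrow> \<eta> \<in> hset E \<Longrightarrow> hip H f (?k w \<eta>) = hip E (f w) \<eta>"
    have "total_in H ?G"
      unfolding total_in_def
    proof (intro conjI ballI allI impI)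
      show "?G \<subseteq> hset H" using k_H0 H(4) by blast
      show "\<exists>y\<in>cspan ?G. hnorm H (x - y) < e" if "x \<in> hset H" "e > 0" for x e
        using H(5)[OF that] span0 by blast
    qed
    then have "is_rkhs E X K H"
      using H by (simp add: is_rkhs_def)
    then show ?thesis by (rule that)
  qed (fact E ips0 H0_value off0 k_H0 span0 rep0 bound0)+
qed

section \<open>Tensor products\<close>

text \<open>The tensor product is realised as the reproducing kernel space on pairs (h, e) whose
  kernel is the product of the two inner products; a tensor t is the function (h, e) to <t, h tensor
  e>. Positivity of the kernel is the Schur product statement.\<close>

lemma tensor_product_exists:
  fixes H :: "'a::complex_vector hspace" and F :: "'f::complex_vector hspace"
  assumes H: "inner_product_space H" and F: "inner_product_space F"
  obtains T :: "('a \<times> 'f \<Rightarrow> complex) hspace" and \<tau> where "is_tensor_product H F T \<tau>"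
proof -
  let ?X = "hset H \<times> hset F"
  \<comment> \<open>The second index q, the one of the kernel function, stands in the linear slots;
    this makes \<open>\<tau>\<close> linear rather than conjugate-linear in both arguments.\<close>
  define g where "g p q = hip H (fst q) (fst p) * hip F (snd q) (snd p)" for p q :: "'a \<times> 'f"
  let ?K = "scalar_kernel g"
  have K: "is_kernel complex_hspace ?X ?K"
    unfolding is_kernel_def
  proof (intro conjI ballI allI impI)
    show "?K z w \<in> bounded_ops complex_hspace complex_hspace" for z w
      by (rule bounded_opsI[OF linear_opsI, where C = "cmod (g z w)"])
        (auto simp: scalar_kernel_def distrib_left scaleC_complex_def norm_mult)
    fix m :: nat and x and \<eta> :: "nat \<Rightarrow> complex"
    assume "\<forall>j<m. x j \<in> ?X \<and> \<eta> j \<in> hset complex_hspace"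
    then have x: "fst (x j) \<in> hset H" "snd (x j) \<in> hset F" if "j < m" for j
      using that by (auto simp: mem_Times_iff)
    \<comment> \<open>The coefficients \<eta> are absorbed into the vectors of \<open>F\<close>, so
      that \<open>?b\<close> is itself a Gram matrix and the other factor is the Gram matrix in
      \<open>H\<close>.\<close>
    let ?b = "\<lambda>q p. hip F (\<eta> q *\<^sub>C snd (x q)) (\<eta> p *\<^sub>C snd (x p))"
    have "(\<Sum>p<m. \<Sum>q<m. ?b q p * hip H (fst (x q)) (fst (x p))) \<in> \<real>\<^sub>\<ge>\<^sub>0"
    proof (rule Schur_product_nonneg[OF H])
      fix c :: "nat \<Rightarrow> complex"
      let ?v = "\<lambda>q. c q *\<^sub>C \<eta> q *\<^sub>C snd (x q)"
      have v: "?v q \<in> hset F" if "q < m" for q using x(2)[OF that] by (simp add: hset_scale[OF F])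
      have "(\<Sum>p<m. \<Sum>q<m. c q * cnj (c p) * ?b q p) = (\<Sum>p<m. \<Sum>q<m. hip F (?v q) (?v p))"
        using x(2) by (intro sum.cong refl) (simp add: hip_scale_left[OF F] hip_scale_right[OF F] hset_scale[OF F])
      also have "\<dots> = hip F (\<Sum>q<m. ?v q) (\<Sum>p<m. ?v p)"
        by (rule hip_sum_self[OF F, symmetric]) (use v in simp)
      also have "\<dots> \<in> \<real>\<^sub>\<ge>\<^sub>0"
        using hset_sum[OF F, of "{..<m}" ?v] v by (simp add: hip_self[OF F] del: of_real_power)
      finally show "(\<Sum>p<m. \<Sum>q<m. c q * cnj (c p) * ?b q p) \<in> \<real>\<^sub>\<ge>\<^sub>0" .
    qed (rule x)
    also have "(\<Sum>p<m. \<Sum>q<m. ?b q p * hip H (fst (x q)) (fst (x p)))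
        = (\<Sum>p<m. \<Sum>q<m. hip complex_hspace (?K (x p) (x q) (\<eta> q)) (\<eta> p))"
      using x by (intro sum.cong refl)
        (simp add: hip_scale_left[OF F] hip_scale_right[OF F] hset_scale[OF F] scalar_kernel_def g_def)
    finally show "(\<Sum>p<m. \<Sum>q<m. hip complex_hspace (?K (x p) (x q) (\<eta> q)) (\<eta> p)) \<in> \<real>\<^sub>\<ge>\<^sub>0" .
  qed
  obtain T where T: "is_rkhs complex_hspace ?X ?K T"
    using rkhs_exists[OF hilbert_complex K] by blast
  note rk = hilbert_complex K T
  define \<tau> where "\<tau> h e = kernel_fun ?X ?K (h, e) 1" for h e
  have \<tau>_apply: "\<tau> h e p = (if p \<in> ?X then g p (h, e) else 0)" for h e p
    by (simp add: \<tau>_def kernel_fun_def zero_ext_def scalar_kernel_def)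
  have \<tau>_mem: "\<tau> h e \<in> hset T" if "h \<in> hset H" "e \<in> hset F" for h e
    unfolding \<tau>_def using that by (intro kernel_fun_mem[OF rk]) auto
  have scale: "kernel_fun ?X ?K (h, e) \<eta> = \<eta> *\<^sub>C \<tau> h e" for h e \<eta>
    by (auto simp: \<tau>_def kernel_fun_def zero_ext_def scalar_kernel_def fun_eq_iff scaleC_fun_apply scaleC_complex_def)
  have "is_tensor_product H F T \<tau>"
    unfolding is_tensor_product_def
  proof (intro conjI ballI allI)
    show "hilbert_space T" by (rule rkhs_hilbert[OF rk])
    show "\<tau> (h + k) e = \<tau> h e + \<tau> k e" if "h \<in> hset H" "k \<in> hset H" "e \<in> hset F" for h k e
      using that by (auto simp: fun_eq_iff \<tau>_apply g_def hip_add_left[OF H] distrib_right)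
    show "\<tau> h (d + e) = \<tau> h d + \<tau> h e" if "h \<in> hset H" "d \<in> hset F" "e \<in> hset F" for h d e
      using that by (auto simp: fun_eq_iff \<tau>_apply g_def hip_add_left[OF F] distrib_left)
    show "\<tau> (a *\<^sub>C h) e = a *\<^sub>C \<tau> h e" "\<tau> h (a *\<^sub>C e) = a *\<^sub>C \<tau> h e" if "h \<in> hset H" "e \<in> hset F" for a h e
      using that by (auto simp: fun_eq_iff \<tau>_apply g_def hip_scale_left[OF F] hip_scale_left[OF H]
          scaleC_fun_apply scaleC_complex_def)
    show "hip T (\<tau> h d) (\<tau> k e) = hip H h k * hip F d e"
      if "h \<in> hset H" "k \<in> hset H" "d \<in> hset F" "e \<in> hset F" for h k d e
      using reproducing[OF rk \<tau>_mem[of h d], of "(k, e)" 1] that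
      by (simp add: \<tau>_def[of k e, symmetric] \<tau>_apply g_def)
    show "total_in T {\<tau> h e |h e. h \<in> hset H \<and> e \<in> hset F}"
      unfolding total_in_def
    proof (intro conjI ballI allI impI)
      show "{\<tau> h e |h e. h \<in> hset H \<and> e \<in> hset F} \<subseteq> hset T" using \<tau>_mem by blast
      have "(\<lambda>(w, \<eta>). kernel_fun ?X ?K w \<eta>) ` (?X \<times> hset complex_hspace)
          \<subseteq> cspan {\<tau> h e |h e. h \<in> hset H \<and> e \<in> hset F}"
      proof
        fix v assume "v \<in> (\<lambda>(w, \<eta>). kernel_fun ?X ?K w \<eta>) ` (?X \<times> hset complex_hspace)"
        then obtain h e \<eta> where v: "v = \<eta> *\<^sub>C \<tau> h e" "h \<in> hset H" "e \<in> hset F"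
          by (auto simp: scale)
        show "v \<in> cspan {\<tau> h e |h e. h \<in> hset H \<and> e \<in> hset F}"
          unfolding v(1) using v(2,3) by (intro complex_vector.span_scale complex_vector.span_base) blast
      qed
      then have "cspan ((\<lambda>(w, \<eta>). kernel_fun ?X ?K w \<eta>) ` (?X \<times> hset complex_hspace))
          \<subseteq> cspan {\<tau> h e |h e. h \<in> hset H \<and> e \<in> hset F}"
        by (rule complex_vector.span_minimal) (rule complex_vector.subspace_span)
      then show "\<exists>y\<in>cspan {\<tau> h e |h e. h \<in> hset H \<and> e \<in> hset F}. hnorm T (x - y) < \<epsilon>"
        if "x \<in> hset T" "\<epsilon> > 0" for x \<epsilon>
        using rkhs_total[OF rk] that unfolding total_in_def by blast
    qed
  qed
  then show ?thesis by (rule that)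
qed

context
  fixes H :: "'a::complex_vector hspace" and F :: "'f::complex_vector hspace"
    and T :: "'t::complex_vector hspace" and \<tau> :: "'a \<Rightarrow> 'f \<Rightarrow> 't"
  assumes H: "hilbert_space H" and F: "hilbert_space F" and T: "is_tensor_product H F T \<tau>"
begin

lemma tensor_hilbert: "hilbert_space T"
  using T by (simp add: is_tensor_product_def)

lemma tensor_total: "total_in T ((\<lambda>(h, e). \<tau> h e) ` (hset H \<times> hset F))"
proof -
  have "(\<lambda>(h, e). \<tau> h e) ` (hset H \<times> hset F) = {\<tau> h e |h e. h \<in> hset H \<and> e \<in> hset F}" by auto
  then show ?thesis using T by (simp add: is_tensor_product_def)
qed

lemma tensor_mem: "h \<in> hset H \<Longrightarrow> e \<in> hset F \<Longrightarrow> \<tau> h e \<in> hset T"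
  using tensor_total by (auto simp: total_in_def)

lemma tensor_hip:
  "h \<in> hset H \<Longrightarrow> k \<in> hset H \<Longrightarrow> d \<in> hset F \<Longrightarrow> e \<in> hset F \<Longrightarrow>
    hip T (\<tau> h d) (\<tau> k e) = hip H h k * hip F d e"
  using T by (simp add: is_tensor_product_def)

lemma tensor_add_left: "h \<in> hset H \<Longrightarrow> k \<in> hset H \<Longrightarrow> e \<in> hset F \<Longrightarrow> \<tau> (h + k) e = \<tau> h e + \<tau> k e"
  and tensor_add_right: "h \<in> hset H \<Longrightarrow> d \<in> hset F \<Longrightarrow> e \<in> hset F \<Longrightarrow> \<tau> h (d + e) = \<tau> h d + \<tau> h e"
  and tensor_scale_left: "h \<in> hset H \<Longrightarrow> e \<in> hset F \<Longrightarrow> \<tau> (a *\<^sub>C h) e = a *\<^sub>C \<tau> h e"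
  and tensor_scale_right: "h \<in> hset H \<Longrightarrow> e \<in> hset F \<Longrightarrow> \<tau> h (a *\<^sub>C e) = a *\<^sub>C \<tau> h e"
  using T by (simp_all add: is_tensor_product_def)

lemma tensor_norm:
  assumes "h \<in> hset H" "e \<in> hset F"
  shows "hnorm T (\<tau> h e) = hnorm H h * hnorm F e"
  using assms hip_self[OF hilbert_space_ips[OF H]] hip_self[OF hilbert_space_ips[OF F]]
    hnorm_nonneg[OF hilbert_space_ips[OF H]] hnorm_nonneg[OF hilbert_space_ips[OF F]]
  by (simp add: hnorm_def[of T] tensor_hip real_sqrt_mult flip: of_real_mult)

text \<open>Boundedness of \<open>A \<otimes> I\<close> by \<open>\<parallel>A\<parallel>\<close>: the Schur product of the positive matrices with
  entries \<open>C\<^sup>2 \<langle>h\<^sub>q, h\<^sub>p\<rangle> - \<langle>A h\<^sub>q, A h\<^sub>p\<rangle>\<close> and \<open>\<langle>e\<^sub>q, e\<^sub>p\<rangle>\<close> is positive.\<close>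

lemma tensor_op_id:
  assumes A: "A \<in> bounded_ops H H"
  shows "tensor_op H F T \<tau> A (id_op F) \<in> bounded_ops T T"
    and "h \<in> hset H \<Longrightarrow> e \<in> hset F \<Longrightarrow> tensor_op H F T \<tau> A (id_op F) (\<tau> h e) = \<tau> (A h) e"
proof -
  note ipsH = hilbert_space_ips[OF H] and ipsF = hilbert_space_ips[OF F] and ipsT = hilbert_space_ips[OF tensor_hilbert]
  note lin = bounded_ops_linear[OF A]
  obtain C where C: "C > 0" "\<And>x. x \<in> hset H \<Longrightarrow> hnorm H (A x) \<le> C * hnorm H x"
    using bounded_ops_bound[OF A ipsH] by metis
  let ?x = "\<lambda>(h, e). \<tau> h e" and ?y = "\<lambda>(h, e). \<tau> (A h) e" and ?I = "hset H \<times> hset F"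
  obtain R where R: "R \<in> bounded_ops T T" "\<And>i. i \<in> ?I \<Longrightarrow> R (?x i) = ?y i"
  proof (rule extend_generators[OF ipsT tensor_hilbert, of C ?x ?I ?y])
    show "?y i \<in> hset T" if "i \<in> ?I" for i
      using that by (auto intro!: tensor_mem op_mem[OF lin])
    fix a b assume "generated_relation ?x ?y ?I a b"
    from generated_relation_sum[OF this]
    obtain m :: nat and c i where i: "\<forall>j<m. i j \<in> ?I" and a: "a = (\<Sum>j<m. c j *\<^sub>C ?x (i j))"
      and b: "b = (\<Sum>j<m. c j *\<^sub>C ?y (i j))"
      by (elim exE conjE) (rule that; assumption)
    \<comment> \<open>Scalars are moved to the second factor, turning the combination into a plain
      sum of elementary tensors on which the operator acts in the first factor only.\<close>
    let ?h = "\<lambda>j. fst (i j)" and ?e = "\<lambda>j. c j *\<^sub>C snd (i j)"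
    have mem: "?h j \<in> hset H" "?e j \<in> hset F" "A (?h j) \<in> hset H" if "j < m" for j
      using i that by (auto simp: mem_Times_iff hset_scale[OF ipsF] intro!: op_mem[OF lin])
    have a': "a = (\<Sum>j<m. \<tau> (?h j) (?e j))" and b': "b = (\<Sum>j<m. \<tau> (A (?h j)) (?e j))"
      unfolding a b using i op_mem[OF lin]
      by (auto intro!: sum.cong simp: tensor_scale_right case_prod_beta mem_Times_iff)
    have gram: "hip T (\<Sum>j<m. \<tau> (f j) (?e j)) (\<Sum>j<m. \<tau> (f j) (?e j))
        = (\<Sum>p<m. \<Sum>q<m. hip H (f q) (f p) * hip F (?e q) (?e p))" if f: "\<And>j. j < m \<Longrightarrow> f j \<in> hset H" for f
    proof -
      have t: "\<tau> (f j) (?e j) \<in> hset T" if "j < m" for j by (intro tensor_mem f mem that)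
      have "hip T (\<Sum>j<m. \<tau> (f j) (?e j)) (\<Sum>j<m. \<tau> (f j) (?e j))
          = (\<Sum>p<m. \<Sum>q<m. hip T (\<tau> (f q) (?e q)) (\<tau> (f p) (?e p)))"
        by (rule hip_sum_self[OF ipsT]) (use t in simp)
      then show ?thesis using f mem by (simp add: tensor_hip)
    qed
    have ga: "hip T a a = (\<Sum>p<m. \<Sum>q<m. hip H (?h q) (?h p) * hip F (?e q) (?e p))"
      unfolding a' by (rule gram) (rule mem(1))
    have gb: "hip T b b = (\<Sum>p<m. \<Sum>q<m. hip H (A (?h q)) (A (?h p)) * hip F (?e q) (?e p))"
      unfolding b' by (rule gram) (rule mem(3))
    let ?b = "\<lambda>q p. of_real (C\<^sup>2) * hip H (?h q) (?h p) - hip H (A (?h q)) (A (?h p))"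
    have "(\<Sum>p<m. \<Sum>q<m. ?b q p * hip F (?e q) (?e p)) \<in> \<real>\<^sub>\<ge>\<^sub>0"
    proof (rule Schur_product_nonneg[OF ipsF])
      show "?e j \<in> hset F" if "j < m" for j by (rule mem(2)[OF that])
      fix d :: "nat \<Rightarrow> complex"
      let ?v = "\<Sum>q<m. d q *\<^sub>C ?h q"
      have v: "?v \<in> hset H" using mem by (intro hset_sum[OF ipsH] hset_scale[OF ipsH]) auto
      have A_sum: "A (\<Sum>q\<in>J. d q *\<^sub>C ?h q) = (\<Sum>q\<in>J. d q *\<^sub>C A (?h q))" if "J \<subseteq> {..<m}" "finite J" for J
        using that(2,1)
      proof (induction J rule: finite_induct)
        case (insert x J)
        have "(\<Sum>q\<in>J. d q *\<^sub>C ?h q) \<in> hset H"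
          using mem insert by (intro hset_sum[OF ipsH] hset_scale[OF ipsH]) auto
        then show ?case
          using insert mem by (simp add: op_add[OF lin] op_scale[OF lin] hset_scale[OF ipsH])
      qed (simp add: op_zero[OF lin ipsH])
      have expand: "hip H (\<Sum>q<m. d q *\<^sub>C f q) (\<Sum>p<m. d p *\<^sub>C f p)
          = (\<Sum>p<m. \<Sum>q<m. d q * cnj (d p) * hip H (f q) (f p))" if f: "\<And>j. j < m \<Longrightarrow> f j \<in> hset H" for f
      proof -
        have "hip H (\<Sum>q<m. d q *\<^sub>C f q) (\<Sum>p<m. d p *\<^sub>C f p) = (\<Sum>p<m. \<Sum>q<m. hip H (d q *\<^sub>C f q) (d p *\<^sub>C f p))"
          by (rule hip_sum_self[OF ipsH]) (use f in \<open>simp add: hset_scale[OF ipsH]\<close>)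
        then show ?thesis
          using f by (simp add: hip_scale_left[OF ipsH] hip_scale_right[OF ipsH] hset_scale[OF ipsH] mult_ac)
      qed
      have "(\<Sum>p<m. \<Sum>q<m. d q * cnj (d p) * ?b q p)
          = of_real (C\<^sup>2) * (\<Sum>p<m. \<Sum>q<m. d q * cnj (d p) * hip H (?h q) (?h p))
            - (\<Sum>p<m. \<Sum>q<m. d q * cnj (d p) * hip H (A (?h q)) (A (?h p)))"
        unfolding sum_distrib_left sum_subtractf[symmetric]
        by (intro sum.cong refl) (simp add: algebra_simps)
      also have "\<dots> = of_real (C\<^sup>2) * hip H ?v ?v - hip H (A ?v) (A ?v)"
        using expand[of ?h] expand[of "\<lambda>j. A (?h j)"] mem A_sum[of "{..<m}"] by simp
      also have "\<dots> = of_real ((C * hnorm H ?v)\<^sup>2 - (hnorm H (A ?v))\<^sup>2)"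
        by (simp add: hip_self[OF ipsH] v op_mem[OF lin] power_mult_distrib)
      also have "\<dots> \<in> \<real>\<^sub>\<ge>\<^sub>0"
      proof -
        have "(hnorm H (A ?v))\<^sup>2 \<le> (C * hnorm H ?v)\<^sup>2"
          by (intro power_mono C v hnorm_nonneg[OF ipsH] op_mem[OF lin])
        then show ?thesis by (simp only: nonneg_Reals_of_real_iff diff_ge_0_iff_ge)
      qed
      finally show "(\<Sum>p<m. \<Sum>q<m. d q * cnj (d p) * ?b q p) \<in> \<real>\<^sub>\<ge>\<^sub>0" .
    qed
    also have "(\<Sum>p<m. \<Sum>q<m. ?b q p * hip F (?e q) (?e p)) = of_real (C\<^sup>2) * hip T a a - hip T b b"
      unfolding ga gb sum_distrib_left sum_subtractf[symmetric]
      by (intro sum.cong refl) (simp add: algebra_simps)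
    finally have "of_real (C\<^sup>2) * hip T a a - hip T b b \<in> \<real>\<^sub>\<ge>\<^sub>0" .
    moreover have ab: "a \<in> hset T" "b \<in> hset T"
      unfolding a' b' using mem by (auto intro!: hset_sum[OF ipsT] tensor_mem)
    ultimately have "(hnorm T b)\<^sup>2 \<le> (C * hnorm T a)\<^sup>2"
      by (simp add: complex_nonneg_Reals_iff hip_self[OF ipsT] power_mult_distrib)
    then show "hnorm T b \<le> C * hnorm T a"
      by (rule power2_le_imp_le) (use C ab in \<open>simp add: hnorm_nonneg[OF ipsT]\<close>)
  qed (use C tensor_total in auto)
  have ex: "R \<in> bounded_ops T T \<and> (\<forall>h\<in>hset H. \<forall>e\<in>hset F. R (\<tau> h e) = \<tau> (A h) (id_op F e))"
    using R by (auto simp: id_op_def zero_ext_def)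
  have "tensor_op H F T \<tau> A (id_op F) = R"
    unfolding tensor_op_def
  proof (rule the_equality, rule ex)
    fix R' assume R': "R' \<in> bounded_ops T T \<and> (\<forall>h\<in>hset H. \<forall>e\<in>hset F. R' (\<tau> h e) = \<tau> (A h) (id_op F e))"
    show "R' = R"
      by (rule bounded_ops_eq_on_total[OF tensor_hilbert ipsT _ _ tensor_total]) (use R' ex in auto)
  qed
  then show "tensor_op H F T \<tau> A (id_op F) \<in> bounded_ops T T"
    and "h \<in> hset H \<Longrightarrow> e \<in> hset F \<Longrightarrow> tensor_op H F T \<tau> A (id_op F) (\<tau> h e) = \<tau> (A h) e"
    using R by auto
qed

end

lemma zero_ext_apply: "x \<in> A \<Longrightarrow> zero_ext A f x = f x"
  by (simp add: zero_ext_def)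

text \<open>The adjoint of this map cuts a tensor along e and returns a vector of \<open>H\<close>;
  such slices reduce questions about joint eigenvectors of the tensor operators to the space
  \<open>H\<close>.\<close>

lemma tensor_left_bounded:
  assumes H: "hilbert_space H" and F: "hilbert_space F" and T: "is_tensor_product H F T \<tau>" and e: "e \<in> hset F"
  shows "zero_ext (hset H) (\<lambda>h. \<tau> h e) \<in> bounded_ops H T"
  by (rule bounded_opsI[OF linear_opsI, where C = "hnorm F e"])
    (use e in \<open>auto simp: zero_ext_def tensor_mem[OF H F T] tensor_add_left[OF H F T] tensor_scale_left[OF H F T]
      tensor_norm[OF H F T] hset_add[OF hilbert_space_ips[OF H]] hset_scale[OF hilbert_space_ips[OF H]]\<close>)

lemma tensor_right_bounded:
  assumes H: "hilbert_space H" and F: "hilbert_space F" and T: "is_tensor_product H F T \<tau>" and h: "h \<in> hset H"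
  shows "zero_ext (hset F) (\<tau> h) \<in> bounded_ops F T"
  by (rule bounded_opsI[OF linear_opsI, where C = "hnorm H h"])
    (use h in \<open>auto simp: zero_ext_def tensor_mem[OF H F T] tensor_add_right[OF H F T] tensor_scale_right[OF H F T]
      tensor_norm[OF H F T] hset_add[OF hilbert_space_ips[OF F]] hset_scale[OF hilbert_space_ips[OF F]]\<close>)

section \<open>Good kernels\<close>

abbreviation (input) kernel_at :: "'x set \<Rightarrow> ('x \<Rightarrow> 'x \<Rightarrow> complex) \<Rightarrow> 'x \<Rightarrow> 'x \<Rightarrow> complex"
  where "kernel_at \<Omega> g w \<equiv> zero_ext \<Omega> (\<lambda>z. g z w)"

context
  fixes \<Omega> :: "(complex ^ 'n) set" and g :: "complex ^ 'n \<Rightarrow> complex ^ 'n \<Rightarrow> complex"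
    and Hg :: "(complex ^ 'n \<Rightarrow> complex) hspace"
  assumes good: "good_kernel \<Omega> g Hg"
begin

lemma good_rkhs:
  shows good_is_kernel: "is_kernel complex_hspace \<Omega> (scalar_kernel g)"
    and good_is_rkhs: "is_rkhs complex_hspace \<Omega> (scalar_kernel g) Hg"
    and good_module: "is_module Hg"
  using good by (auto simp: good_kernel_def)

lemma good_hilbert: "hilbert_space Hg"
  by (rule rkhs_hilbert[OF hilbert_complex good_is_kernel good_is_rkhs])

lemma scalar_kernel_fun: "kernel_fun \<Omega> (scalar_kernel g) w \<eta> = \<eta> *\<^sub>C kernel_at \<Omega> g w"
  by (auto simp: kernel_fun_def zero_ext_def scalar_kernel_def fun_eq_iff scaleC_fun_apply scaleC_complex_def)

lemma good_mem: "w \<in> \<Omega> \<Longrightarrow> kernel_at \<Omega> g w \<in> hset Hg"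
  using kernel_fun_mem[OF hilbert_complex good_is_kernel good_is_rkhs, of w 1]
  by (simp add: scalar_kernel_fun scaleC_one)

lemma good_hip: "w \<in> \<Omega> \<Longrightarrow> z \<in> \<Omega> \<Longrightarrow> hip Hg (kernel_at \<Omega> g w) (kernel_at \<Omega> g z) = g z w"
  using kernel_fun_hip[OF hilbert_complex good_is_kernel good_is_rkhs, of z w 1 1]
  by (simp add: scalar_kernel_fun scaleC_one scalar_kernel_def)

lemma good_M_bounded: "M_op Hg j \<in> bounded_ops Hg Hg"
  by (rule M_op_bounded(1)[OF hilbert_complex good_is_kernel good_is_rkhs good_module])

lemma good_M_adj: "w \<in> \<Omega> \<Longrightarrow> adj Hg Hg (M_op Hg j) (kernel_at \<Omega> g w) = cnj (w $ j) *\<^sub>C kernel_at \<Omega> g w"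
  using M_op_bounded(2)[OF hilbert_complex good_is_kernel good_is_rkhs good_module, of w 1]
  by (simp add: scalar_kernel_fun scaleC_one)

lemma good_point:
  obtains w0 where "w0 \<in> \<Omega>" "\<And>w. w \<in> \<Omega> \<Longrightarrow> hip Hg (kernel_at \<Omega> g w0) (kernel_at \<Omega> g w) = 1"
proof -
  obtain w0 where "w0 \<in> \<Omega>" "\<forall>z\<in>\<Omega>. g z w0 = 1"
    using good by (auto simp: good_kernel_def)
  then show ?thesis using that[of w0] by (simp add: good_hip)
qed

text \<open>The kernel function at w0 has norm 1 because g(w0, w0) = 1, and it pairs to 1 with every
  other kernel function; Cauchy-Schwarz then bounds the norm of the latter from below.\<close>

lemma good_diag_ge_1:
  assumes z: "z \<in> \<Omega>"
  shows "\<exists>c\<ge>1. g z z = of_real c"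
proof -
  note ips = hilbert_space_ips[OF good_hilbert]
  obtain w0 where w0: "w0 \<in> \<Omega>" "\<And>w. w \<in> \<Omega> \<Longrightarrow> hip Hg (kernel_at \<Omega> g w0) (kernel_at \<Omega> g w) = 1"
    using good_point by metis
  have "(hnorm Hg (kernel_at \<Omega> g w0))\<^sup>2 = 1"
    using w0 hnorm_sq[OF ips good_mem[OF w0(1)]] by simp
  then have n0: "hnorm Hg (kernel_at \<Omega> g w0) = 1"
    using hnorm_nonneg[OF ips good_mem[OF w0(1)]] by (simp add: power2_eq_1_iff)
  have "1 \<le> hnorm Hg (kernel_at \<Omega> g z)"
    using Cauchy_Schwarz[OF ips good_mem[OF w0(1)] good_mem[OF z]] w0(2)[OF z] n0 by simp
  then have "1 \<le> (hnorm Hg (kernel_at \<Omega> g z))\<^sup>2" by simp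
  moreover have "g z z = of_real ((hnorm Hg (kernel_at \<Omega> g z))\<^sup>2)"
    using good_hip[OF z z] hip_self[OF ips good_mem[OF z]] by simp
  ultimately show ?thesis by blast
qed

text \<open>Every slice of t along some f is a joint eigenvector in \<open>Hg\<close>, hence a
  multiple of g(., w) by goodness. The multiple depends on f as the conjugate of <f, e>'s
  conjugate-linear counterpart, that is, its conjugate is <f, e> for a single vector e, which
  pairing with g(., w0) identifies.\<close>

lemma joint_eigenvector:
  fixes F :: "'f::complex_vector hspace"
  assumes F: "hilbert_space F" and T: "is_tensor_product Hg F T \<tau>"
    and w0: "w0 \<in> \<Omega>" "\<And>w. w \<in> \<Omega> \<Longrightarrow> hip Hg (kernel_at \<Omega> g w0) (kernel_at \<Omega> g w) = 1"
    and w: "w \<in> \<Omega>" and t: "t \<in> hset T"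
    and eigen: "\<And>i. tensor_op Hg F T \<tau> (adj Hg Hg (M_op Hg i)) (id_op F) t = cnj (w $ i) *\<^sub>C t"
  shows "t = \<tau> (kernel_at \<Omega> g w) (adj F T (zero_ext (hset F) (\<tau> (kernel_at \<Omega> g w0))) t)"
proof -
  note H = good_hilbert
  note ipsH = hilbert_space_ips[OF H] and ipsF = hilbert_space_ips[OF F]
  note tens = H F T
  note hT = tensor_hilbert[OF tens]
  note ipsT = hilbert_space_ips[OF hT]
  let ?J = "zero_ext (hset F) (\<tau> (kernel_at \<Omega> g w0))"
  let ?e = "adj F T ?J t"
  have J: "?J \<in> bounded_ops F T" by (rule tensor_right_bounded[OF tens good_mem[OF w0(1)]])
  have e: "?e \<in> hset F" by (rule adj_mem[OF F ipsT J t])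
  let ?A = "\<lambda>i. adj Hg Hg (M_op Hg i)"
  let ?R = "\<lambda>i. tensor_op Hg F T \<tau> (?A i) (id_op F)"
  have A: "?A i \<in> bounded_ops Hg Hg" for i
    by (rule adj_bounded[OF H ipsH good_M_bounded])
  have R: "?R i \<in> bounded_ops T T" "\<And>h e. h \<in> hset Hg \<Longrightarrow> e \<in> hset F \<Longrightarrow> ?R i (\<tau> h e) = \<tau> (?A i h) e" for i
    using tensor_op_id[OF tens A] by blast+
  have M_mem: "M_op Hg i h \<in> hset Hg" if "h \<in> hset Hg" for i h
    by (rule op_mem[OF bounded_ops_linear[OF good_M_bounded] that])
  have A_mem: "?A i h \<in> hset Hg" if "h \<in> hset Hg" for i h
    by (rule op_mem[OF bounded_ops_linear[OF A] that])
  \<comment> \<open>The adjoint of (adjoint of M_i) tensor I acts as M_i tensor I; on elementary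
    tensors this is read off from the factors.\<close>
  have R_adj: "adj T T (?R i) (\<tau> h f) = \<tau> (M_op Hg i h) f" if h: "h \<in> hset Hg" and f: "f \<in> hset F" for i h f
  proof (rule total_hip_ext[OF ipsT tensor_total[OF tens]])
    show "adj T T (?R i) (\<tau> h f) \<in> hset T"
      by (rule adj_mem[OF hT ipsT R(1) tensor_mem[OF tens h f]])
    show "\<tau> (M_op Hg i h) f \<in> hset T" by (intro tensor_mem[OF tens] M_mem h f)
    fix s assume "s \<in> (\<lambda>(h, e). \<tau> h e) ` (hset Hg \<times> hset F)"
    then obtain k d where s: "k \<in> hset Hg" "d \<in> hset F" "s = \<tau> k d" by auto
    have "hip T s (adj T T (?R i) (\<tau> h f)) = hip T (\<tau> (?A i k) d) (\<tau> h f)"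
      using hip_adj[OF hT ipsT R(1) tensor_mem[OF tens h f] tensor_mem[OF tens s(1,2)], of i] s
      by (simp add: R(2))
    also have "\<dots> = hip Hg (?A i k) h * hip F d f"
      by (rule tensor_hip[OF tens A_mem[OF s(1)] h s(2) f])
    also have "\<dots> = hip Hg k (M_op Hg i h) * hip F d f"
      using hip_adj_left[OF H ipsH good_M_bounded s(1) h] by simp
    also have "\<dots> = hip T s (\<tau> (M_op Hg i h) f)"
      by (simp add: s tensor_hip[OF tens s(1) M_mem[OF h] s(2) f])
    finally show "hip T s (adj T T (?R i) (\<tau> h f)) = hip T s (\<tau> (M_op Hg i h) f)" .
  qed
  \<comment> \<open>\<open>u\<close> is the slice of t along f. It inherits the eigenvalue equations
    because multiplication by a coordinate acts on the first factor only.\<close>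
  have slice: "hip T (\<tau> h f) t = hip T (\<tau> h f) (\<tau> (kernel_at \<Omega> g w) ?e)" if h: "h \<in> hset Hg" and f: "f \<in> hset F" for h f
  proof -
    let ?L = "zero_ext (hset Hg) (\<lambda>h. \<tau> h f)"
    have L: "?L \<in> bounded_ops Hg T" by (rule tensor_left_bounded[OF tens f])
    define u where "u = adj Hg T ?L t"
    have u: "u \<in> hset Hg" unfolding u_def by (rule adj_mem[OF H ipsT L t])
    have hip_u: "hip Hg k u = hip T (\<tau> k f) t" if "k \<in> hset Hg" for k
      using hip_adj[OF H ipsT L t that] that by (simp add: u_def zero_ext_def)
    have "?A i u = cnj (w $ i) *\<^sub>C u" for i
    proof (rule hip_ext_right[OF ipsH A_mem[OF u] hset_scale[OF ipsH u]])
      fix k assume k: "k \<in> hset Hg"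
      have "hip Hg k (?A i u) = hip Hg (M_op Hg i k) u"
        by (rule hip_adj[OF H ipsH good_M_bounded u k, symmetric])
      also have "\<dots> = hip T (adj T T (?R i) (\<tau> k f)) t"
        by (simp add: hip_u[OF M_mem[OF k]] R_adj[OF k f])
      also have "\<dots> = hip T (\<tau> k f) (?R i t)"
        by (rule hip_adj_left[OF hT ipsT R(1) tensor_mem[OF tens k f] t])
      also have "\<dots> = w $ i * hip Hg k u"
        using hip_scale_right[OF ipsT tensor_mem[OF tens k f] t] by (simp add: eigen hip_u[OF k])
      also have "\<dots> = hip Hg k (cnj (w $ i) *\<^sub>C u)"
        using hip_scale_right[OF ipsH k u] by simp
      finally show "hip Hg k (?A i u) = hip Hg k (cnj (w $ i) *\<^sub>C u)" .
    qed
    then have "u \<in> (\<Inter>j. {f \<in> hset Hg. ?A j f - cnj (w $ j) *\<^sub>C f = 0})"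
      using u by simp
    then obtain c where c: "u = c *\<^sub>C kernel_at \<Omega> g w"
      using good w unfolding good_kernel_def by blast
    \<comment> \<open>The normalisation <g(., w0), g(., w)> = 1 reads off the coefficient;
      conjugation appears because u is in the second slot.\<close>
    have "cnj c = hip Hg (kernel_at \<Omega> g w0) u"
      using w0(2)[OF w] by (simp add: c hip_scale_right[OF ipsH good_mem[OF w0(1)] good_mem[OF w]])
    also have "\<dots> = hip F f ?e"
      using hip_adj[OF F ipsT J t f] f by (simp add: hip_u[OF good_mem[OF w0(1)]] zero_ext_apply)
    finally have c_eq: "cnj c = hip F f ?e" .
    have "hip T (\<tau> h f) t = cnj c * hip Hg h (kernel_at \<Omega> g w)"
      using hip_u[OF h] by (simp add: c hip_scale_right[OF ipsH h good_mem[OF w]])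
    also have "\<dots> = hip T (\<tau> h f) (\<tau> (kernel_at \<Omega> g w) ?e)"
      by (simp add: c_eq tensor_hip[OF tens h good_mem[OF w] f e])
    finally show ?thesis .
  qed
  show ?thesis
    by (rule total_hip_ext[OF ipsT tensor_total[OF tens] t tensor_mem[OF tens good_mem[OF w] e]])
      (use slice in auto)
qed

end

section \<open>Dilations and factorizations of kernels\<close>

context
  fixes \<Omega> :: "(complex ^ 'n) set"
    and E :: "'e::complex_vector hspace"
    and g :: "complex ^ 'n \<Rightarrow> complex ^ 'n \<Rightarrow> complex"
    and Hg :: "(complex ^ 'n \<Rightarrow> complex) hspace"
    and K :: "complex ^ 'n \<Rightarrow> complex ^ 'n \<Rightarrow> 'e \<Rightarrow> 'e"
    and HK :: "(complex ^ 'n \<Rightarrow> 'e) hspace"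
  assumes \<Omega>: "open \<Omega>" and E: "hilbert_space E" and good: "good_kernel \<Omega> g Hg"
    and K: "is_kernel E \<Omega> K" and HK: "is_rkhs E \<Omega> K HK" and module: "is_module HK"
    and holomorphic: "\<forall>f\<in>hset HK. holomorphic_into (hset E) (hnorm E) \<Omega> f"
begin

lemmas HK_holomorphic = holomorphic[rule_format]

lemma dilates_imp_factors:
  fixes F :: "'f::complex_vector hspace"
  assumes F: "hilbert_space F" and dil: "dilates HK Hg F"
  shows "factors E \<Omega> K g F"
proof -
  note rk = E K HK
  note hK = rkhs_hilbert[OF rk] and hG = good_hilbert[OF good]
  note ipsE = hilbert_space_ips[OF E] and ipsF = hilbert_space_ips[OF F] and ipsK = hilbert_space_ips[OF hK]
    and ipsG = hilbert_space_ips[OF hG]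
  obtain T :: "((complex ^ 'n \<Rightarrow> complex) \<times> 'f \<Rightarrow> complex) hspace" and \<tau> V
    where T: "is_tensor_product Hg F T \<tau>" and V: "V \<in> isometries HK T"
      and intertwines: "\<And>i. tensor_op Hg F T \<tau> (adj Hg Hg (M_op Hg i)) (id_op F) \<circ> V = V \<circ> adj HK HK (M_op HK i)"
    using dil unfolding dilates_def by blast
  note tens = hG F T
  note hT = tensor_hilbert[OF tens]
  note ipsT = hilbert_space_ips[OF hT]
  note Vb = isometries_bounded[OF V]
  note Vlin = bounded_ops_linear[OF Vb]
  obtain w0 where w0: "w0 \<in> \<Omega>" "\<And>w. w \<in> \<Omega> \<Longrightarrow> hip Hg (kernel_at \<Omega> g w0) (kernel_at \<Omega> g w) = 1"
    using good_point[OF good] by metis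
  let ?k = "kernel_fun \<Omega> K"
  let ?J = "zero_ext (hset F) (\<tau> (kernel_at \<Omega> g w0))"
  have J: "?J \<in> bounded_ops F T" by (rule tensor_right_bounded[OF tens good_mem[OF good w0(1)]])
  have J_mem: "?J f \<in> hset T" if "f \<in> hset F" for f by (rule op_mem[OF bounded_ops_linear[OF J] that])
  \<comment> \<open>The future adjoint of \<Phi>(w) applied to \<eta>, available before \<Phi>
    itself is defined.\<close>
  define a where "a w \<eta> = adj F T ?J (V (?k w \<eta>))" for w \<eta>
  have k_mem: "?k w \<eta> \<in> hset HK" if "w \<in> \<Omega>" "\<eta> \<in> hset E" for w \<eta>
    by (rule kernel_fun_mem[OF rk that])
  have Vk_mem: "V (?k w \<eta>) \<in> hset T" if "w \<in> \<Omega>" "\<eta> \<in> hset E" for w \<eta>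
    by (rule op_mem[OF Vlin k_mem[OF that]])
  have a_mem: "a w \<eta> \<in> hset F" if "w \<in> \<Omega>" "\<eta> \<in> hset E" for w \<eta>
    unfolding a_def by (rule adj_mem[OF F ipsT J Vk_mem[OF that]])
  have Vk: "V (?k w \<eta>) = \<tau> (kernel_at \<Omega> g w) (a w \<eta>)" if w: "w \<in> \<Omega>" and \<eta>: "\<eta> \<in> hset E" for w \<eta>
    unfolding a_def
  proof (rule joint_eigenvector[OF good F T w0 w Vk_mem[OF w \<eta>]])
    fix i
    have "tensor_op Hg F T \<tau> (adj Hg Hg (M_op Hg i)) (id_op F) (V (?k w \<eta>)) = V (adj HK HK (M_op HK i) (?k w \<eta>))"
      using fun_cong[OF intertwines[of i], of "?k w \<eta>"] by simp
    also have "\<dots> = cnj (w $ i) *\<^sub>C V (?k w \<eta>)"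
      by (simp add: M_op_bounded(2)[OF rk module w \<eta>] op_scale[OF Vlin k_mem[OF w \<eta>]])
    finally show "tensor_op Hg F T \<tau> (adj Hg Hg (M_op Hg i)) (id_op F) (V (?k w \<eta>)) = cnj (w $ i) *\<^sub>C V (?k w \<eta>)" .
  qed
  \<comment> \<open>\<open>U\<close> sends f to a genuine element of the space of K, so holomorphy
    of \<Phi>(w) f = (U f)(w) is that of an element of the module.\<close>
  define U where "U = adj HK T V \<circ> ?J"
  have adjV: "adj HK T V \<in> bounded_ops T HK" by (rule adj_bounded[OF hK ipsT Vb])
  have U: "U \<in> bounded_ops F HK"
    unfolding U_def by (rule bounded_ops_comp[OF adjV J ipsF ipsT ipsK])
  note U_mem = op_mem[OF bounded_ops_linear[OF U]]
  define \<Phi> where "\<Phi> w = eval_op HK w \<circ> U" for w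
  have \<Phi>: "\<Phi> w \<in> bounded_ops F E" if "w \<in> \<Omega>" for w
    unfolding \<Phi>_def by (rule bounded_ops_comp[OF eval_op_bounded[OF rk that] U ipsF ipsK ipsE])
  have \<Phi>_apply: "\<Phi> w f = U f w" if "f \<in> hset F" for w f
    using U_mem[OF that] by (simp add: \<Phi>_def eval_op_def zero_ext_def)
  have adj_\<Phi>: "adj F E (\<Phi> w) \<eta> = a w \<eta>" if w: "w \<in> \<Omega>" and \<eta>: "\<eta> \<in> hset E" for w \<eta>
  proof (rule adj_eqI[OF ipsF \<eta> a_mem[OF w \<eta>]])
    fix f assume f: "f \<in> hset F"
    have "hip E (\<Phi> w f) \<eta> = hip HK (U f) (?k w \<eta>)"
      by (simp add: \<Phi>_apply[OF f] reproducing[OF rk U_mem[OF f] w \<eta>])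
    also have "\<dots> = hip T (?J f) (V (?k w \<eta>))"
      using hip_adj_left[OF hK ipsT Vb J_mem[OF f] k_mem[OF w \<eta>]] by (simp add: U_def)
    also have "\<dots> = hip F f (a w \<eta>)"
      unfolding a_def by (rule hip_adj[OF F ipsT J Vk_mem[OF w \<eta>] f])
    finally show "hip E (\<Phi> w f) \<eta> = hip F f (a w \<eta>)" .
  qed
  have "K z w \<eta> = g z w *\<^sub>C \<Phi> z (adj F E (\<Phi> w) \<eta>)" if z: "z \<in> \<Omega>" and w: "w \<in> \<Omega>" for z w \<eta>
  proof (cases "\<eta> \<in> hset E")
    case True
    note \<Phi>_mem = op_mem[OF bounded_ops_linear[OF \<Phi>[OF z]] a_mem[OF w True]]
    show ?thesis
      unfolding adj_\<Phi>[OF w True]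
    proof (rule hip_ext[OF ipsE kernel_mem[OF rk z w True] hset_scale[OF ipsE \<Phi>_mem]])
      fix \<xi> assume \<xi>: "\<xi> \<in> hset E"
      have "hip E (K z w \<eta>) \<xi> = hip HK (?k w \<eta>) (?k z \<xi>)"
        by (rule kernel_fun_hip[OF rk z w True \<xi>, symmetric])
      also have "\<dots> = hip T (V (?k w \<eta>)) (V (?k z \<xi>))"
        by (rule isometry_hip[OF ipsK ipsT V k_mem[OF w True] k_mem[OF z \<xi>], symmetric])
      also have "\<dots> = g z w * hip F (a w \<eta>) (a z \<xi>)"
        by (simp add: Vk[OF w True] Vk[OF z \<xi>] good_hip[OF good w z]
            tensor_hip[OF tens good_mem[OF good w] good_mem[OF good z] a_mem[OF w True] a_mem[OF z \<xi>]])
      also have "hip F (a w \<eta>) (a z \<xi>) = hip E (\<Phi> z (a w \<eta>)) \<xi>"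
        using hip_adj[OF F ipsE \<Phi>[OF z] \<xi> a_mem[OF w True]] by (simp add: adj_\<Phi>[OF z \<xi>])
      finally show "hip E (K z w \<eta>) \<xi> = hip E (g z w *\<^sub>C \<Phi> z (a w \<eta>)) \<xi>"
        by (simp add: hip_scale_left[OF ipsE \<Phi>_mem \<xi>])
    qed
  next
    \<comment> \<open>Operators are total functions extended by 0, so the identity must also be
      checked off the carrier; both sides vanish there.\<close>
    case False
    then show ?thesis
      using op_off[OF bounded_ops_linear[OF kernel_bounded[OF rk z w]]]
        op_zero[OF bounded_ops_linear[OF \<Phi>[OF z]] ipsF] by (simp add: adj_off)
  qed
  then have "\<forall>z\<in>\<Omega>. \<forall>w\<in>\<Omega>. K z w = g z w *\<^sub>C (\<Phi> z \<circ> adj F E (\<Phi> w))"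
    by (simp add: fun_eq_iff scaleC_fun_apply)
  moreover have "holomorphic_into (bounded_ops F E) (opnorm F E) \<Omega> \<Phi>"
  proof (rule holomorphic_into_opnormI[OF E F \<Omega> \<Phi>])
    show "total_in F (hset F)"
      unfolding total_in_def
      by (auto intro!: bexI[OF _ complex_vector.span_base] simp: hnorm_zero[OF ipsF])
    show "holomorphic_into (hset E) (hnorm E) \<Omega> (\<lambda>z. \<Phi> z f)" if "f \<in> hset F" for f
      using HK_holomorphic[OF U_mem[OF that]] by (simp add: \<Phi>_apply[OF that])
    fix z assume z: "z \<in> \<Omega>"
    \<comment> \<open>\<Phi>(w) is evaluation at w after \<open>U\<close>; near z its norm is at
      most the local bound C for evaluations times the bound D for \<open>U\<close>.\<close>
    obtain r C where r: "r > 0" "ball z r \<subseteq> \<Omega>" "0 \<le> C"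
      and C: "\<And>w \<eta>. w \<in> ball z r \<Longrightarrow> \<eta> \<in> hset E \<Longrightarrow> hnorm HK (?k w \<eta>) \<le> C * hnorm E \<eta>"
      using rkhs_locally_bounded[OF rk \<Omega> HK_holomorphic z] by metis
    obtain D where D: "D > 0" "\<And>f. f \<in> hset F \<Longrightarrow> hnorm HK (U f) \<le> D * hnorm F f"
      using bounded_ops_bound[OF U ipsF] by metis
    have "hnorm E (\<Phi> w f) \<le> (C * D) * hnorm F f" if w: "w \<in> ball z r" and f: "f \<in> hset F" for w f
    proof -
      have w\<Omega>: "w \<in> \<Omega>" using w r by blast
      have "hnorm E (U f w) \<le> C * hnorm HK (U f)"
        by (rule eval_norm_le[OF rk U_mem[OF f] w\<Omega> r(3) C[OF w]])
      also have "\<dots> \<le> C * (D * hnorm F f)"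
        by (intro mult_left_mono D f r)
      finally show ?thesis by (simp add: \<Phi>_apply[OF f] mult.assoc)
    qed
    then show "\<exists>r>0. \<exists>C. \<forall>w\<in>\<Omega> \<inter> ball z r. \<forall>f\<in>hset F. hnorm E (\<Phi> w f) \<le> C * hnorm F f"
      using r(1) by blast
  qed
  ultimately show ?thesis
    unfolding factors_def by blast
qed

lemma factors_imp_dilates:
  fixes F :: "'f::complex_vector hspace"
  assumes F: "hilbert_space F" and fac: "factors E \<Omega> K g F"
  shows "dilates HK Hg F"
proof -
  note rk = E K HK
  note hK = rkhs_hilbert[OF rk] and hG = good_hilbert[OF good]
  note ipsE = hilbert_space_ips[OF E] and ipsF = hilbert_space_ips[OF F] and ipsK = hilbert_space_ips[OF hK]
    and ipsG = hilbert_space_ips[OF hG]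
  obtain \<Phi> where \<Phi>_hol: "holomorphic_into (bounded_ops F E) (opnorm F E) \<Omega> \<Phi>"
    and fac: "\<And>z w. z \<in> \<Omega> \<Longrightarrow> w \<in> \<Omega> \<Longrightarrow> K z w = g z w *\<^sub>C (\<Phi> z \<circ> adj F E (\<Phi> w))"
    using fac unfolding factors_def by blast
  have \<Phi>: "\<Phi> w \<in> bounded_ops F E" if "w \<in> \<Omega>" for w
    using \<Phi>_hol that by (simp add: differentiable_into_iff)
  have adj_\<Phi>: "adj F E (\<Phi> w) \<eta> \<in> hset F" if "w \<in> \<Omega>" "\<eta> \<in> hset E" for w \<eta>
    by (rule adj_mem[OF F ipsE \<Phi>[OF that(1)] that(2)])
  obtain T :: "((complex ^ 'n \<Rightarrow> complex) \<times> 'f \<Rightarrow> complex) hspace" and \<tau> where T: "is_tensor_product Hg F T \<tau>"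
    using tensor_product_exists[OF ipsG ipsF] by metis
  note tens = hG F T
  note hT = tensor_hilbert[OF tens]
  note ipsT = hilbert_space_ips[OF hT]
  let ?I = "\<Omega> \<times> hset E"
  let ?x = "\<lambda>(w, \<eta>). kernel_fun \<Omega> K w \<eta>" and ?y = "\<lambda>(w, \<eta>). \<tau> (kernel_at \<Omega> g w) (adj F E (\<Phi> w) \<eta>)"
  obtain V where V: "V \<in> isometries HK T" "\<And>i. i \<in> ?I \<Longrightarrow> V (?x i) = ?y i"
  proof (rule extend_isometry[OF hK hT rkhs_total[OF rk], of ?y])
    show "?y i \<in> hset T" if "i \<in> ?I" for i
      using that by (auto intro!: tensor_mem[OF tens] good_mem[OF good] adj_\<Phi>)
    fix i j assume "i \<in> ?I" "j \<in> ?I"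
    then obtain w \<eta> z \<xi> where i: "i = (w, \<eta>)" "w \<in> \<Omega>" "\<eta> \<in> hset E" and j: "j = (z, \<xi>)" "z \<in> \<Omega>" "\<xi> \<in> hset E"
      by auto
    \<comment> \<open>The factorization says precisely that the proposed images have the Gram matrix
      of the kernel functions of K: the first tensor factor contributes g(z, w), the second
      <\<Phi>(z) a, \<xi>> for a the image of \<eta> under the adjoint of \<Phi>(w).\<close>
    have "hip T (?y i) (?y j) = g z w * hip F (adj F E (\<Phi> w) \<eta>) (adj F E (\<Phi> z) \<xi>)"
      using i j by (simp add: tensor_hip[OF tens] good_mem[OF good] good_hip[OF good] adj_\<Phi>)
    also have "\<dots> = g z w * hip E (\<Phi> z (adj F E (\<Phi> w) \<eta>)) \<xi>"
      using hip_adj[OF F ipsE \<Phi>[OF j(2)] j(3) adj_\<Phi>[OF i(2,3)]] by simp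
    also have "\<dots> = hip E (K z w \<eta>) \<xi>"
      using i j op_mem[OF bounded_ops_linear[OF \<Phi>[OF j(2)]] adj_\<Phi>[OF i(2,3)]]
      by (simp add: fac scaleC_fun_apply hip_scale_left[OF ipsE])
    also have "\<dots> = hip HK (?x i) (?x j)"
      using i j by (simp add: kernel_fun_hip[OF rk])
    finally show "hip T (?y i) (?y j) = hip HK (?x i) (?x j)" .
  qed blast
  note Vb = isometries_bounded[OF V(1)]
  \<comment> \<open>On a kernel function at w both sides multiply its image by cnj(w_i): on the
    right it is an eigenvector in the space of K, on the left g(., w) is one in
    \<open>Hg\<close>.\<close>
  have "tensor_op Hg F T \<tau> (adj Hg Hg (M_op Hg i)) (id_op F) \<circ> V = V \<circ> adj HK HK (M_op HK i)" for i
  proof (rule bounded_ops_eq_on_total[OF hK ipsT _ _ rkhs_total[OF rk]])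
    have A: "adj Hg Hg (M_op Hg i) \<in> bounded_ops Hg Hg"
      by (rule adj_bounded[OF hG ipsG good_M_bounded[OF good]])
    note R = tensor_op_id[OF tens A]
    show "tensor_op Hg F T \<tau> (adj Hg Hg (M_op Hg i)) (id_op F) \<circ> V \<in> bounded_ops HK T"
      by (rule bounded_ops_comp[OF R(1) Vb ipsK ipsT ipsT])
    show "V \<circ> adj HK HK (M_op HK i) \<in> bounded_ops HK T"
      by (rule bounded_ops_comp[OF Vb adj_bounded[OF hK ipsK M_op_bounded(1)[OF rk module]] ipsK ipsK ipsT])
    fix s assume "s \<in> ?x ` ?I"
    then obtain w \<eta> where w: "w \<in> \<Omega>" "\<eta> \<in> hset E" "s = kernel_fun \<Omega> K w \<eta>" by auto
    have Vs: "V s = \<tau> (kernel_at \<Omega> g w) (adj F E (\<Phi> w) \<eta>)" using V(2)[of "(w, \<eta>)"] w by simp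
    show "(tensor_op Hg F T \<tau> (adj Hg Hg (M_op Hg i)) (id_op F) \<circ> V) s = (V \<circ> adj HK HK (M_op HK i)) s"
      using w(1,2) kernel_fun_mem[OF rk w(1,2)]
      by (simp add: Vs R(2) good_mem[OF good] adj_\<Phi> good_M_adj[OF good] tensor_scale_left[OF tens])
        (simp add: w(3) M_op_bounded(2)[OF rk module] op_scale[OF bounded_ops_linear[OF Vb]] flip: Vs)
  qed
  then show ?thesis
    unfolding dilates_def using T V(1) by blast
qed

text \<open>L(z, w) is \<Phi>(z) times the adjoint of \<Phi>(w); its quadratic form is the squared
  norm of the sum of the vectors obtained from \<eta>_q by the adjoint of \<Phi>(x_q).\<close>

lemma factors_imp_quotient_kernel:
  fixes F :: "'f::complex_vector hspace"
  assumes F: "hilbert_space F" and fac: "factors E \<Omega> K g F"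
  shows "\<exists>L. is_kernel E \<Omega> L \<and> sesqui_holomorphic E \<Omega> L \<and> (\<forall>z\<in>\<Omega>. \<forall>w\<in>\<Omega>. K z w = g z w *\<^sub>C L z w)"
proof -
  note ipsE = hilbert_space_ips[OF E] and ipsF = hilbert_space_ips[OF F]
  obtain \<Phi> where \<Phi>_hol: "holomorphic_into (bounded_ops F E) (opnorm F E) \<Omega> \<Phi>"
    and fac: "\<And>z w. z \<in> \<Omega> \<Longrightarrow> w \<in> \<Omega> \<Longrightarrow> K z w = g z w *\<^sub>C (\<Phi> z \<circ> adj F E (\<Phi> w))"
    using fac unfolding factors_def by blast
  have \<Phi>: "\<Phi> w \<in> bounded_ops F E" if "w \<in> \<Omega>" for w
    using \<Phi>_hol that by (simp add: differentiable_into_iff)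
  let ?L = "\<lambda>z w. \<Phi> z \<circ> adj F E (\<Phi> w)"
  have "is_kernel E \<Omega> ?L"
    unfolding is_kernel_def
  proof (intro conjI ballI allI impI)
    show "?L z w \<in> bounded_ops E E" if "z \<in> \<Omega>" "w \<in> \<Omega>" for z w
      by (rule bounded_ops_comp[OF \<Phi>[OF that(1)] adj_bounded[OF F ipsE \<Phi>[OF that(2)]] ipsE ipsF ipsE])
    fix m :: nat and x \<eta>
    assume "\<forall>j<m. x j \<in> \<Omega> \<and> \<eta> j \<in> hset E"
    then have x: "x j \<in> \<Omega>" "\<eta> j \<in> hset E" if "j < m" for j using that by auto
    let ?v = "\<lambda>q. adj F E (\<Phi> (x q)) (\<eta> q)"
    have v: "?v q \<in> hset F" if "q < m" for q
      by (rule adj_mem[OF F ipsE \<Phi>[OF x(1)[OF that]] x(2)[OF that]])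
    have "(\<Sum>p<m. \<Sum>q<m. hip E (?L (x p) (x q) (\<eta> q)) (\<eta> p)) = (\<Sum>p<m. \<Sum>q<m. hip F (?v q) (?v p))"
    proof (intro sum.cong refl)
      fix p q assume "p \<in> {..<m}" "q \<in> {..<m}"
      then have pq: "p < m" "q < m" by auto
      show "hip E (?L (x p) (x q) (\<eta> q)) (\<eta> p) = hip F (?v q) (?v p)"
        using hip_adj[OF F ipsE \<Phi>[OF x(1)[OF pq(1)]] x(2)[OF pq(1)] v[OF pq(2)]] by simp
    qed
    also have "\<dots> = hip F (\<Sum>q<m. ?v q) (\<Sum>q<m. ?v q)"
      by (rule hip_sum_self[OF ipsF, symmetric]) (use v in simp)
    also have "\<dots> \<in> \<real>\<^sub>\<ge>\<^sub>0"
      using hset_sum[OF ipsF, of "{..<m}" ?v] v by (simp add: hip_self[OF ipsF] del: of_real_power)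
    finally show "(\<Sum>p<m. \<Sum>q<m. hip E (?L (x p) (x q) (\<eta> q)) (\<eta> p)) \<in> \<real>\<^sub>\<ge>\<^sub>0" .
  qed
  then show ?thesis
    using sesqui_holomorphic_factorization[OF E F \<Omega> \<Phi>_hol] fac by blast
qed

text \<open>Here \<open>\<Phi>\<close> is point evaluation on \<open>\<H>\<^sub>L\<close>. It is locally bounded since \<open>g(z, z) \<ge> 1\<close> for a good
  kernel, whence \<open>\<parallel>L(z, z)\<parallel> \<le> \<parallel>K(z, z)\<parallel>\<close>.\<close>

lemma quotient_kernel_imp_factors:
  assumes L: "is_kernel E \<Omega> L" and L_hol: "sesqui_holomorphic E \<Omega> L"
    and quotient: "\<forall>z\<in>\<Omega>. \<forall>w\<in>\<Omega>. K z w = g z w *\<^sub>C L z w"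
  shows "\<exists>F :: (complex ^ 'n \<Rightarrow> 'e) hspace. hilbert_space F \<and> factors E \<Omega> K g F"
proof -
  obtain F where HL: "is_rkhs E \<Omega> L F"
    using rkhs_exists[OF E L] by metis
  note rk = E K HK and rkL = E L HL and KL = quotient[rule_format]
  note F = rkhs_hilbert[OF rkL]
  note ipsE = hilbert_space_ips[OF E] and ipsF = hilbert_space_ips[OF F]
  let ?\<Phi> = "eval_op F"
  let ?S = "(\<lambda>(w, \<eta>). kernel_fun \<Omega> L w \<eta>) ` (\<Omega> \<times> hset E)"
  have "holomorphic_into (bounded_ops F E) (opnorm F E) \<Omega> ?\<Phi>"
  \<comment> \<open>The total set consists of kernel functions of L, on which evaluation gives L(z,
    w) \<eta>, holomorphic in z by assumption. Holomorphy thus has to be known only on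
    generators.\<close>
  proof (rule holomorphic_into_opnormI[OF E F \<Omega> eval_op_bounded[OF rkL] rkhs_total[OF rkL]])
    fix f assume "f \<in> ?S"
    then obtain w \<eta> where w: "w \<in> \<Omega>" "\<eta> \<in> hset E" "f = kernel_fun \<Omega> L w \<eta>" by auto
    have apply_f: "?\<Phi> z f = L z w \<eta>" if "z \<in> \<Omega>" for z
      using kernel_fun_mem[OF rkL w(1,2)] that
      by (simp add: w(3) eval_op_def zero_ext_def kernel_fun_apply[OF rkL])
    have "holomorphic_into (hset E) (hnorm E) \<Omega> (\<lambda>z. L z w \<eta>)"
      using L_hol w by (intro holomorphic_into_apply[OF ipsE ipsE \<Omega>]) (auto simp: sesqui_holomorphic_def)
    then show "holomorphic_into (hset E) (hnorm E) \<Omega> (\<lambda>z. ?\<Phi> z f)"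
      by (rule differentiable_into_cong[OF \<Omega> ipsE]) (simp add: apply_f)
  next
    fix z assume z: "z \<in> \<Omega>"
    obtain r C where r: "r > 0" "ball z r \<subseteq> \<Omega>" "0 \<le> C"
      and C: "\<And>w \<eta>. w \<in> ball z r \<Longrightarrow> \<eta> \<in> hset E \<Longrightarrow> hnorm HK (kernel_fun \<Omega> K w \<eta>) \<le> C * hnorm E \<eta>"
      using rkhs_locally_bounded[OF rk \<Omega> HK_holomorphic z] by metis
    have "hnorm E (?\<Phi> w f) \<le> C * hnorm F f" if w: "w \<in> ball z r" and f: "f \<in> hset F" for w f
    proof -
      have w\<Omega>: "w \<in> \<Omega>" using w r by blast
      obtain c where c: "c \<ge> 1" "g w w = of_real c"
        using good_diag_ge_1[OF good w\<Omega>] by blast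
      have "hnorm F (kernel_fun \<Omega> L w \<eta>) \<le> C * hnorm E \<eta>" if \<eta>: "\<eta> \<in> hset E" for \<eta>
      proof (rule power2_le_imp_le)
        have L_mem: "L w w \<eta> \<in> hset E" by (rule kernel_mem[OF rkL w\<Omega> w\<Omega> \<eta>])
        have "(hnorm HK (kernel_fun \<Omega> K w \<eta>))\<^sup>2 = c * (hnorm F (kernel_fun \<Omega> L w \<eta>))\<^sup>2"
          using kernel_fun_norm_sq[OF rk w\<Omega> \<eta>] kernel_fun_norm_sq[OF rkL w\<Omega> \<eta>] L_mem \<eta>
          by (simp add: KL[OF w\<Omega> w\<Omega>] scaleC_fun_apply hip_scale_left[OF ipsE] c(2))
        moreover have "1 * (hnorm F (kernel_fun \<Omega> L w \<eta>))\<^sup>2 \<le> c * (hnorm F (kernel_fun \<Omega> L w \<eta>))\<^sup>2"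
          by (intro mult_right_mono c) simp
        moreover have "(hnorm HK (kernel_fun \<Omega> K w \<eta>))\<^sup>2 \<le> (C * hnorm E \<eta>)\<^sup>2"
          by (intro power_mono C w \<eta> hnorm_nonneg[OF rkhs_ips[OF rk]] kernel_fun_mem[OF rk] w\<Omega>)
        ultimately show "(hnorm F (kernel_fun \<Omega> L w \<eta>))\<^sup>2 \<le> (C * hnorm E \<eta>)\<^sup>2" by linarith
        show "0 \<le> C * hnorm E \<eta>" using r(3) \<eta> by (simp add: hnorm_nonneg[OF ipsE])
      qed
      then show ?thesis
        using eval_norm_le[OF rkL f w\<Omega> r(3)] f by (simp add: eval_op_def zero_ext_def)
    qed
    then show "\<exists>r>0. \<exists>C. \<forall>w\<in>\<Omega> \<inter> ball z r. \<forall>f\<in>hset F. hnorm E (?\<Phi> w f) \<le> C * hnorm F f"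
      using r(1) by blast
  qed
  moreover have "K z w = g z w *\<^sub>C (?\<Phi> z \<circ> adj F E (?\<Phi> w))" if z: "z \<in> \<Omega>" and w: "w \<in> \<Omega>" for z w
  proof -
    have "L z w \<eta> = ?\<Phi> z (adj F E (?\<Phi> w) \<eta>)" for \<eta>
    proof (cases "\<eta> \<in> hset E")
      case True
      then show ?thesis
        using kernel_fun_mem[OF rkL w True] z
        by (simp add: adj_eval_op[OF rkL w] eval_op_def[of F z] zero_ext_def kernel_fun_apply[OF rkL])
    next
      case False
      then show ?thesis
        using op_off[OF bounded_ops_linear[OF kernel_bounded[OF rkL z w]]]
          op_zero[OF bounded_ops_linear[OF eval_op_bounded[OF rkL z]] ipsF] by (simp add: adj_off)
    qed
    then show ?thesis by (simp add: KL[OF z w] fun_eq_iff scaleC_fun_apply)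
  qed
  ultimately show ?thesis
    using F unfolding factors_def by blast
qed

end

theorem corollary6p2:
  fixes \<Omega> :: "(complex ^ 'n) set"
    and E :: "'e::complex_vector hspace"
    and g :: "complex ^ 'n \<Rightarrow> complex ^ 'n \<Rightarrow> complex"
    and Hg :: "(complex ^ 'n \<Rightarrow> complex) hspace"
    and K :: "complex ^ 'n \<Rightarrow> complex ^ 'n \<Rightarrow> 'e \<Rightarrow> 'e"
    and HK :: "(complex ^ 'n \<Rightarrow> 'e) hspace"
  assumes "bounded_domain \<Omega>"
    and "hilbert_space E"
    and "good_kernel \<Omega> g Hg"
    and "sesqui_holomorphic complex_hspace \<Omega> (scalar_kernel g)"
    and "is_kernel E \<Omega> K"
    and "is_rkhs E \<Omega> K HK"
    and "is_module HK"
    and "sesqui_holomorphic E \<Omega> K"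
    and "\<forall>f\<in>hset HK. holomorphic_into (hset E) (hnorm E) \<Omega> f"
    and "\<forall>w\<in>\<Omega>. \<exists>z\<in>\<Omega>. K z w \<noteq> 0"
  shows
    \<comment> \<open>(a) and (b) are equivalent, for every Hilbert space\<close>
    "(\<forall>F :: 'f::complex_vector hspace. hilbert_space F \<longrightarrow>
        (dilates HK Hg F \<longleftrightarrow> factors E \<Omega> K g F)) \<and>
    \<comment> \<open>(1) implies (2), the Hilbert space in (1) being of arbitrary type\<close>
     ((\<exists>F :: 'f hspace. hilbert_space F \<and> dilates HK Hg F \<and> factors E \<Omega> K g F) \<longrightarrow>
        (\<exists>L. is_kernel E \<Omega> L \<and> sesqui_holomorphic E \<Omega> L \<and>
             (\<forall>z\<in>\<Omega>. \<forall>w\<in>\<Omega>. K z w = g z w *\<^sub>C L z w))) \<and>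
    \<comment> \<open>(1) is equivalent to (2), the Hilbert space in (1) consisting of functions with values in E\<close>
     ((\<exists>F :: (complex ^ 'n \<Rightarrow> 'e) hspace.
          hilbert_space F \<and> dilates HK Hg F \<and> factors E \<Omega> K g F) \<longleftrightarrow>
        (\<exists>L. is_kernel E \<Omega> L \<and> sesqui_holomorphic E \<Omega> L \<and>
             (\<forall>z\<in>\<Omega>. \<forall>w\<in>\<Omega>. K z w = g z w *\<^sub>C L z w)))"
proof -
  have \<Omega>: "open \<Omega>"
    using assms(1) by (simp add: bounded_domain_def)
  note ctxt = \<Omega> assms(2,3,5,6,7,9)
  let ?quotient = "\<lambda>L. is_kernel E \<Omega> L \<and> sesqui_holomorphic E \<Omega> L \<and> (\<forall>z\<in>\<Omega>. \<forall>w\<in>\<Omega>. K z w = g z w *\<^sub>C L z w)"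
  have "dilates HK Hg F \<longleftrightarrow> factors E \<Omega> K g F" if "hilbert_space F" for F :: "'f hspace"
    using dilates_imp_factors[OF ctxt that] factors_imp_dilates[OF ctxt that] by blast
  moreover have "\<exists>L. ?quotient L" if "hilbert_space F" "factors E \<Omega> K g F" for F :: "'f hspace"
    by (rule factors_imp_quotient_kernel[OF ctxt that])
  \<comment> \<open>The same lemma once more, at the type of functions into E: \<open>'f\<close> is
    fixed in the statement, and the equivalence with (2) needs its own instance.\<close>
  moreover have "\<exists>L. ?quotient L" if "hilbert_space F" "factors E \<Omega> K g F" for F :: "(complex ^ 'n \<Rightarrow> 'e) hspace"
    by (rule factors_imp_quotient_kernel[OF ctxt that])
  \<comment> \<open>The witness is the reproducing kernel space of L, whose elements are functions
    with values in E; this determines the type at which (1) is asserted.\<close>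
  moreover have "\<exists>F :: (complex ^ 'n \<Rightarrow> 'e) hspace. hilbert_space F \<and> dilates HK Hg F \<and> factors E \<Omega> K g F"
    if "?quotient L" for L
    using quotient_kernel_imp_factors[OF ctxt, of L] factors_imp_dilates[OF ctxt] that by blast
  ultimately show ?thesis by blast
qed

end
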